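(* Let $f:(\mathbb{C}^n,0)\to(\mathbb{C}^p,0)$ be a singular monomial map-germ of corank $q$ with $p\ge 2n$. Then $f$ is $\mathcal{A}$-finite if and only if $f$ is $\mathcal{A}$-equivalent to a map-germ $(\mathbb{C}^n,0)\to(\mathbb{C}^p,0)$ of the form $$(I*\phi_{k_1}*\cdots*\phi_{k_q})_H(\underline{x},\underline{y})=(\underline{x},\ \phi_{k_1}(y_1),\ldots,\phi_{k_q}(y_q),\ H(\underline{x},\underline{y})),$$ where $\underline{x}=(x_1,\ldots,x_{n-q})$, $\underline{y}=(y_1,\ldots,y_q)$, $I$ is the identity of $\mathbb{C}^{n-q}$, each $\phi_{k_j}(y_j)=(y_j^{m_j},y_j^{m_{j2}},\ldots,y_j^{m_{jk_j}})$ is a primitive parameterized monomial curve in $\mathbb{C}^{k_j}$ with $1<m_j<m_{j2}<\cdots<m_{jk_j}$, and $$H(\underline{x},\underline{y})=(\underline{x}^{\lambda_{i1}}y_1,\ldots,\underline{x}^{\lambda_{iq}}y_q,\ H_1(\underline{y}),\ldots,H_q(\underline{y}),\ h(\underline{x},\underline{y}))$$ with $\underline{x}^{\lambda_{ij}}y_j:=(x_1^{\lambda_{1j}}y_j,\ldots,x_{n-q}^{\lambda_{(n-q)j}}y_j)$ and $H_j(\underline{y}):=(y_j^{\mu_{j1}}y_1,\ldots,y_j^{\mu_{j(j-1)}}y_{j-1},y_j^{\mu_{j(j+1)}}y_{j+1},\ldots,y_j^{\mu_{jq}}y_q)$, for some integers $\lambda_{ij}\ge 1$ and $\mu_{jt}\ge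 1$ ($1\le i\le n-q$, $1\le j,t\le q$, $t\neq j$), and some monomial map $h$ that is zero on each coordinate axis; here, if $\mu_{jt}=\mu_{tj}=1$ for some $j\ne t$, the component $y_jy_t$, which occurs in both $H_j$ and $H_t$, is listed only once. In particular, if all $\mu_{jt}=1$, the map $H$ can be given by $$H(\underline{x},\underline{y})=(\underline{x}^{\lambda_{i1}}y_1,\ldots,\underline{x}^{\lambda_{iq}}y_q,\ y_1y_2,\ldots,y_1y_q,\ y_2y_3,\ldots,y_2y_q,\ldots,y_{q-1}y_q,\ h(\underline{x},\underline{y})).$$
   Context: All germs are holomorphic. Two germs $f,g:(\mathbb{C}^n,0)\to(\mathbb{C}^p,0)$ are $\mathcal{A}$-equivalent if $g=\psi\circ f\circ\rho^{-1}$ for germs of biholomorphisms $\rho$ of $(\mathbb{C}^n,0)$ and $\psi$ of $(\mathbb{C}^p,0)$. A germ $f$ is $\mathcal{A}$-finite (finitely determined) if there is $r<\infty$ such that every germ $g:(\mathbb{C}^n,0)\to(\mathbb{C}^p,0)$ with the same $r$-jet at $0$ as $f$ is $\mathcal{A}$-equivalent to $f$. The corank of $f$ is $n-\operatorname{rank} df_0$, and $f$ is singular if its corank is at least $1$. A map-germ is monomial if each of its components is a monomial in the source coordinates (the zero component is allowed). A monomial curve $(y^{m_1},\ldots,y^{m_k})$ is primitive if $\gcd(m_1,\ldots,m_k)=1$. The map $h$ may have zero components, or no components at all; the number of its components is such that the total target dimension is $p$. *)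

theory Defs
  imports "HOL-Analysis.Analysis"
begin

text \<open>
  Germs at the origin are represented by functions on the whole space of which only the
  behaviour near \<open>0\<close> matters: identities between germs are stated with
  \<open>\<forall>\<^sub>F z in nhds 0\<close>.
\<close>

definition complex_differentiable_at :: "(complex^'n \<Rightarrow> complex^'m) \<Rightarrow> complex^'n \<Rightarrow> bool" where
  "complex_differentiable_at f z \<longleftrightarrow>
     (\<exists>D. (f has_derivative D) (at z) \<and> (\<forall>c v. D (c *s v) = c *s D v))"

definition map_germ :: "(complex^'n \<Rightarrow> complex^'m) \<Rightarrow> bool" where
  "map_germ f \<longleftrightarrow> f 0 = 0 \<and> (\<forall>\<^sub>F z in nhds 0. complex_differentiable_at f z)"

definition inverse_germs :: "(complex^'n \<Rightarrow> complex^'n) \<Rightarrow> (complex^'n \<Rightarrow> complex^'n) \<Rightarrow> bool" where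
  "inverse_germs \<rho> \<rho>' \<longleftrightarrow> map_germ \<rho> \<and> map_germ \<rho>' \<and>
     (\<forall>\<^sub>F z in nhds 0. \<rho>' (\<rho> z) = z) \<and> (\<forall>\<^sub>F z in nhds 0. \<rho> (\<rho>' z) = z)"

definition A_equivalent :: "(complex^'n \<Rightarrow> complex^'p) \<Rightarrow> (complex^'n \<Rightarrow> complex^'p) \<Rightarrow> bool" where
  "A_equivalent f g \<longleftrightarrow>
     (\<exists>\<rho> \<rho>' \<psi> \<psi>'. inverse_germs \<rho> \<rho>' \<and> inverse_germs \<psi> \<psi>' \<and>
        (\<forall>\<^sub>F z in nhds 0. g z = \<psi> (f (\<rho>' z))))"

definition partial :: "'n \<Rightarrow> (complex^'n \<Rightarrow> complex) \<Rightarrow> complex^'n \<Rightarrow> complex" where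
  "partial j c z = deriv (\<lambda>t. c (z + axis j t)) 0"

text \<open>Equality of \<open>r\<close>-jets at \<open>0\<close>: all iterated partial derivatives of order at most \<open>r\<close>
  agree there (the empty list \<open>js\<close> gives the value).\<close>

definition same_jet :: "nat \<Rightarrow> (complex^'n \<Rightarrow> complex^'p) \<Rightarrow> (complex^'n \<Rightarrow> complex^'p) \<Rightarrow> bool" where
  "same_jet r f g \<longleftrightarrow>
     (\<forall>js k. length js \<le> r \<longrightarrow>
        fold partial js (\<lambda>z. f z $ k) 0 = fold partial js (\<lambda>z. g z $ k) 0)"

definition A_finite :: "(complex^'n \<Rightarrow> complex^'p) \<Rightarrow> bool" where
  "A_finite f \<longleftrightarrow> (\<exists>r. \<forall>g. map_germ g \<and> same_jet r f g \<longrightarrow> A_equivalent g f)"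

definition jacobian_at_0 :: "(complex^'n \<Rightarrow> complex^'p) \<Rightarrow> complex^'n^'p" where
  "jacobian_at_0 f = (\<chi> k j. partial j (\<lambda>z. f z $ k) 0)"

definition corank :: "(complex^'n \<Rightarrow> complex^'p) \<Rightarrow> nat" where
  "corank f = CARD('n) - rank (jacobian_at_0 f)"

definition singular :: "(complex^'n \<Rightarrow> complex^'p) \<Rightarrow> bool" where
  "singular f \<longleftrightarrow> corank f \<ge> 1"

text \<open>A monomial is a product of powers of the coordinates, with coefficient \<open>1\<close>.
  The zero function is admitted as a component.\<close>

definition monomial_or_zero :: "(complex^'n \<Rightarrow> complex) \<Rightarrow> bool" where
  "monomial_or_zero c \<longleftrightarrow>
     (\<exists>a. c = (\<lambda>z. \<Prod>i\<in>UNIV. (z $ i) ^ a i)) \<or> c = (\<lambda>z. 0)"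

definition monomial_germ :: "(complex^'n \<Rightarrow> complex^'p) \<Rightarrow> bool" where
  "monomial_germ f \<longleftrightarrow>
     (\<forall>k. \<exists>c. monomial_or_zero c \<and> (\<forall>\<^sub>F z in nhds 0. f z $ k = c z))"

definition zero_on_axes :: "(complex^'n \<Rightarrow> complex) \<Rightarrow> bool" where
  "zero_on_axes c \<longleftrightarrow> (\<forall>i t. c (axis i t) = 0)"

definition primitive :: "nat list \<Rightarrow> bool" where
  "primitive ms \<longleftrightarrow> Gcd (set ms) = 1"

text \<open>
  The coordinates of \<open>\<complex>\<^sup>n\<close> are numbered by a bijection \<open>src\<close> from \<open>{..<n}\<close> to the index type:
  with indices starting at \<open>0\<close>, the coordinate \<open>x\<^sub>i\<close> (\<open>i < n - q\<close>) has number \<open>i\<close> and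
  \<open>y\<^sub>j\<close> (\<open>j < q\<close>) has number \<open>n - q + j\<close>.
\<close>

definition xc :: "(nat \<Rightarrow> 'n) \<Rightarrow> nat \<Rightarrow> complex^'n \<Rightarrow> complex" where
  "xc src i z = z $ src i"

definition yc :: "(nat \<Rightarrow> 'n::finite) \<Rightarrow> nat \<Rightarrow> nat \<Rightarrow> complex^'n \<Rightarrow> complex" where
  "yc src q j z = z $ src (CARD('n) - q + j)"

text \<open>
  Data of a normal form: \<open>m j\<close> is the list of exponents of the curve \<open>\<phi>\<close> in \<open>y\<^sub>j\<close>
  (so \<open>k\<^sub>j = length (m j)\<close>), \<open>lam i j\<close> and \<open>mu j t\<close> are the exponents in \<open>H\<close>, and \<open>hs\<close> is the
  list, possibly empty, of the components of \<open>h\<close>.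
\<close>

definition normal_form_data ::
  "nat \<Rightarrow> (nat \<Rightarrow> nat list) \<Rightarrow> (nat \<Rightarrow> nat \<Rightarrow> nat) \<Rightarrow> (nat \<Rightarrow> nat \<Rightarrow> nat) \<Rightarrow>
    (complex^'n \<Rightarrow> complex) list \<Rightarrow> bool" where
  "normal_form_data q m lam mu hs \<longleftrightarrow>
     (\<forall>j<q. primitive (m j) \<and> sorted_wrt (<) (m j) \<and> (\<forall>e\<in>set (m j). 1 < e)) \<and>
     (\<forall>i<CARD('n) - q. \<forall>j<q. lam i j \<ge> 1) \<and>
     (\<forall>j<q. \<forall>t<q. t \<noteq> j \<longrightarrow> mu j t \<ge> 1) \<and>
     (\<forall>c\<in>set hs. monomial_or_zero c \<and> zero_on_axes c)"

definition x_block :: "(nat \<Rightarrow> 'n::finite) \<Rightarrow> nat \<Rightarrow> complex^'n \<Rightarrow> complex list" where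
  "x_block src q z = [xc src i z. i \<leftarrow> [0..<CARD('n) - q]]"

definition phi_block ::
  "(nat \<Rightarrow> 'n::finite) \<Rightarrow> nat \<Rightarrow> (nat \<Rightarrow> nat list) \<Rightarrow> complex^'n \<Rightarrow> complex list" where
  "phi_block src q m z = [yc src q j z ^ e. j \<leftarrow> [0..<q], e \<leftarrow> m j]"

definition xy_block ::
  "(nat \<Rightarrow> 'n::finite) \<Rightarrow> nat \<Rightarrow> (nat \<Rightarrow> nat \<Rightarrow> nat) \<Rightarrow> complex^'n \<Rightarrow> complex list" where
  "xy_block src q lam z =
     [xc src i z ^ lam i j * yc src q j z. j \<leftarrow> [0..<q], i \<leftarrow> [0..<CARD('n) - q]]"

text \<open>The concatenation of \<open>H\<^sub>1, \<dots>, H\<^sub>q\<close>. If \<open>\<mu>\<^sub>j\<^sub>t = \<mu>\<^sub>t\<^sub>j = 1\<close>, the component \<open>y\<^sub>j y\<^sub>t\<close> is kept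
  only in the block with the smaller index.\<close>

definition yy_block ::
  "(nat \<Rightarrow> 'n::finite) \<Rightarrow> nat \<Rightarrow> (nat \<Rightarrow> nat \<Rightarrow> nat) \<Rightarrow> complex^'n \<Rightarrow> complex list" where
  "yy_block src q mu z =
     [yc src q j z ^ mu j t * yc src q t z. j \<leftarrow> [0..<q], t \<leftarrow> [0..<q],
        t \<noteq> j \<and> \<not> (t < j \<and> mu j t = 1 \<and> mu t j = 1)]"

definition H_map ::
  "(nat \<Rightarrow> 'n::finite) \<Rightarrow> nat \<Rightarrow> (nat \<Rightarrow> nat \<Rightarrow> nat) \<Rightarrow> (nat \<Rightarrow> nat \<Rightarrow> nat) \<Rightarrow>
    (complex^'n \<Rightarrow> complex) list \<Rightarrow> complex^'n \<Rightarrow> complex list" where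
  "H_map src q lam mu hs z =
     xy_block src q lam z @ yy_block src q mu z @ [c z. c \<leftarrow> hs]"

definition H_map_simple ::
  "(nat \<Rightarrow> 'n::finite) \<Rightarrow> nat \<Rightarrow> (nat \<Rightarrow> nat \<Rightarrow> nat) \<Rightarrow>
    (complex^'n \<Rightarrow> complex) list \<Rightarrow> complex^'n \<Rightarrow> complex list" where
  "H_map_simple src q lam hs z =
     xy_block src q lam z @
     [yc src q j z * yc src q t z. j \<leftarrow> [0..<q], t \<leftarrow> [Suc j..<q]] @
     [c z. c \<leftarrow> hs]"

text \<open>\<open>has_components tgt g L\<close>: the components of \<open>g\<close>, in the numbering \<open>tgt\<close> of the target
  coordinates, are exactly those listed by \<open>L\<close>.\<close>

definition has_components ::
  "(nat \<Rightarrow> 'p::finite) \<Rightarrow> (complex^'n \<Rightarrow> complex^'p) \<Rightarrow> (complex^'n \<Rightarrow> complex list) \<Rightarrow> bool" where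
  "has_components tgt g L \<longleftrightarrow>
     (\<forall>z. length (L z) = CARD('p) \<and> (\<forall>k<CARD('p). g z $ tgt k = L z ! k))"

definition normal_form ::
  "(nat \<Rightarrow> 'n::finite) \<Rightarrow> (nat \<Rightarrow> 'p::finite) \<Rightarrow> nat \<Rightarrow> (complex^'n \<Rightarrow> complex^'p) \<Rightarrow> bool" where
  "normal_form src tgt q g \<longleftrightarrow>
     (\<exists>m lam mu hs. normal_form_data q m lam mu hs \<and>
        has_components tgt g
          (\<lambda>z. x_block src q z @ phi_block src q m z @ H_map src q lam mu hs z))"

end

theory Submission
  imports Defs "HOL-Complex_Analysis.Cauchy_Integral_Formula"
begin

text \<open>
  Call the set \<open>E\<close> of exponents of the components of \<open>f\<close> good if for every coordinate \<open>z\<^sub>j\<close> the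
  powers of \<open>z\<^sub>j\<close> in \<open>E\<close> have coprime exponents and for every \<open>i \<noteq> j\<close> some \<open>z\<^sub>i\<^sup>l z\<^sub>j\<close> is in \<open>E\<close>.
  The theorem follows from the equivalence of this condition with \<open>\<A>\<close>-finiteness.

  If \<open>E\<close> is good, then the semigroup it generates contains all exponents of large degree. Hence if
  \<open>g\<close> and \<open>f\<close> have the same jet of high order, then substituting products of components of \<open>f\<close> for
  the monomials in the Taylor series of \<open>g - f\<close> gives \<open>g = (id + \<eta>) \<circ> f\<close> with \<open>\<eta>\<close> of order at least 2,
  and \<open>id + \<eta>\<close> is invertible: no source coordinate change is needed.

  If \<open>E\<close> is not good, then along a coordinate axis \<open>f\<close> is not immersive or has a curve of double
  points, and this is preserved by \<open>\<A>\<close>-equivalence. Since \<open>p \<ge> 2n\<close>, a generic polynomial perturbation of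
  \<open>f\<close> of arbitrarily high order is immersive off the origin and has no curve of double points, so \<open>f\<close> is
  not \<open>\<A>\<close>-finite. Genericity is a dimension count: the bad perturbations form a null set.
\<close>

subsection \<open>Holomorphic functions of several variables\<close>

text \<open>Degeneracy links the two directions: the axis conditions speak of exponents and have no
  evident meaning for a germ that is merely equivalent to a monomial one, whereas non-immersive
  points and double points are carried along by coordinate changes. The conditions are then read off
  again from a monomial germ. The origin is excluded from the non-immersive points because a
  singular germ is never immersive there. Single double points cannot serve as the obstruction: for
  p = 2n the double-point equations have as many equations as unknowns, so isolated solutions may
  survive every small perturbation. A connected set of solutions is one dimension too many, and a
  non-immersive point also yields such a set, since its kernel vectors can be rescaled; hence one
  null-set argument treats both cases. For sufficiency, the hypothesis on jets concerns iterated
  one-variable derivatives at 0 of functions that are complex differentiable near 0. The passage to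
  an absolutely convergent power series, with coefficient bounds strong enough for the substitution,
  is built up variable by variable.\<close>

definition holomorphic_at :: "(complex^'n \<Rightarrow> complex) \<Rightarrow> complex^'n \<Rightarrow> bool" where
  "holomorphic_at h z \<longleftrightarrow> (\<exists>D. (h has_derivative D) (at z) \<and> (\<forall>c v. D (c *s v) = c * D v))"

lemma norm_smult_complex: "norm (c *s x) = norm c * norm (x :: complex^'n)"
  by (simp add: norm_vec_def norm_mult L2_set_right_distrib)

lemma bounded_bilinear_smult: "bounded_bilinear (\<lambda>c (x :: complex^'n). c *s x)"
proof (rule bounded_bilinear.intro)
  show "\<exists>K. \<forall>a (b :: complex^'n). norm (a *s b) \<le> norm a * norm b * K"
    by (rule exI[of _ 1]) (simp add: norm_smult_complex)
qed (simp_all add: vec_eq_iff algebra_simps)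

lemma bounded_linear_axis: "bounded_linear (axis k :: 'a::real_normed_vector \<Rightarrow> 'a^'n)"
proof
  show "\<exists>K. \<forall>x::'a. norm (axis k x :: 'a^'n) \<le> norm x * K"
  proof (intro exI allI)
    fix x :: 'a
    have "norm (axis k x :: 'a^'n) \<le> (\<Sum>i\<in>UNIV. norm ((axis k x :: 'a^'n) $ i))"
      unfolding norm_vec_def by (rule L2_set_le_sum) simp
    also have "\<dots> = norm x * 1"
      by (simp add: axis_def if_distrib[of norm] cong: if_cong)
    finally show "norm (axis k x :: 'a^'n) \<le> norm x * 1" .
  qed
qed (simp_all add: axis_def vec_eq_iff)

lemma vec_lambda_eq_sum_axis: "(\<chi> k. F k) = (\<Sum>k\<in>UNIV. axis k (F k :: 'a::real_normed_vector))"
  by (simp add: vec_eq_iff axis_def if_distrib cong: if_cong)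

lemma has_derivative_vec_lambda:
  fixes F :: "'k::finite \<Rightarrow> 'x::real_normed_vector \<Rightarrow> 'a::real_normed_vector"
  assumes "\<And>k. (F k has_derivative D k) (at x within S)"
  shows "((\<lambda>x. \<chi> k. F k x) has_derivative (\<lambda>v. \<chi> k. D k v)) (at x within S)"
  unfolding vec_lambda_eq_sum_axis
  by (intro has_derivative_sum bounded_linear.has_derivative[OF bounded_linear_axis] assms)

lemma complex_differentiable_at_iff:
  "complex_differentiable_at f z \<longleftrightarrow> (\<forall>k. holomorphic_at (\<lambda>z. f z $ k) z)"
proof
  assume "complex_differentiable_at f z"
  then obtain D where D: "(f has_derivative D) (at z)" "\<And>c v. D (c *s v) = c *s D v"
    unfolding complex_differentiable_at_def by blast
  show "\<forall>k. holomorphic_at (\<lambda>z. f z $ k) z"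
    unfolding holomorphic_at_def
  proof (intro allI exI conjI)
    fix k show "((\<lambda>z. f z $ k) has_derivative (\<lambda>v. D v $ k)) (at z)"
      by (rule bounded_linear.has_derivative[OF bounded_linear_vec_nth D(1)])
  qed (simp add: D)
next
  assume "\<forall>k. holomorphic_at (\<lambda>z. f z $ k) z"
  then obtain D where D: "\<And>k. ((\<lambda>z. f z $ k) has_derivative D k) (at z)" "\<And>k c v. D k (c *s v) = c * D k v"
    unfolding holomorphic_at_def by metis
  have "(f has_derivative (\<lambda>v. \<chi> k. D k v)) (at z)"
    using has_derivative_vec_lambda[of "\<lambda>k z. f z $ k" D z UNIV] D(1) by simp
  then show "complex_differentiable_at f z"
    unfolding complex_differentiable_at_def using D(2)
    by (intro exI[of _ "\<lambda>v. \<chi> k. D k v"]) (simp add: vec_eq_iff)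
qed

lemma complex_differentiable_at_compose:
  assumes "complex_differentiable_at f z" "complex_differentiable_at g (f z)"
  shows "complex_differentiable_at (\<lambda>z. g (f z)) z"
proof -
  obtain D where D: "(f has_derivative D) (at z)" "\<And>c v. D (c *s v) = c *s D v"
    using assms(1) unfolding complex_differentiable_at_def by blast
  obtain E where E: "(g has_derivative E) (at (f z))" "\<And>c v. E (c *s v) = c *s E v"
    using assms(2) unfolding complex_differentiable_at_def by blast
  show ?thesis unfolding complex_differentiable_at_def
    using has_derivative_compose[OF D(1) E(1)] D(2) E(2) by (intro exI[of _ "\<lambda>v. E (D v)"]) simp
qed

lemma holomorphic_at_continuous: "holomorphic_at h z \<Longrightarrow> isCont h z"
  unfolding holomorphic_at_def using has_derivative_continuous by blast

lemma complex_differentiable_at_continuous: "complex_differentiable_at f z \<Longrightarrow> isCont f z"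
  unfolding complex_differentiable_at_def using has_derivative_continuous by blast

lemma holomorphic_at_const [simp]: "holomorphic_at (\<lambda>z. c) z"
  unfolding holomorphic_at_def by (intro exI[of _ "\<lambda>v. 0"]) simp

lemma holomorphic_at_nth [simp]: "holomorphic_at (\<lambda>z. z $ i) z"
  unfolding holomorphic_at_def by (intro exI[of _ "\<lambda>v. v $ i"]) (simp add: bounded_linear_imp_has_derivative[OF bounded_linear_vec_nth])

lemma holomorphic_at_add:
  assumes "holomorphic_at f z" "holomorphic_at g z" shows "holomorphic_at (\<lambda>z. f z + g z) z"
proof -
  obtain D where D: "(f has_derivative D) (at z)" "\<And>c v. D (c *s v) = c * D v"
    using assms(1) unfolding holomorphic_at_def by blast
  obtain E where E: "(g has_derivative E) (at z)" "\<And>c v. E (c *s v) = c * E v"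
    using assms(2) unfolding holomorphic_at_def by blast
  show ?thesis unfolding holomorphic_at_def
    using has_derivative_add[OF D(1) E(1)] D(2) E(2)
    by (intro exI[of _ "\<lambda>v. D v + E v"]) (simp add: algebra_simps)
qed

lemma holomorphic_at_mult:
  assumes "holomorphic_at f z" "holomorphic_at g z" shows "holomorphic_at (\<lambda>z. f z * g z) z"
proof -
  obtain D where D: "(f has_derivative D) (at z)" "\<And>c v. D (c *s v) = c * D v"
    using assms(1) unfolding holomorphic_at_def by blast
  obtain E where E: "(g has_derivative E) (at z)" "\<And>c v. E (c *s v) = c * E v"
    using assms(2) unfolding holomorphic_at_def by blast
  show ?thesis unfolding holomorphic_at_def
    using has_derivative_mult[OF D(1) E(1)] D(2) E(2)
    by (intro exI[of _ "\<lambda>v. f z * E v + D v * g z"]) (simp add: algebra_simps)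
qed

lemma holomorphic_at_uminus: "holomorphic_at f z \<Longrightarrow> holomorphic_at (\<lambda>z. - f z) z"
  using holomorphic_at_mult[of "\<lambda>_. -1" z f] by simp

lemma holomorphic_at_diff: "holomorphic_at f z \<Longrightarrow> holomorphic_at g z \<Longrightarrow> holomorphic_at (\<lambda>z. f z - g z) z"
  using holomorphic_at_add[OF _ holomorphic_at_uminus, of f z g] by simp

lemma holomorphic_at_power: "holomorphic_at f z \<Longrightarrow> holomorphic_at (\<lambda>z. f z ^ n) z"
  by (induction n) (auto intro: holomorphic_at_mult)

lemma holomorphic_at_prod: "(\<And>i. i \<in> I \<Longrightarrow> holomorphic_at (f i) z) \<Longrightarrow> holomorphic_at (\<lambda>z. \<Prod>i\<in>I. f i z) z"
  by (induction I rule: infinite_finite_induct) (auto intro: holomorphic_at_mult)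

lemma has_derivative_cong_nhds:
  assumes "(f has_derivative D) (at z)" "\<forall>\<^sub>F x in nhds z. f x = g x"
  shows "(g has_derivative D) (at z)"
  using assms has_derivative_transform_eventually[OF assms(1), of g]
  by (auto simp: eventually_nhds_conv_at)

lemma eventually_norm_less: "e > 0 \<Longrightarrow> \<forall>\<^sub>F z in nhds (0 :: 'a::real_normed_vector). norm z < e"
  by (auto simp: eventually_nhds_metric dist_norm)

lemma has_derivative_line: "((\<lambda>t. w + t *s (v :: complex^'n)) has_derivative (\<lambda>t. t *s v)) (at t)"
proof -
  have "bounded_linear (\<lambda>t. t *s v)"
    by (rule bounded_bilinear.bounded_linear_left[OF bounded_bilinear_smult])
  from has_derivative_add[OF has_derivative_const[of w "at t"] bounded_linear_imp_has_derivative[OF this]]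
  show ?thesis by simp
qed

text \<open>Restriction to complex lines is the bridge from several variables to one-variable
  function theory: complex linearity of \<open>D\<close> turns the chain rule into a complex
  derivative.\<close>

lemma holomorphic_at_line_derivative:
  fixes h :: "complex^'n \<Rightarrow> complex"
  assumes "(h has_derivative D) (at (w + t *s v))" "\<And>c v. D (c *s v) = c * D v"
  shows "((\<lambda>t. h (w + t *s v)) has_field_derivative D v) (at t)"
proof -
  have "((\<lambda>t. h (w + t *s v)) has_derivative (\<lambda>t. D (t *s v))) (at t)"
    using has_derivative_compose[OF has_derivative_line assms(1)] .
  moreover have "(\<lambda>t. D (t *s v)) = (*) (D v)" by (rule ext) (simp add: assms(2))
  ultimately show ?thesis unfolding has_field_derivative_def by simp
qed

section \<open>One-variable Cauchy and Taylor estimates\<close>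

lemma Cauchy_inequality_ball:
  assumes "\<phi> holomorphic_on ball x R" "\<And>t. t \<in> ball x R \<Longrightarrow> norm (\<phi> t) \<le> B" "0 < r" "r < R"
  shows "norm ((deriv ^^ n) \<phi> x) \<le> fact n * B / r ^ n"
proof (rule Cauchy_inequality)
  have "cball x r \<subseteq> ball x R" using assms by (auto simp: subset_iff)
  then show "\<phi> holomorphic_on ball x r" "continuous_on (cball x r) \<phi>"
    using assms(1) holomorphic_on_subset ball_subset_cball holomorphic_on_imp_continuous_on
    by (blast, metis)
qed (use assms in \<open>auto simp: dist_norm\<close>)

text \<open>The constant is 2! * B / (R/4)^2: a point of norm below R/2 has a ball of radius R/2
  around it inside the domain, and Cauchy's inequality is applied there with radius R/4.\<close>

lemma quadratic_Taylor_bound: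
  assumes hol: "\<phi> holomorphic_on ball 0 R" and B: "\<And>t. t \<in> ball 0 R \<Longrightarrow> norm (\<phi> t) \<le> B"
    and d: "norm \<delta> < R / 2"
  shows "norm (\<phi> \<delta> - \<phi> 0 - deriv \<phi> 0 * \<delta>) \<le> 32 * B / R\<^sup>2 * (norm \<delta>)\<^sup>2"
proof -
  have R: "R > 0" using d norm_ge_zero[of \<delta>] by linarith
  have "norm ((deriv ^^ 0) \<phi> \<delta> - (\<Sum>i\<le>1. (deriv ^^ i) \<phi> 0 * (\<delta> - 0) ^ i / fact i))
      \<le> 32 * B / R\<^sup>2 * norm (\<delta> - 0) ^ Suc 1 / fact 1"
  proof (rule complex_Taylor[where S = "ball 0 (R/2)" and f = "\<lambda>i. (deriv ^^ i) \<phi>"])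
    fix i and x :: complex assume x: "x \<in> ball 0 (R/2)"
    have x': "x \<in> ball 0 R" using x R by simp
    have "(deriv ^^ i) \<phi> holomorphic_on ball 0 R" using hol by (intro holomorphic_higher_deriv) auto
    then show "((deriv ^^ i) \<phi> has_field_derivative (deriv ^^ Suc i) \<phi> x) (at x within ball 0 (R/2))"
      using holomorphic_derivI[OF _ open_ball x', of "(deriv ^^ i) \<phi>"] by simp
  next
    fix x assume x: "x \<in> ball (0::complex) (R/2)"
    have sub: "ball x (R/2) \<subseteq> ball 0 R"
      using x by (intro ball_subset_ball_iff[THEN iffD2] disjI1) (simp add: dist_norm)
    have "norm ((deriv ^^ 2) \<phi> x) \<le> fact 2 * B / (R/4) ^ 2"
      by (rule Cauchy_inequality_ball[where R = "R/2"])
        (use sub R B holomorphic_on_subset[OF hol sub] in auto)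
    then show "norm ((deriv ^^ Suc 1) \<phi> x) \<le> 32 * B / R\<^sup>2"
      by (simp add: numeral_2_eq_2 power_divide)
  qed (use d R in simp_all)
  then show ?thesis by (simp add: numeral_2_eq_2 diff_diff_eq)
qed

section \<open>Functions holomorphic in each variable\<close>

definition polydisc :: "real \<Rightarrow> (complex^'n) set" where
  "polydisc \<rho> = {z. \<forall>i. norm (z $ i) < \<rho>}"

definition upd :: "complex^'n \<Rightarrow> 'n \<Rightarrow> complex \<Rightarrow> complex^'n" where
  "upd z i t = (\<chi> j. if j = i then t else z $ j)"

text \<open>Local boundedness makes this class closed under partial derivatives without any appeal to
  joint continuity.\<close>

definition separately_holomorphic :: "real \<Rightarrow> (complex^'n \<Rightarrow> complex) \<Rightarrow> bool" where
  "separately_holomorphic \<rho> F \<longleftrightarrow>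
     (\<forall>z\<in>polydisc \<rho>. \<forall>i. (\<lambda>t. F (upd z i t)) holomorphic_on ball 0 \<rho>) \<and>
     (\<forall>r<\<rho>. \<exists>B. \<forall>z\<in>polydisc r. norm (F z) \<le> B)"

lemma upd_nth [simp]: "upd z i t $ j = (if j = i then t else z $ j)"
  by (simp add: upd_def)

lemma upd_same [simp]: "upd z i (z $ i) = z" and upd_upd [simp]: "upd (upd z i s) i t = upd z i t"
  by (simp_all add: vec_eq_iff)

lemma upd_commute: "i \<noteq> j \<Longrightarrow> upd (upd z i s) j t = upd (upd z j t) i s"
  by (simp add: vec_eq_iff)

lemma upd_in_polydisc: "z \<in> polydisc \<rho> \<Longrightarrow> norm t < \<rho> \<Longrightarrow> upd z i t \<in> polydisc \<rho>"
  by (simp add: polydisc_def)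

lemma deriv_shift: "deriv (\<lambda>s. h (t + s)) 0 = deriv h (t :: complex)"
  unfolding deriv_def by (simp add: DERIV_shift[of h _ 0 t, simplified, symmetric] add.commute)

lemma partial_upd: "partial i F (upd z i t) = deriv (\<lambda>t. F (upd z i t)) t"
proof -
  have "upd z i t + axis i s = upd z i (t + s)" for s
    by (simp add: vec_eq_iff axis_def)
  then show ?thesis
    unfolding partial_def using deriv_shift[of "\<lambda>t. F (upd z i t)" t] by simp
qed

lemma partial_conv_upd: "partial i F z = deriv (\<lambda>t. F (upd z i t)) (z $ i)"
  using partial_upd[of i F z "z $ i"] by simp

lemma funpow_partial_upd: "(partial i ^^ k) F (upd z i t) = (deriv ^^ k) (\<lambda>t. F (upd z i t)) t"
proof (induction k arbitrary: t)
  case (Suc k)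
  show ?case by (simp add: partial_upd Suc)
qed simp

lemma polydisc_shrink:
  fixes z :: "complex^'n"
  assumes "z \<in> polydisc \<rho>" "c < \<rho>"
  shows "\<exists>r<\<rho>. c < r \<and> z \<in> polydisc r"
proof -
  have "\<exists>r. c < r \<and> (\<forall>i. norm (z $ i) < r) \<and> r < \<rho>"
  proof -
    let ?m = "Max (insert c (range (\<lambda>i. norm (z $ i))))"
    have m: "x \<le> ?m" if "x \<in> insert c (range (\<lambda>i. norm (z $ i)))" for x
      using that by (intro Max_ge) auto
    have "?m < \<rho>" using assms by (simp add: polydisc_def)
    then obtain r where "?m < r" "r < \<rho>" using dense by blast
    then show ?thesis using m by (intro exI[of _ r]) (auto intro: order_le_less_trans)
  qed
  then show ?thesis by (auto simp: polydisc_def)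
qed

text \<open>In the variable \<open>i\<close> itself this is holomorphy of a derivative. In another
  variable \<open>l\<close>, the partial derivative is a locally uniform limit of difference
  quotients in direction \<open>i\<close>, each of which is holomorphic in the \<open>l\<close>-th
  variable; the quadratic Taylor bound, with the local bound on \<open>F\<close>, makes the
  convergence uniform. The new local bounds come from Cauchy's inequality.\<close>

lemma separately_holomorphic_partial:
  fixes F :: "complex^'n \<Rightarrow> complex"
  assumes F: "separately_holomorphic \<rho> F"
  shows "separately_holomorphic \<rho> (partial i F)"
  unfolding separately_holomorphic_def
proof (intro conjI ballI allI impI)
  fix z :: "complex^'n" and l assume z: "z \<in> polydisc \<rho>"
  have hol: "(\<lambda>t. F (upd z i t)) holomorphic_on ball 0 \<rho>" if "z \<in> polydisc \<rho>" for z i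
    using F that unfolding separately_holomorphic_def by blast
  show "(\<lambda>t. partial i F (upd z l t)) holomorphic_on ball 0 \<rho>"
  proof (cases "l = i")
    case True
    then show ?thesis using hol[OF z, of i] by (simp add: partial_upd holomorphic_deriv)
  next
    case False
    define t0 where "t0 = z $ i"
    \<comment> \<open>A quarter of the distance from \<open>t0\<close> to the boundary: the disc of
      radius 3 * \<open>\<epsilon>\<close> about \<open>t0\<close> stays inside, and increments of
      norm at most \<open>\<epsilon>\<close> lie within half of that radius, as
      \<open>quadratic_Taylor_bound\<close> demands.\<close>
    define \<epsilon> where "\<epsilon> = (\<rho> - norm t0) / 4"
    have t0: "norm t0 < \<rho>" using z by (simp add: polydisc_def t0_def)
    have eps: "\<epsilon> > 0" "norm t0 + 3 * \<epsilon> < \<rho>" using t0 by (simp_all add: \<epsilon>_def field_simps)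
    define \<delta> where "\<delta> n = complex_of_real (\<epsilon> / real (Suc n))" for n
    have \<delta>: "\<delta> n \<noteq> 0" "norm (\<delta> n) \<le> \<epsilon>" "norm (\<delta> n) = \<epsilon> / real (Suc n)" for n
    proof -
      show "norm (\<delta> n) = \<epsilon> / real (Suc n)" using eps unfolding \<delta>_def by (simp only: norm_of_real) simp
      then show "norm (\<delta> n) \<le> \<epsilon>" "\<delta> n \<noteq> 0" using eps by (auto simp: field_simps)
    qed
    define h where "h s \<tau> = F (upd (upd z l s) i (t0 + \<tau>))" for s \<tau>
    have h_hol: "(\<lambda>s. h s \<tau>) holomorphic_on ball 0 \<rho>" if "norm \<tau> \<le> \<epsilon>" for \<tau>
    proof -
      have "norm (t0 + \<tau>) < \<rho>" using that eps norm_triangle_ineq[of t0 \<tau>] by linarith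
      then show ?thesis using hol[OF upd_in_polydisc[OF z], of "t0 + \<tau>" i l] False
        by (simp add: h_def upd_commute)
    qed
    have part: "partial i F (upd z l s) = deriv (h s) 0" for s
      using False deriv_shift[of "\<lambda>t. F (upd (upd z l s) i t)" t0] unfolding h_def
      by (simp add: partial_conv_upd t0_def)
    show ?thesis
    proof (rule holomorphic_uniform_sequence[where f = "\<lambda>n s. (h s (\<delta> n) - h s 0) / \<delta> n"])
      show "(\<lambda>s. (h s (\<delta> n) - h s 0) / \<delta> n) holomorphic_on ball 0 \<rho>" for n
        using \<delta>[of n] eps by (intro holomorphic_intros h_hol) auto
      fix x :: complex assume x: "x \<in> ball 0 \<rho>"
      define d where "d = (\<rho> - norm x) / 2"
      have d: "d > 0" "norm x + d < \<rho>" using x by (auto simp: d_def field_simps)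
      have sub: "cball x d \<subseteq> ball 0 \<rho>"
        using d by (auto simp: subset_iff dist_norm) (smt (verit) norm_triangle_ineq2 norm_minus_commute)
      obtain r where r: "r < \<rho>" "max (norm x + d) (norm t0 + 3 * \<epsilon>) < r" "z \<in> polydisc r"
        using polydisc_shrink[OF z, of "max (norm x + d) (norm t0 + 3 * \<epsilon>)"] d eps by auto
      obtain B where B: "\<And>z. z \<in> polydisc r \<Longrightarrow> norm (F z) \<le> B"
        using F r(1) unfolding separately_holomorphic_def by blast
      have est: "norm ((h s (\<delta> n) - h s 0) / \<delta> n - deriv (h s) 0) \<le> 32 * B / (3 * \<epsilon>)\<^sup>2 * (\<epsilon> / real (Suc n))"
        if s: "s \<in> cball x d" for s n
      proof -
        have s': "norm s < r" using s r(2) norm_triangle_ineq2[of s x]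
          by (simp add: dist_norm norm_minus_commute)
        then have s'': "norm s < \<rho>" using r by simp
        have b: "norm (t0 + \<tau>) < r" if "\<tau> \<in> ball 0 (3 * \<epsilon>)" for \<tau>
          using that r(2) norm_triangle_ineq[of t0 \<tau>] by simp
        have "((\<lambda>t. F (upd (upd z l s) i t)) \<circ> (\<lambda>\<tau>. t0 + \<tau>)) holomorphic_on ball 0 (3 * \<epsilon>)"
        proof (rule holomorphic_on_compose_gen[OF _ hol[OF upd_in_polydisc[OF z s'']]])
          show "(\<lambda>\<tau>. t0 + \<tau>) ` ball 0 (3 * \<epsilon>) \<subseteq> ball 0 \<rho>"
            using b r(1) by (force simp: image_subset_iff)
        qed (intro holomorphic_intros)
        then have hs: "h s holomorphic_on ball 0 (3 * \<epsilon>)" unfolding h_def o_def .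
        have "norm (h s (\<delta> n) - h s 0 - deriv (h s) 0 * \<delta> n) \<le> 32 * B / (3 * \<epsilon>)\<^sup>2 * (norm (\<delta> n))\<^sup>2"
        proof (rule quadratic_Taylor_bound[OF hs])
          fix \<tau> :: complex assume "\<tau> \<in> ball 0 (3 * \<epsilon>)"
          then show "norm (h s \<tau>) \<le> B" unfolding h_def
            by (intro B upd_in_polydisc r(3) s' b)
        qed (use \<delta>(2)[of n] eps in linarith)
        moreover have "(h s (\<delta> n) - h s 0) / \<delta> n - deriv (h s) 0
            = (h s (\<delta> n) - h s 0 - deriv (h s) 0 * \<delta> n) / \<delta> n"
          using \<delta>(1)[of n] by (simp add: field_simps)
        ultimately have "norm ((h s (\<delta> n) - h s 0) / \<delta> n - deriv (h s) 0)
            \<le> (32 * B / (3 * \<epsilon>)\<^sup>2 * (norm (\<delta> n))\<^sup>2) / norm (\<delta> n)"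
          by (simp only: norm_divide) (rule divide_right_mono, simp_all)
        also have "\<dots> = 32 * B / (3 * \<epsilon>)\<^sup>2 * norm (\<delta> n)"
          using \<delta>(1)[of n] by (simp add: power2_eq_square)
        finally show ?thesis unfolding \<delta>(3) .
      qed
      have "(\<lambda>n. 32 * B / (3 * \<epsilon>)\<^sup>2 * (\<epsilon> / real (Suc n))) \<longlonglongrightarrow> 32 * B / (3 * \<epsilon>)\<^sup>2 * 0"
        by (intro tendsto_mult tendsto_const LIMSEQ_Suc lim_const_over_n)
      then have lim: "\<forall>\<^sub>F n in sequentially. 32 * B / (3 * \<epsilon>)\<^sup>2 * (\<epsilon> / real (Suc n)) < e" if "e > 0" for e
        using that by (intro order_tendstoD(2)[of _ 0]) auto
      have "uniform_limit (cball x d) (\<lambda>n s. (h s (\<delta> n) - h s 0) / \<delta> n) (\<lambda>s. partial i F (upd z l s)) sequentially"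
        unfolding part
      proof (rule uniform_limitI)
        fix e :: real assume "e > 0"
        from lim[OF this] show "\<forall>\<^sub>F n in sequentially. \<forall>s\<in>cball x d. dist ((h s (\<delta> n) - h s 0) / \<delta> n) (deriv (h s) 0) < e"
        proof eventually_elim
          case (elim n)
          then show ?case using order_le_less_trans[OF est elim] unfolding dist_norm by blast
        qed
      qed
      then show "\<exists>d>0. cball x d \<subseteq> ball 0 \<rho> \<and>
           uniform_limit (cball x d) (\<lambda>n s. (h s (\<delta> n) - h s 0) / \<delta> n) (\<lambda>s. partial i F (upd z l s)) sequentially"
        using d sub by blast
    qed simp
  qed
next
  fix r assume r: "r < \<rho>"
  define r' where "r' = (r + \<rho>) / 2"
  have r': "r < r'" "r' < \<rho>" using r by (auto simp: r'_def)
  obtain B where B: "\<And>z. z \<in> polydisc r' \<Longrightarrow> norm (F z) \<le> B"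
    using F r' unfolding separately_holomorphic_def by blast
  show "\<exists>B. \<forall>z\<in>polydisc r. norm (partial i F z) \<le> B"
  proof (intro exI ballI)
    fix z :: "complex^'n" assume z: "z \<in> polydisc r"
    then have z': "z \<in> polydisc r'" "z \<in> polydisc \<rho>" "norm (z $ i) < r"
      using r r' unfolding polydisc_def by (force intro: less_trans)+
    have sub: "ball (z $ i) (r' - r) \<subseteq> ball 0 r'" "ball 0 r' \<subseteq> ball (0::complex) \<rho>"
      using z'(3) r' by (auto simp: ball_subset_ball_iff dist_norm)
    have "norm ((deriv ^^ 1) (\<lambda>t. F (upd z i t)) (z $ i)) \<le> fact 1 * B / ((r' - r) / 2) ^ 1"
    proof (rule Cauchy_inequality_ball)
      show "(\<lambda>t. F (upd z i t)) holomorphic_on ball (z $ i) (r' - r)"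
        using F z'(2) sub unfolding separately_holomorphic_def
        by (meson holomorphic_on_subset)
      fix t assume "t \<in> ball (z $ i) (r' - r)"
      then have "norm t < r'" using sub by auto
      then show "norm (F (upd z i t)) \<le> B" by (intro B upd_in_polydisc z')
    qed (use r' in auto)
    then show "norm (partial i F z) \<le> fact 1 * B / ((r' - r) / 2) ^ 1"
      by (simp add: partial_conv_upd)
  qed
qed

lemma separately_holomorphic_fold_partial:
  "separately_holomorphic \<rho> F \<Longrightarrow> separately_holomorphic \<rho> (fold partial js F)"
  by (induction js arbitrary: F) (auto intro: separately_holomorphic_partial)

lemma norm_le_sum_norm_nth: "norm (z :: complex^'n) \<le> (\<Sum>i\<in>UNIV. norm (z $ i))"
  unfolding norm_vec_def by (rule L2_set_le_sum) simp

text \<open>Continuity at 0 alone gives the common bound |F 0| + 1 on a small ball, and coordinate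
  slices are complex lines.\<close>

lemma holomorphic_at_imp_separately_holomorphic:
  fixes F :: "complex^'n \<Rightarrow> complex"
  assumes "\<forall>\<^sub>F z in nhds 0. holomorphic_at F z"
  shows "\<exists>\<rho>>0. \<exists>B. separately_holomorphic \<rho> F \<and> (\<forall>z\<in>polydisc \<rho>. norm (F z) \<le> B)"
proof -
  have "holomorphic_at F 0" using assms eventually_nhds_x_imp_x by blast
  then have "(F \<longlongrightarrow> F 0) (nhds 0)" using holomorphic_at_continuous tendsto_at_iff_tendsto_nhds isCont_def by metis
  then have "\<forall>\<^sub>F z in nhds 0. dist (F z) (F 0) < 1" by (rule tendstoD) simp
  with assms have "\<forall>\<^sub>F z in nhds 0. holomorphic_at F z \<and> dist (F z) (F 0) < 1" by eventually_elim simp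
  then obtain e where e: "e > 0" "\<And>z. dist z 0 < e \<Longrightarrow> holomorphic_at F z \<and> dist (F z) (F 0) < 1"
    unfolding eventually_nhds_metric by blast
  \<comment> \<open>Dividing by the number of coordinates puts the polydisc inside the ball of
    radius \<open>e\<close>, since the norm is at most the sum of the norms of the
    coordinates.\<close>
  define \<rho> where "\<rho> = e / CARD('n)"
  have \<rho>: "\<rho> > 0" using e by (simp add: \<rho>_def)
  have sub: "dist z 0 < e" if "z \<in> polydisc \<rho>" for z :: "complex^'n"
  proof -
    have "norm z \<le> (\<Sum>i\<in>UNIV. norm (z $ i))" by (rule norm_le_sum_norm_nth)
    also have "\<dots> < (\<Sum>i\<in>(UNIV::'n set). \<rho>)" by (rule sum_strict_mono) (use that in \<open>auto simp: polydisc_def\<close>)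
    finally show ?thesis by (simp add: \<rho>_def)
  qed
  have bd: "norm (F z) \<le> norm (F 0) + 1" if "z \<in> polydisc \<rho>" for z
    using e(2)[OF sub[OF that]] norm_triangle_ineq2[of "F z" "F 0"] by (simp add: dist_norm)
  have mono: "z \<in> polydisc r \<Longrightarrow> r < \<rho> \<Longrightarrow> z \<in> polydisc \<rho>" for z :: "complex^'n" and r
    unfolding polydisc_def by (force intro: less_trans)
  have "separately_holomorphic \<rho> F"
    unfolding separately_holomorphic_def
  proof (intro conjI ballI allI impI)
    fix z :: "complex^'n" and i assume z: "z \<in> polydisc \<rho>"
    show "(\<lambda>t. F (upd z i t)) holomorphic_on ball 0 \<rho>"
      unfolding holomorphic_on_def
    proof
      fix t :: complex assume "t \<in> ball 0 \<rho>"
      then have chF: "holomorphic_at F (upd z i t)" using e(2)[OF sub[OF upd_in_polydisc[OF z]]] by simp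
      have eq: "upd z i t = upd z i 0 + t *s axis i 1" for t
        by (simp add: vec_eq_iff axis_def)
      have eqF: "(\<lambda>t. F (upd z i t)) = (\<lambda>t. F (upd z i 0 + t *s axis i 1))"
        by (rule ext) (rule arg_cong[OF eq])
      from chF obtain D where "(F has_derivative D) (at (upd z i 0 + t *s axis i 1))" "\<And>c v. D (c *s v) = c * D v"
        unfolding holomorphic_at_def eq[of t] by blast
      then have "((\<lambda>t. F (upd z i t)) has_field_derivative D (axis i 1)) (at t)"
        using holomorphic_at_line_derivative[of F D "upd z i 0" t "axis i 1"] by (simp only: eqF)
      then show "(\<lambda>t. F (upd z i t)) field_differentiable at t within ball 0 \<rho>"
        using field_differentiable_at_within field_differentiable_def by blast
    qed
  qed (use bd mono in blast)
  then show ?thesis using \<rho> bd by blast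
qed

subsection \<open>Taylor expansion\<close>

lemma summable_on_norm_bound:
  fixes f :: "'i \<Rightarrow> 'b::banach"
  assumes "g summable_on A" "\<And>x. x \<in> A \<Longrightarrow> norm (f x) \<le> g x"
  shows "f summable_on A"
  by (rule Infinite_Sum.abs_summable_summable[OF Infinite_Sum.abs_summable_on_comparison_test'[of g, OF assms]])

text \<open>Exponents stay functions on the whole index type and are only constrained outside
  \<open>S\<close>. Induction over the variables then needs no change of type, and
  \<open>expo UNIV\<close> is the set of all exponents.\<close>

definition expo :: "'n set \<Rightarrow> ('n \<Rightarrow> nat) set" where
  "expo S = {a. \<forall>i. i \<notin> S \<longrightarrow> a i = 0}"

lemma bij_betw_expo_insert:
  assumes "i \<notin> S"
  shows "bij_betw (\<lambda>(a, k). a(i := k)) (expo S \<times> UNIV) (expo (insert i S))"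
  by (rule bij_betw_byWitness[where f' = "\<lambda>b. (b(i := 0), b i)"])
    (use assms in \<open>auto simp: expo_def fun_eq_iff\<close>)

lemma prod_fun_upd_notin:
  "i \<notin> S \<Longrightarrow> (\<Prod>j\<in>S. g j ((a(i := k)) j)) = (\<Prod>j\<in>S. g j (a j))"
  by (intro prod.cong) auto

lemma summable_geometric_expo:
  fixes x :: "'n \<Rightarrow> real"
  assumes "finite S" "\<And>i. i \<in> S \<Longrightarrow> 0 \<le> x i \<and> x i < 1"
  shows "(\<lambda>a. \<Prod>i\<in>S. x i ^ a i) summable_on expo S"
  using assms
proof (induction S rule: finite_induct)
  case empty
  have "expo {} = {\<lambda>_::'n. 0::nat}" by (auto simp: expo_def)
  then show ?case by simp
next
  case (insert i S)
  have geo: "((\<lambda>k. x i ^ k) has_sum (1 / (1 - x i))) UNIV"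
    using insert.prems by (intro norm_summable_imp_has_sum geometric_sums) (auto simp: abs_of_nonneg)
  have "(\<lambda>p. (\<Prod>j\<in>S. x j ^ fst p j) * x i ^ snd p) summable_on (expo S \<times> UNIV)"
  proof (rule summable_on_SigmaI[where g = "\<lambda>a. (\<Prod>j\<in>S. x j ^ a j) * (1 / (1 - x i))"])
    show "(\<lambda>a. (\<Prod>j\<in>S. x j ^ a j) * (1 / (1 - x i))) summable_on expo S"
      using insert by (intro summable_on_cmult_left) auto
    fix a
    show "((\<lambda>k. (\<Prod>j\<in>S. x j ^ fst (a, k) j) * x i ^ snd (a, k)) has_sum (\<Prod>j\<in>S. x j ^ a j) * (1 / (1 - x i))) UNIV"
      using has_sum_cmult_right[OF geo] by simp
    fix k show "0 \<le> (\<Prod>j\<in>S. x j ^ fst (a, k) j) * x i ^ snd (a, k)"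
      using insert.prems by (intro mult_nonneg_nonneg prod_nonneg zero_le_power) auto
  qed
  also have "?this \<longleftrightarrow> (\<lambda>p. \<Prod>j\<in>insert i S. x j ^ (case p of (a, k) \<Rightarrow> a(i := k)) j) summable_on (expo S \<times> UNIV)"
    using insert.hyps by (intro summable_on_cong)
      (auto simp: prod_fun_upd_notin[where g = "\<lambda>j n. x j ^ n"] fun_upd_same mult.commute simp del: fun_upd_apply)
  also have "\<dots> \<longleftrightarrow> ?case"
    using summable_on_reindex_bij_betw[OF bij_betw_expo_insert[OF insert.hyps(2)], of "\<lambda>a. \<Prod>j\<in>insert i S. x j ^ a j"]
    by simp
  finally show ?case .
qed

definition jet_list :: "'n list \<Rightarrow> ('n \<Rightarrow> nat) \<Rightarrow> 'n list" where
  "jet_list L a = concat (map (\<lambda>i. replicate (a i) i) L)"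

definition zero_out :: "'n set \<Rightarrow> complex^'n \<Rightarrow> complex^'n" where
  "zero_out S z = (\<chi> j. if j \<in> S then 0 else z $ j)"

text \<open>The Taylor coefficient with respect to the variables in \<open>L\<close> only, expanded
  at 0 in these; it still depends on the remaining coordinates of \<open>z\<close>. For the empty
  list it is \<open>F z\<close>, for a list of all variables the usual coefficient.\<close>

definition iterated_coeff :: "(complex^'n \<Rightarrow> complex) \<Rightarrow> 'n list \<Rightarrow> ('n \<Rightarrow> nat) \<Rightarrow> complex^'n \<Rightarrow> complex" where
  "iterated_coeff F L a z = fold partial (jet_list L a) F (zero_out (set L) z) / (\<Prod>i\<in>set L. fact (a i))"

lemma fold_replicate: "fold f (replicate k i) F = (f i ^^ k) F"
  by (induction k arbitrary: F) (auto simp: funpow_swap1)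

lemma zero_out_insert: "zero_out (insert i S) z = upd (zero_out S z) i 0"
  by (simp add: vec_eq_iff zero_out_def)

lemma zero_out_upd: "i \<notin> S \<Longrightarrow> upd (zero_out S z) i t = zero_out S (upd z i t)"
  by (auto simp: vec_eq_iff zero_out_def)

lemma zero_out_in_polydisc: "0 < \<rho> \<Longrightarrow> z \<in> polydisc \<rho> \<Longrightarrow> zero_out S z \<in> polydisc \<rho>"
  by (auto simp: polydisc_def zero_out_def)

lemma separately_holomorphic_slice:
  assumes "separately_holomorphic \<rho> F" "0 < \<rho>" "z \<in> polydisc \<rho>" "i \<notin> set L"
  shows "(\<lambda>t. iterated_coeff F L a (upd z i t)) holomorphic_on ball 0 \<rho>"
proof -
  have "(\<lambda>t. fold partial (jet_list L a) F (upd (zero_out (set L) z) i t)) holomorphic_on ball 0 \<rho>"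
    using separately_holomorphic_fold_partial[OF assms(1)] zero_out_in_polydisc[OF assms(2,3)]
    unfolding separately_holomorphic_def by blast
  then show ?thesis unfolding iterated_coeff_def zero_out_upd[OF assms(4)]
    by (intro holomorphic_intros) (auto simp: zero_out_upd[OF assms(4)])
qed

text \<open>\<open>fold\<close> applies the derivatives in the last variable of the list last, so
  adding a variable means taking a one-variable Taylor coefficient of the coefficient function
  obtained so far.\<close>

lemma iterated_coeff_snoc:
  assumes "separately_holomorphic \<rho> F" "0 < \<rho>" "z \<in> polydisc \<rho>" "i \<notin> set L"
  shows "iterated_coeff F (L @ [i]) a z =
    (deriv ^^ a i) (\<lambda>t. iterated_coeff F L a (upd z i t)) 0 / fact (a i)"
proof -
  let ?H = "fold partial (jet_list L a) F" and ?c = "\<Prod>j\<in>set L. fact (a j) :: complex"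
  have "iterated_coeff F (L @ [i]) a z = (partial i ^^ a i) ?H (upd (zero_out (set L) z) i 0) / (?c * fact (a i))"
    using assms by (simp add: iterated_coeff_def jet_list_def fold_replicate zero_out_insert mult.commute)
  also have "\<dots> = inverse ?c * (deriv ^^ a i) (\<lambda>t. ?H (upd (zero_out (set L) z) i t)) 0 / fact (a i)"
    by (simp add: funpow_partial_upd field_simps)
  also have "inverse ?c * (deriv ^^ a i) (\<lambda>t. ?H (upd (zero_out (set L) z) i t)) 0
      = (deriv ^^ a i) (\<lambda>t. inverse ?c * ?H (upd (zero_out (set L) z) i t)) 0"
    using separately_holomorphic_fold_partial[OF assms(1)] zero_out_in_polydisc[OF assms(2,3)] assms(2)
    unfolding separately_holomorphic_def
    by (intro higher_deriv_cmult[symmetric, where A = "ball 0 \<rho>"]) auto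
  finally show ?thesis
    using assms by (simp add: iterated_coeff_def zero_out_upd divide_inverse mult.commute)
qed

text \<open>One Cauchy inequality for each variable of \<open>L\<close>, each contributing a factor
  1 / r ^ a i. The bound must hold on the whole polydisc, since the next inequality uses it along a
  slice.\<close>

lemma iterated_coeff_bound:
  assumes F: "separately_holomorphic \<rho> F" and r: "0 < r" "r < \<rho>"
    and B: "\<And>z. z \<in> polydisc \<rho> \<Longrightarrow> norm (F z) \<le> B"
  shows "distinct L \<Longrightarrow> z \<in> polydisc \<rho> \<Longrightarrow> norm (iterated_coeff F L a z) \<le> B / r ^ (\<Sum>i\<in>set L. a i)"
proof (induction L arbitrary: z rule: rev_induct)
  case Nil
  then show ?case using B by (simp add: iterated_coeff_def jet_list_def zero_out_def)
next
  case (snoc i L)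
  have i: "i \<notin> set L" and rho: "0 < \<rho>" using snoc.prems r by auto
  let ?n = "\<Sum>i\<in>set L. a i"
  have "norm ((deriv ^^ a i) (\<lambda>t. iterated_coeff F L a (upd z i t)) 0) \<le> fact (a i) * (B / r ^ ?n) / r ^ a i"
  proof (rule Cauchy_inequality_ball)
    show "(\<lambda>t. iterated_coeff F L a (upd z i t)) holomorphic_on ball 0 \<rho>"
      by (rule separately_holomorphic_slice[OF F rho snoc.prems(2) i])
    show "norm (iterated_coeff F L a (upd z i t)) \<le> B / r ^ ?n" if "t \<in> ball 0 \<rho>" for t
      using that snoc.prems by (intro snoc.IH upd_in_polydisc) auto
  qed (use r in auto)
  then have "norm (iterated_coeff F (L @ [i]) a z) \<le> B / r ^ ?n / r ^ a i"
    unfolding iterated_coeff_snoc[OF F rho snoc.prems(2) i] using r by (simp add: norm_divide field_simps)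
  then show ?case using i by (simp add: power_add mult.commute)
qed

lemma iterated_coeff_upd:
  "i \<notin> set L \<Longrightarrow> iterated_coeff F L (a(i := k)) z = iterated_coeff F L a z"
proof -
  assume i: "i \<notin> set L"
  then have "jet_list L (a(i := k)) = jet_list L a"
    unfolding jet_list_def by (intro arg_cong[where f = concat] map_cong) auto
  moreover have "(\<Prod>j\<in>set L. fact ((a(i := k)) j)) = (\<Prod>j\<in>set L. fact (a j) :: complex)"
    using i by (intro prod.cong) auto
  ultimately show ?thesis by (simp add: iterated_coeff_def)
qed

text \<open>Each new variable replaces a coefficient by its one-variable power series. Summing first
  over the exponent of the new variable gives the previous expansion; regrouping the double family
  is legitimate because the Cauchy bounds dominate it by a product of geometric series.\<close>

lemma iterated_Taylor:
  assumes F: "separately_holomorphic \<rho> F" and r: "0 < r" "r < \<rho>"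
    and B: "\<And>z. z \<in> polydisc \<rho> \<Longrightarrow> norm (F z) \<le> B"
  shows "distinct L \<Longrightarrow> z \<in> polydisc r \<Longrightarrow>
    ((\<lambda>a. iterated_coeff F L a z * (\<Prod>i\<in>set L. z $ i ^ a i)) has_sum F z) (expo (set L))"
proof (induction L rule: rev_induct)
  case Nil
  have "expo {} = {\<lambda>_::'a. 0::nat}" by (auto simp: expo_def)
  moreover have "iterated_coeff F [] (\<lambda>_. 0) z = F z" by (simp add: iterated_coeff_def jet_list_def zero_out_def)
  ultimately show ?case using has_sum_finite[of "{\<lambda>_. 0}" "\<lambda>a. iterated_coeff F [] a z"] by simp
next
  case (snoc i L)
  have i: "i \<notin> set L" and rho: "0 < \<rho>" and L: "distinct L" using snoc.prems r by auto
  have z: "z \<in> polydisc r" by fact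
  then have z': "z \<in> polydisc \<rho>" using r unfolding polydisc_def by (force intro: less_trans)
  let ?M = "insert i (set L)"
  define t where "t b = iterated_coeff F (L @ [i]) b z * (\<Prod>j\<in>?M. z $ j ^ b j)" for b
  let ?u = "\<lambda>p. t (case p of (a, k) \<Rightarrow> a(i := k))"
  have nz: "0 \<le> norm (z $ j) / r \<and> norm (z $ j) / r < 1" for j
    using z r by (auto simp: polydisc_def)
  have B0: "0 \<le> B" using order_trans[OF norm_ge_zero B[OF z']] .
  have bd: "norm (t b) \<le> B * (\<Prod>j\<in>?M. (norm (z $ j) / r) ^ b j)" for b
  proof -
    have "norm (t b) \<le> B / r ^ (\<Sum>j\<in>?M. b j) * (\<Prod>j\<in>?M. norm (z $ j) ^ b j)"
    proof -
      have "norm (t b) = norm (iterated_coeff F (L @ [i]) b z) * (\<Prod>j\<in>?M. norm (z $ j) ^ b j)"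
        by (simp add: t_def norm_mult prod_norm[symmetric] norm_power)
      also have "\<dots> \<le> B / r ^ (\<Sum>j\<in>?M. b j) * (\<Prod>j\<in>?M. norm (z $ j) ^ b j)"
        using iterated_coeff_bound[OF F r B snoc.prems(1) z', of b]
        by (intro mult_right_mono prod_nonneg) auto
      finally show ?thesis .
    qed
    also have "\<dots> = B * (\<Prod>j\<in>?M. (norm (z $ j) / r) ^ b j)"
      by (simp add: power_divide prod_dividef power_sum)
    finally show ?thesis .
  qed
  have "(\<lambda>b. B * (\<Prod>j\<in>?M. (norm (z $ j) / r) ^ b j)) summable_on expo ?M"
    using nz by (intro summable_on_cmult_right summable_geometric_expo) auto
  then have "t summable_on expo ?M"
    by (rule summable_on_norm_bound) (use bd in auto)
  then have summ: "?u summable_on (expo (set L) \<times> UNIV)"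
    using summable_on_reindex_bij_betw[OF bij_betw_expo_insert[OF i], of t] by blast
  have fiber: "((\<lambda>k. ?u (a, k)) has_sum (iterated_coeff F L a z * (\<Prod>j\<in>set L. z $ j ^ a j))) UNIV" for a
  proof -
    let ?h = "\<lambda>t. iterated_coeff F L a (upd z i t)"
    have u: "?u (a, k) = (deriv ^^ k) ?h 0 / fact k * (z $ i - 0) ^ k * (\<Prod>j\<in>set L. z $ j ^ a j)" for k
    proof -
      have "iterated_coeff F (L @ [i]) (a(i := k)) z = (deriv ^^ k) ?h 0 / fact k"
        unfolding iterated_coeff_snoc[OF F rho z' i] iterated_coeff_upd[OF i] by simp
      moreover have "(\<Prod>j\<in>set L. z $ j ^ (a(i := k)) j) = (\<Prod>j\<in>set L. z $ j ^ a j)"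
        using i by (intro prod.cong) auto
      ultimately show ?thesis using i by (simp add: t_def mult.assoc)
    qed
    have "(\<lambda>k. (deriv ^^ k) ?h 0 / fact k * (z $ i - 0) ^ k) sums ?h (z $ i)"
      by (rule holomorphic_power_series[OF separately_holomorphic_slice[OF F rho z' i]])
        (use z' in \<open>auto simp: polydisc_def\<close>)
    moreover have "summable (\<lambda>k. norm ((deriv ^^ k) ?h 0 / fact k * (z $ i - 0) ^ k))"
    proof (rule summable_comparison_test'[of "\<lambda>k. B / r ^ (\<Sum>j\<in>set L. a j) * (norm (z $ i) / r) ^ k"])
      show "summable (\<lambda>k. B / r ^ (\<Sum>j\<in>set L. a j) * (norm (z $ i) / r) ^ k)"
        using nz[of i] r by (intro summable_mult summable_geometric) simp
      fix k
      have "norm ((deriv ^^ k) ?h 0 / fact k) \<le> B / r ^ (\<Sum>j\<in>set L. a j) / r ^ k"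
      proof -
        have "norm ((deriv ^^ k) ?h 0) \<le> fact k * (B / r ^ (\<Sum>j\<in>set L. a j)) / r ^ k"
        proof (rule Cauchy_inequality_ball[OF separately_holomorphic_slice[OF F rho z' i] _ r])
          show "norm (?h t) \<le> B / r ^ (\<Sum>j\<in>set L. a j)" if "t \<in> ball 0 \<rho>" for t
            using that by (intro iterated_coeff_bound[OF F r B L] upd_in_polydisc[OF z']) auto
        qed
        then show ?thesis by (simp add: norm_divide field_simps)
      qed
      then have "norm ((deriv ^^ k) ?h 0 / fact k) * norm (z $ i) ^ k \<le> B / r ^ (\<Sum>j\<in>set L. a j) / r ^ k * norm (z $ i) ^ k"
        by (rule mult_right_mono) simp
      then show "norm (norm ((deriv ^^ k) ?h 0 / fact k * (z $ i - 0) ^ k)) \<le> B / r ^ (\<Sum>j\<in>set L. a j) * (norm (z $ i) / r) ^ k"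
        by (simp add: norm_mult norm_divide norm_power power_divide)
    qed
    ultimately have "((\<lambda>k. (deriv ^^ k) ?h 0 / fact k * (z $ i - 0) ^ k) has_sum ?h (z $ i)) UNIV"
      by (intro norm_summable_imp_has_sum)
    then show ?thesis unfolding u by (intro has_sum_cmult_left) simp
  qed
  have "(?u has_sum F z) (expo (set L) \<times> UNIV)"
    by (rule has_sum_SigmaI[OF fiber snoc.IH[OF L z] summ])
  then have "(t has_sum F z) (expo ?M)"
    using has_sum_reindex_bij_betw[OF bij_betw_expo_insert[OF i], of t "F z"] by blast
  moreover have "?M = set (L @ [i])" by simp
  ultimately show ?case unfolding t_def by (simp only:)
qed

definition index_list :: "'n::finite list" where
  "index_list = (SOME L. distinct L \<and> set L = UNIV)"

lemma index_list: "distinct (index_list :: 'n::finite list)" "set (index_list :: 'n list) = UNIV"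
proof -
  have "\<exists>L :: 'n list. distinct L \<and> set L = UNIV"
    using finite_distinct_list[of "UNIV :: 'n set"] by auto
  from someI_ex[OF this] show "distinct (index_list :: 'n list)" "set (index_list :: 'n list) = UNIV"
    by (auto simp: index_list_def)
qed

text \<open>The derivatives are taken in the fixed order of \<open>index_list\<close>. Agreement of
  jets, being required for all lists of indices, includes this order and so yields equality of these
  coefficients.\<close>

definition taylor_coeff :: "(complex^'n \<Rightarrow> complex) \<Rightarrow> ('n \<Rightarrow> nat) \<Rightarrow> complex" where
  "taylor_coeff F a = fold partial (jet_list index_list a) F 0 / (\<Prod>i\<in>UNIV. fact (a i))"

definition mon :: "('n::finite \<Rightarrow> nat) \<Rightarrow> complex^'n \<Rightarrow> complex" where
  "mon a z = (\<Prod>i\<in>UNIV. z $ i ^ a i)"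

definition mdeg :: "('n::finite \<Rightarrow> nat) \<Rightarrow> nat" where
  "mdeg a = (\<Sum>i\<in>UNIV. a i)"

lemma length_jet_list_index_list: "length (jet_list index_list a) = mdeg a"
  by (simp add: jet_list_def length_concat o_def mdeg_def sum_list_distinct_conv_sum_set index_list)

theorem Taylor_expansion:
  fixes F :: "complex^'n \<Rightarrow> complex"
  assumes "\<forall>\<^sub>F z in nhds 0. holomorphic_at F z"
  shows "\<exists>r>0. \<exists>B\<ge>0. (\<forall>a. norm (taylor_coeff F a) \<le> B / r ^ mdeg a) \<and>
    (\<forall>z\<in>polydisc r. ((\<lambda>a. taylor_coeff F a * mon a z) has_sum F z) UNIV)"
proof -
  obtain \<rho> B where \<rho>: "\<rho> > 0" and F: "separately_holomorphic \<rho> F"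
    and B: "\<And>z. z \<in> polydisc \<rho> \<Longrightarrow> norm (F z) \<le> B"
    using holomorphic_at_imp_separately_holomorphic[OF assms] by blast
  define r where "r = \<rho> / 2"
  have r: "0 < r" "r < \<rho>" using \<rho> by (auto simp: r_def)
  have coeff: "iterated_coeff F index_list a z = taylor_coeff F a" for a z
  proof -
    have "zero_out UNIV z = 0" by (simp add: vec_eq_iff zero_out_def)
    then show ?thesis by (simp add: iterated_coeff_def taylor_coeff_def index_list)
  qed
  have "(0 :: complex^'n) \<in> polydisc \<rho>" using \<rho> by (simp add: polydisc_def)
  from iterated_coeff_bound[OF F r B index_list(1) this] order_trans[OF norm_ge_zero B[OF this]]
  have "B \<ge> 0" "\<And>a. norm (taylor_coeff F a) \<le> B / r ^ mdeg a"
    by (simp_all add: coeff index_list mdeg_def)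
  moreover have "((\<lambda>a. taylor_coeff F a * mon a z) has_sum F z) UNIV" if "z \<in> polydisc r" for z
    using iterated_Taylor[OF F r B index_list(1) that] by (simp add: coeff index_list mon_def expo_def)
  ultimately show ?thesis using r(1) by (intro exI[of _ r] exI[of _ B] conjI) auto
qed

subsection \<open>Holomorphic series and germs tangent to the identity\<close>

text \<open>On the complex line t -> w + t v the parameter may range over the disc of radius T =
  \<epsilon> / |v|. Cauchy's inequality with radius T/2 bounds the derivative at 0, which is
  \<open>D v\<close>; the quadratic Taylor bound at t = 1, allowed when 1 < T/2, gives the
  remainder. Substituting T produces the stated constants.\<close>

lemma holomorphic_at_ball_estimates:
  fixes h :: "complex^'n \<Rightarrow> complex"
  assumes h: "\<And>x. x \<in> ball w \<epsilon> \<Longrightarrow> holomorphic_at h x" "\<And>x. x \<in> ball w \<epsilon> \<Longrightarrow> norm (h x) \<le> M"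
    and \<epsilon>: "\<epsilon> > 0" and D: "(h has_derivative D) (at w)" "\<And>c v. D (c *s v) = c * D v"
  shows "norm (D v) \<le> 2 * M / \<epsilon> * norm v"
    and "norm v < \<epsilon> / 2 \<Longrightarrow> norm (h (w + v) - h w - D v) \<le> 32 * M / \<epsilon>\<^sup>2 * (norm v)\<^sup>2"
proof -
  have "norm (D v) \<le> 2 * M / \<epsilon> * norm v \<and>
    (norm v < \<epsilon> / 2 \<longrightarrow> norm (h (w + v) - h w - D v) \<le> 32 * M / \<epsilon>\<^sup>2 * (norm v)\<^sup>2)"
  proof (cases "v = 0")
    case True
    moreover have "D 0 = 0" using D(2)[of 0 0] by simp
    ultimately show ?thesis by simp
  next
    case False
    define \<phi> where "\<phi> t = h (w + t *s v)" for t
    define T where "T = \<epsilon> / norm v"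
    have T: "T > 0" using False \<epsilon> by (simp add: T_def)
    have mem: "w + t *s v \<in> ball w \<epsilon>" if "t \<in> ball 0 T" for t
      using that False by (simp add: dist_norm norm_smult_complex T_def field_simps)
    have hol: "\<phi> holomorphic_on ball 0 T"
      unfolding holomorphic_on_def
    proof
      fix t :: complex assume "t \<in> ball 0 T"
      then obtain D' where "(h has_derivative D') (at (w + t *s v))" "\<And>c v. D' (c *s v) = c * D' v"
        using h(1)[OF mem] unfolding holomorphic_at_def by blast
      then have "(\<phi> has_field_derivative D' v) (at t)"
        unfolding \<phi>_def by (rule holomorphic_at_line_derivative)
      then show "\<phi> field_differentiable at t within ball 0 T"
        using field_differentiable_at_within field_differentiable_def by blast
    qed
    have bd: "norm (\<phi> t) \<le> M" if "t \<in> ball 0 T" for t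
      using h(2)[OF mem[OF that]] by (simp add: \<phi>_def)
    have d: "deriv \<phi> 0 = D v"
      unfolding \<phi>_def by (rule DERIV_imp_deriv, rule holomorphic_at_line_derivative) (use D in simp_all)
    have "norm ((deriv ^^ 1) \<phi> 0) \<le> fact 1 * M / (T / 2) ^ 1"
      by (rule Cauchy_inequality_ball[OF hol bd]) (use T in auto)
    then have 1: "norm (D v) \<le> 2 * M / \<epsilon> * norm v"
      by (simp add: d T_def mult_ac)
    have 2: "norm (h (w + v) - h w - D v) \<le> 32 * M / \<epsilon>\<^sup>2 * (norm v)\<^sup>2" if "norm v < \<epsilon> / 2"
    proof -
      have "norm (1 :: complex) < T / 2" using that False by (simp add: T_def field_simps)
      from quadratic_Taylor_bound[OF hol bd this] show ?thesis
        by (simp add: d) (simp add: \<phi>_def T_def power_divide)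
    qed
    from 1 2 show ?thesis by blast
  qed
  then show "norm (D v) \<le> 2 * M / \<epsilon> * norm v"
    and "norm v < \<epsilon> / 2 \<Longrightarrow> norm (h (w + v) - h w - D v) \<le> 32 * M / \<epsilon>\<^sup>2 * (norm v)\<^sup>2" by blast+
qed

lemma has_sum_diff:
  fixes f g :: "'i \<Rightarrow> 'b::real_normed_vector"
  assumes "(f has_sum a) A" "(g has_sum b) A"
  shows "((\<lambda>x. f x - g x) has_sum (a - b)) A"
  using has_sum_add[OF assms(1), of "\<lambda>x. - g x" "- b"] assms(2) by (simp add: has_sum_uminus)

text \<open>The derivative is the sum of the derivatives. First- and second-order estimates hold for
  all terms on the same ball with constants proportional to \<open>M i\<close>, so both sum up, and
  the remainder of the sum is still quadratic in \<open>v\<close>.\<close>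

lemma holomorphic_at_infsum:
  fixes h :: "'i \<Rightarrow> complex^'n \<Rightarrow> complex"
  assumes h: "\<And>i x. x \<in> ball w \<epsilon> \<Longrightarrow> holomorphic_at (h i) x" "\<And>i x. x \<in> ball w \<epsilon> \<Longrightarrow> norm (h i x) \<le> M i"
    and \<epsilon>: "\<epsilon> > 0" and M: "M summable_on UNIV"
  shows "holomorphic_at (\<lambda>x. \<Sum>\<^sub>\<infinity>i. h i x) w"
proof -
  have w: "w \<in> ball w \<epsilon>" using \<epsilon> by simp
  have "\<exists>D. (h i has_derivative D) (at w) \<and> (\<forall>c v. D (c *s v) = c * D v)" for i
    using h(1)[OF w] unfolding holomorphic_at_def by blast
  then obtain D where D: "\<And>i. (h i has_derivative D i) (at w)" "\<And>i c v. D i (c *s v) = c * D i v"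
    by metis
  note est = holomorphic_at_ball_estimates[OF h \<epsilon> D]
  define S where "S v = (\<Sum>\<^sub>\<infinity>i. D i v)" for v
  define m where "m = infsum M UNIV"
  have Msum: "((\<lambda>i. c * M i) has_sum (c * m)) UNIV" for c :: real
    unfolding m_def using M by (intro has_sum_cmult_right has_sum_infsum)
  have hs: "((\<lambda>i. D i v) has_sum S v) UNIV" for v
    unfolding S_def
  proof (rule has_sum_infsum, rule summable_on_norm_bound)
    show "(\<lambda>i. 2 * norm v / \<epsilon> * M i) summable_on UNIV" using Msum has_sum_imp_summable by blast
    show "norm (D i v) \<le> 2 * norm v / \<epsilon> * M i" for i using est(1)[of i v] by (simp add: field_simps)
  qed
  have hsum: "((\<lambda>i. h i x) has_sum (\<Sum>\<^sub>\<infinity>i. h i x)) UNIV" if "x \<in> ball w \<epsilon>" for x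
    by (rule has_sum_infsum, rule summable_on_norm_bound[OF M]) (use h(2)[OF that] in blast)
  have D_lin: "linear (D i)" for i
    using D(1) has_derivative_linear by blast
  have Sbound: "norm (S v) \<le> norm v * (2 * m / \<epsilon>)" for v
  proof -
    have "norm (D i v) \<le> 2 * norm v / \<epsilon> * M i" for i using est(1)[of i v] by (simp add: field_simps)
    then have "norm (S v) \<le> 2 * norm v / \<epsilon> * m"
      by (rule norm_infsum_le[OF hs Msum])
    then show ?thesis by (simp add: field_simps)
  qed
  have S_lin: "bounded_linear S"
  proof (rule bounded_linear_intro[OF _ _ Sbound])
    fix u v :: "complex^'n" and c :: real
    have "((\<lambda>i. D i (u + v)) has_sum (S u + S v)) UNIV"
      using has_sum_add[OF hs[of u] hs[of v]] by (simp add: linear_add[OF D_lin])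
    then show "S (u + v) = S u + S v" using hs has_sum_unique by blast
    have "((\<lambda>i. D i (c *\<^sub>R u)) has_sum (c *\<^sub>R S u)) UNIV"
      using has_sum_scaleR[OF hs[of u], of c] by (simp add: linear_scale[OF D_lin])
    then show "S (c *\<^sub>R u) = c *\<^sub>R S u" using hs has_sum_unique by blast
  qed
  have S_complex: "S (c *s v) = c * S v" for c v
  proof -
    have "((\<lambda>i. D i (c *s v)) has_sum (c * S v)) UNIV"
      using has_sum_cmult_right[OF hs[of v], of c] by (simp add: D(2))
    then show ?thesis using hs has_sum_unique by blast
  qed
  define K where "K = 32 * m / \<epsilon>\<^sup>2"
  have rem: "norm ((\<Sum>\<^sub>\<infinity>i. h i (w + v)) - (\<Sum>\<^sub>\<infinity>i. h i w) - S v) \<le> K * (norm v)\<^sup>2"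
    if v: "norm v < \<epsilon> / 2" for v
  proof -
    have "w + v \<in> ball w \<epsilon>" using v \<epsilon> by (simp add: dist_norm)
    then have "((\<lambda>i. h i (w + v) - h i w - D i v) has_sum ((\<Sum>\<^sub>\<infinity>i. h i (w + v)) - (\<Sum>\<^sub>\<infinity>i. h i w) - S v)) UNIV"
      by (rule has_sum_diff[OF has_sum_diff[OF hsum hsum[OF w]] hs])
    moreover have "norm (h i (w + v) - h i w - D i v) \<le> 32 * (norm v)\<^sup>2 / \<epsilon>\<^sup>2 * M i" for i
      using est(2)[of v i] v by (simp add: field_simps)
    ultimately have "norm ((\<Sum>\<^sub>\<infinity>i. h i (w + v)) - (\<Sum>\<^sub>\<infinity>i. h i w) - S v) \<le> 32 * (norm v)\<^sup>2 / \<epsilon>\<^sup>2 * m"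
      by (rule norm_infsum_le[OF _ Msum])
    then show ?thesis by (simp add: K_def field_simps)
  qed
  have "((\<lambda>x. \<Sum>\<^sub>\<infinity>i. h i x) has_derivative S) (at w)"
    unfolding has_derivative_at_alt
  proof (intro conjI allI impI S_lin)
    fix e :: real assume e: "e > 0"
    define d where "d = min (\<epsilon> / 2) (e / (\<bar>K\<bar> + 1))"
    have "d > 0" using e \<epsilon> by (simp add: d_def)
    moreover have "norm ((\<Sum>\<^sub>\<infinity>i. h i y) - (\<Sum>\<^sub>\<infinity>i. h i w) - S (y - w)) \<le> e * norm (y - w)" if y: "norm (y - w) < d" for y
    proof -
      let ?n = "norm (y - w)"
      have "norm ((\<Sum>\<^sub>\<infinity>i. h i y) - (\<Sum>\<^sub>\<infinity>i. h i w) - S (y - w)) \<le> K * ?n\<^sup>2"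
        using rem[of "y - w"] y by (simp add: d_def)
      also have "\<dots> \<le> (\<bar>K\<bar> + 1) * ?n * ?n"
        by (simp add: power2_eq_square mult.assoc mult_right_mono)
      also have "\<dots> \<le> e * ?n"
      proof (rule mult_right_mono)
        have "(\<bar>K\<bar> + 1) * ?n \<le> (\<bar>K\<bar> + 1) * (e / (\<bar>K\<bar> + 1))"
          using y by (intro mult_left_mono) (auto simp: d_def)
        then show "(\<bar>K\<bar> + 1) * ?n \<le> e" by simp
      qed simp
      finally show ?thesis .
    qed
    ultimately show "\<exists>d>0. \<forall>y. norm (y - w) < d \<longrightarrow>
        norm ((\<Sum>\<^sub>\<infinity>i. h i y) - (\<Sum>\<^sub>\<infinity>i. h i w) - S (y - w)) \<le> e * norm (y - w)" by blast
  qed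
  then show ?thesis unfolding holomorphic_at_def using S_complex by blast
qed

text \<open>A quadratic bound on \<eta> forces, by Cauchy's estimates, a derivative of norm at most
  1/2 near 0. So id + \<eta> shrinks distances at most by a factor 2: it is injective, has open
  image by invariance of domain, and its inverse is continuous. Differentiability of the inverse
  then follows from invertibility of the derivative.\<close>

lemma inverse_germ_near_identity:
  fixes \<eta> :: "complex^'p \<Rightarrow> complex^'p"
  assumes diff: "\<forall>\<^sub>F w in nhds 0. complex_differentiable_at \<eta> w"
    and quad: "\<forall>\<^sub>F w in nhds 0. norm (\<eta> w) \<le> C * (norm w)\<^sup>2"
  shows "\<exists>\<psi>'. inverse_germs (\<lambda>w. w + \<eta> w) \<psi>'"
proof -
  obtain e where e: "e > 0" "\<And>w. norm w < e \<Longrightarrow> complex_differentiable_at \<eta> w \<and> norm (\<eta> w) \<le> C * (norm w)\<^sup>2"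
    using eventually_conj[OF diff quad] unfolding eventually_nhds_metric by (auto simp: dist_norm)
  define p where "p = real CARD('p)"
  \<comment> \<open>For |w| < \<open>\<delta>\<close> the ball of radius \<open>\<delta>\<close>
    about w stays within norm 2 * \<open>\<delta>\<close> \<le> \<open>e\<close>, where \<eta> is at
    most 4 |C| \<open>\<delta>\<close>^2. Cauchy then bounds each component of the derivative by 8
    |C| \<open>\<delta>\<close>; the 16 \<open>p\<close> makes the sum over \<open>p\<close>
    components at most 1/2.\<close>
  define \<delta> where "\<delta> = min (e / 2) (1 / (16 * p * (\<bar>C\<bar> + 1)))"
  have p: "p > 0" by (simp add: p_def)
  then have \<delta>: "\<delta> > 0" "2 * \<delta> \<le> e" "\<delta> \<le> 1 / (16 * p * (\<bar>C\<bar> + 1))" using e by (auto simp: \<delta>_def)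
  let ?U = "ball (0 :: complex^'p) \<delta>"
  let ?\<psi> = "\<lambda>w. w + \<eta> w"
  have "\<exists>D. (\<eta> has_derivative D) (at w) \<and> (\<forall>c v. D (c *s v) = c *s D v) \<and> (\<forall>v. norm (D v) \<le> norm v / 2)"
    if w: "w \<in> ?U" for w
  proof -
    have "norm w < e" using w \<delta> by simp
    then obtain D where D: "(\<eta> has_derivative D) (at w)" "\<And>c v. D (c *s v) = c *s D v"
      using e(2) unfolding complex_differentiable_at_def by blast
    have comp: "norm (D v $ k) \<le> 8 * \<bar>C\<bar> * \<delta> * norm v" for v k
    proof -
      have *: "norm x < 2 * \<delta>" if "x \<in> ball w \<delta>" for x
        using that w norm_triangle_ineq2[of x w] by (simp add: dist_norm norm_minus_commute)
      have "norm (D v $ k) \<le> 2 * (4 * \<bar>C\<bar> * \<delta>\<^sup>2) / \<delta> * norm v"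
      proof (rule holomorphic_at_ball_estimates(1)[where h = "\<lambda>w. \<eta> w $ k" and D = "\<lambda>v. D v $ k" and w = w])
        fix x assume "x \<in> ball w \<delta>"
        then have x: "norm x < 2 * \<delta>" "norm x < e" using * \<delta> by fastforce+
        show "holomorphic_at (\<lambda>w. \<eta> w $ k) x"
          using e(2)[OF x(2)] by (simp add: complex_differentiable_at_iff)
        have "norm (\<eta> x $ k) \<le> norm (\<eta> x)" by (rule Finite_Cartesian_Product.norm_nth_le)
        also have "\<dots> \<le> C * (norm x)\<^sup>2" using e(2)[OF x(2)] by simp
        also have "\<dots> \<le> \<bar>C\<bar> * (2 * \<delta>)\<^sup>2"
          using x(1) by (intro mult_mono power_mono) auto
        finally show "norm (\<eta> x $ k) \<le> 4 * \<bar>C\<bar> * \<delta>\<^sup>2" by (simp add: power_mult_distrib)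
      next
        show "((\<lambda>w. \<eta> w $ k) has_derivative (\<lambda>v. D v $ k)) (at w)"
          by (rule bounded_linear.has_derivative[OF bounded_linear_vec_nth D(1)])
      qed (use \<delta> D in auto)
      then show ?thesis using \<delta>(1) by (simp add: power2_eq_square)
    qed
    have "norm (D v) \<le> norm v / 2" for v
    proof -
      have "norm (D v) \<le> (\<Sum>k\<in>UNIV. norm (D v $ k))" by (rule norm_le_sum_norm_nth)
      also have "\<dots> \<le> (\<Sum>k\<in>(UNIV::'p set). 8 * \<bar>C\<bar> * \<delta> * norm v)"
        by (intro sum_mono comp)
      also have "\<dots> = 8 * p * \<bar>C\<bar> * \<delta> * norm v" by (simp add: p_def)
      also have "\<dots> \<le> 1 / 2 * norm v"
      proof (rule mult_right_mono)
        have "8 * p * \<bar>C\<bar> * \<delta> \<le> 8 * p * (\<bar>C\<bar> + 1) * (1 / (16 * p * (\<bar>C\<bar> + 1)))"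
          using \<delta> p by (intro mult_mono) auto
        also have "\<dots> = 1 / 2"
        proof -
          have "p * (\<bar>C\<bar> + 1) \<noteq> 0" using p abs_ge_zero[of C] by auto
          then show ?thesis by (simp add: divide_simps)
        qed
        finally show "8 * p * \<bar>C\<bar> * \<delta> \<le> 1 / 2" .
      qed simp
      finally show ?thesis by simp
    qed
    then show ?thesis using D by blast
  qed
  then obtain D where D: "\<And>w. w \<in> ?U \<Longrightarrow> (\<eta> has_derivative D w) (at w)"
    "\<And>w c v. w \<in> ?U \<Longrightarrow> D w (c *s v) = c *s D w v" "\<And>w v. w \<in> ?U \<Longrightarrow> norm (D w v) \<le> norm v / 2"
    by metis
  have lip: "norm (\<eta> x - \<eta> y) \<le> 1 / 2 * norm (x - y)" if "x \<in> ?U" "y \<in> ?U" for x y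
  proof (rule differentiable_bound[where S = ?U and f' = D])
    fix w assume w: "w \<in> ?U"
    show "(\<eta> has_derivative D w) (at w within ?U)" using D(1)[OF w] by (rule has_derivative_at_withinI)
    show "onorm (D w) \<le> 1 / 2" using D(3)[OF w] by (intro onorm_bound) auto
  qed (use that in auto)
  have expand: "norm (x - y) \<le> 2 * norm (?\<psi> x - ?\<psi> y)" if "x \<in> ?U" "y \<in> ?U" for x y
  proof -
    have "norm (x - y) - norm (\<eta> y - \<eta> x) \<le> norm ((x - y) - (\<eta> y - \<eta> x))" by (rule norm_triangle_ineq2)
    also have "(x - y) - (\<eta> y - \<eta> x) = ?\<psi> x - ?\<psi> y" by simp
    finally show ?thesis using lip[OF that(2,1)] by (simp add: norm_minus_commute)
  qed
  have inj: "inj_on ?\<psi> ?U"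
    by (rule inj_onI) (use expand in force)
  have der: "(?\<psi> has_derivative (\<lambda>v. v + D w v)) (at w)" if "w \<in> ?U" for w
    using D(1)[OF that] by (intro derivative_intros)
  have cont: "continuous_on ?U ?\<psi>"
    using der has_derivative_continuous by (metis continuous_at_imp_continuous_on)
  define V where "V = ?\<psi> ` ?U"
  have V: "open V" unfolding V_def by (rule invariance_of_domain[OF cont open_ball inj])
  have \<eta>0: "\<eta> 0 = 0" using e(2)[of 0] e(1) by simp
  have V0: "0 \<in> V" using \<delta> \<eta>0 unfolding V_def by (force intro!: image_eqI[of _ _ 0])
  define \<psi>' where "\<psi>' = inv_into ?U ?\<psi>"
  have inv1: "\<psi>' (?\<psi> w) = w" if "w \<in> ?U" for w
    unfolding \<psi>'_def by (rule inv_into_f_f[OF inj that])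
  have inv2: "?\<psi> (\<psi>' y) = y" "\<psi>' y \<in> ?U" if "y \<in> V" for y
    using that unfolding \<psi>'_def V_def by (rule f_inv_into_f, rule inv_into_into)
  have cont': "isCont \<psi>' y" if y: "y \<in> V" for y
  proof -
    have "continuous_on V \<psi>'"
      unfolding continuous_on_iff
    proof (intro ballI allI impI)
      fix y and \<epsilon> :: real assume y: "y \<in> V" and \<epsilon>: "\<epsilon> > 0"
      show "\<exists>d>0. \<forall>x'\<in>V. dist x' y < d \<longrightarrow> dist (\<psi>' x') (\<psi>' y) < \<epsilon>"
      proof (intro exI[of _ "\<epsilon> / 2"] conjI ballI impI)
        fix x assume x: "x \<in> V" "dist x y < \<epsilon> / 2"
        show "dist (\<psi>' x) (\<psi>' y) < \<epsilon>"
          using expand[OF inv2(2)[OF x(1)] inv2(2)[OF y]] x(2) unfolding inv2(1)[OF x(1)] inv2(1)[OF y]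
          by (simp add: dist_norm)
      qed (use \<epsilon> in simp)
    qed
    then show ?thesis using V y continuous_on_eq_continuous_at by blast
  qed
  have d\<psi>': "complex_differentiable_at \<psi>' y" if y: "y \<in> V" for y
  proof -
    let ?w = "\<psi>' y"
    let ?E = "\<lambda>v. v + D ?w v"
    have w: "?w \<in> ?U" by (rule inv2(2)[OF y])
    have linE: "linear ?E" using der[OF w] has_derivative_linear by blast
    have injE: "inj ?E"
      unfolding linear_injective_0[OF linE]
    proof (intro allI impI)
      fix v assume "?E v = 0"
      then have "norm v = norm (D ?w v)" by (metis add_eq_0_iff norm_minus_cancel)
      then show "v = 0" using D(3)[OF w, of v] by simp
    qed
    obtain G where G: "linear G" "G \<circ> ?E = id"
      using linear_injective_left_inverse[OF linE injE] by blast
    have "(\<psi>' has_derivative G) (at y)"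
      by (rule has_derivative_inverse_basic[OF _ _ G(2) cont'[OF y] V y inv2(1)])
        (use der[OF w] G(1) in \<open>auto intro: linear_conv_bounded_linear[THEN iffD1]\<close>)
    \<comment> \<open>\<open>G\<close> was obtained as a real-linear left inverse; it inherits
      complex linearity because \<open>?E\<close> is complex linear and onto.\<close>
    moreover have "G (c *s u) = c *s G u" for c u
    proof -
      obtain v where v: "u = ?E v" using linear_injective_imp_surjective[OF linE injE] by (metis surjD)
      have "c *s u = ?E (c *s v)" unfolding v by (simp add: D(2)[OF w] vec_eq_iff algebra_simps)
      then show ?thesis using G(2) unfolding v fun_eq_iff by simp
    qed
    ultimately show ?thesis unfolding complex_differentiable_at_def by blast
  qed
  have d\<psi>: "complex_differentiable_at ?\<psi> w" if w: "w \<in> ?U" for w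
    unfolding complex_differentiable_at_def using der[OF w]
    by (intro exI[of _ "\<lambda>v. v + D w v"]) (simp add: D(2)[OF w] vec_eq_iff algebra_simps)
  have "\<psi>' 0 = 0" using inv1[of 0] \<delta> \<eta>0 by simp
  have U: "\<forall>\<^sub>F w in nhds 0. w \<in> ?U"
    by (rule eventually_nhds_in_open[OF open_ball]) (use \<delta> in simp)
  have V': "\<forall>\<^sub>F w in nhds 0. w \<in> V"
    by (rule eventually_nhds_in_open[OF V V0])
  have "\<forall>\<^sub>F w in nhds 0. complex_differentiable_at ?\<psi> w \<and> \<psi>' (?\<psi> w) = w"
    using U by (rule eventually_mono) (use d\<psi> inv1 in blast)
  moreover have "\<forall>\<^sub>F w in nhds 0. complex_differentiable_at \<psi>' w \<and> ?\<psi> (\<psi>' w) = w"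
    using V' by (rule eventually_mono) (use d\<psi>' inv2(1) in blast)
  ultimately show ?thesis
    unfolding inverse_germs_def map_germ_def using \<eta>0 \<open>\<psi>' 0 = 0\<close>
    by (intro exI[of _ \<psi>']) (simp add: eventually_conj_iff)
qed

subsection \<open>Sufficiency of the axis conditions\<close>

text \<open>Let d be the least positive difference of two elements x and x + d. If d did not divide
  some s in \<open>S\<close>, then (s div d) (x + d) + s mod d = (s div d) x + s would give the
  smaller positive difference s mod d. So d divides every element, hence d = 1, and two consecutive
  numbers lie in \<open>S\<close>.\<close>

lemma numerical_semigroup_conductor:
  fixes S :: "nat set"
  assumes zero: "0 \<in> S" and add: "\<And>x y. x \<in> S \<Longrightarrow> y \<in> S \<Longrightarrow> x + y \<in> S" and gcd: "Gcd S = 1"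
  shows "\<exists>c. \<forall>e\<ge>c. e \<in> S"
proof -
  have mult: "k * x \<in> S" if "x \<in> S" for k x
    by (induction k) (auto simp: zero intro: add that)
  let ?P = "\<lambda>d. d > 0 \<and> (\<exists>x\<in>S. x + d \<in> S)"
  have "\<exists>s\<in>S. s \<noteq> 0" using gcd Gcd_0_iff[of S] by auto
  then have "\<exists>d. ?P d" using zero by force
  then have d: "?P (LEAST d. ?P d)" by (rule LeastI_ex)
  define d where "d = (LEAST d. ?P d)"
  obtain x where x: "d > 0" "x \<in> S" "x + d \<in> S" using d unfolding d_def by blast
  have min: "d \<le> d'" if "d' > 0" "y \<in> S" "y + d' \<in> S" for d' y
    unfolding d_def using that by (intro Least_le) blast
  have "d dvd s" if s: "s \<in> S" for s
  proof (rule ccontr)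
    assume "\<not> d dvd s"
    then have pos: "s mod d > 0" using mod_greater_zero_iff_not_dvd by blast
    have "(s div d) * (x + d) + s mod d = (s div d) * x + s"
      by (simp add: algebra_simps)
    then have "(s div d) * (x + d) + s mod d \<in> S"
      using add[OF mult[OF x(2)] s] by simp
    from min[OF pos mult[OF x(3)] this] show False
      using x(1) mod_less_divisor[of d s] by linarith
  qed
  then have "d dvd Gcd S" by (rule Gcd_greatest)
  then have x1: "x \<in> S" "x + 1 \<in> S" using gcd x by auto
  show ?thesis
  proof (intro exI allI impI)
    \<comment> \<open>With quotient k and remainder r of e by x one has e = (k - r) x + r (x + 1);
      the bound on e guarantees r < x \<le> k. If x = 0, then 1 is in \<open>S\<close> and there is
      nothing to divide.\<close>
    fix e assume e: "e \<ge> x * x + x"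
    define k where "k = (if x = 0 then 0 else e div x - e mod x)"
    show "e \<in> S"
    proof (cases "x = 0")
      case True
      then show ?thesis using mult[OF x1(2), of e] by simp
    next
      case False
      have "e div x \<ge> x" using e False by (simp add: less_eq_div_iff_mult_less_eq)
      then have "e mod x \<le> e div x" using mod_less_divisor[of x e] False by linarith
      then have "(e div x - e mod x) * x + e mod x * (x + 1) = e"
        by (simp add: algebra_simps diff_mult_distrib)
      moreover have "(e div x - e mod x) * x + e mod x * (x + 1) \<in> S"
        by (rule add[OF mult[OF x1(1)] mult[OF x1(2)]])
      ultimately show ?thesis by (simp only:)
    qed
  qed
qed

definition single :: "'n \<Rightarrow> nat \<Rightarrow> 'n \<Rightarrow> nat" where
  "single j e = (\<lambda>t. if t = j then e else 0)"

definition pair :: "'n \<Rightarrow> nat \<Rightarrow> 'n \<Rightarrow> 'n \<Rightarrow> nat" where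
  "pair i l j = (\<lambda>t. if t = j then 1 else if t = i then l else 0)"

text \<open>As the Gcd of the empty set is 0, the first condition includes that some power of each
  coordinate occurs. In the second, l = 0 is allowed: if z_j itself is a component, it serves for
  every i.\<close>

definition axis_conditions :: "('n \<Rightarrow> nat) set \<Rightarrow> bool" where
  "axis_conditions E \<longleftrightarrow>
     (\<forall>j. Gcd {e. single j e \<in> E} = 1 \<and> (\<forall>i. i \<noteq> j \<longrightarrow> (\<exists>l. pair i l j \<in> E)))"

inductive_set sums_of :: "('n \<Rightarrow> nat) set \<Rightarrow> ('n \<Rightarrow> nat) set" for E where
  zero: "(\<lambda>_. 0) \<in> sums_of E"
| add: "a \<in> E \<Longrightarrow> b \<in> sums_of E \<Longrightarrow> (\<lambda>t. a t + b t) \<in> sums_of E"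

lemma sums_of_base: "a \<in> E \<Longrightarrow> a \<in> sums_of E"
  using sums_of.add[OF _ sums_of.zero, of a E] by simp

lemma sums_of_add:
  assumes "a \<in> sums_of E" "b \<in> sums_of E"
  shows "(\<lambda>t. a t + b t) \<in> sums_of E"
  using assms(1)
proof (induction rule: sums_of.induct)
  case zero
  then show ?case using assms(2) by simp
next
  case (add a c)
  from sums_of.add[OF add.hyps(1) add.IH] show ?case by (simp only: add.assoc)
qed

lemma sums_of_mult:
  assumes "a \<in> sums_of E" shows "(\<lambda>t. k * a t) \<in> sums_of E"
proof (induction k)
  case 0
  then show ?case using sums_of.zero by simp
next
  case (Suc k)
  from sums_of_add[OF assms Suc] show ?case by simp
qed

lemma sums_of_sum:
  assumes "finite I" "\<And>i. i \<in> I \<Longrightarrow> g i \<in> sums_of E"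
  shows "(\<lambda>t. \<Sum>i\<in>I. g i t) \<in> sums_of E"
  using assms
proof (induction I rule: finite_induct)
  case empty
  then show ?case using sums_of.zero by simp
next
  case (insert i I)
  have "(\<lambda>t. g i t + (\<Sum>i\<in>I. g i t)) \<in> sums_of E"
    by (rule sums_of_add) (use insert in auto)
  then show ?case using insert.hyps by simp
qed

text \<open>A large degree makes the exponent of some z_i large. For another j, either a j is beyond
  the conductor \<open>c j\<close> of the powers of z_j, or a j < \<open>c j\<close> copies of z_i^l
  z_j supply it. These copies use up at most \<open>m i\<close> of the exponent of z_i, so at least
  \<open>c i\<close> is left there, which is again a sum of powers of z_i from E.\<close>

lemma axis_conditions_conductor:
  fixes E :: "('n::finite \<Rightarrow> nat) set"
  assumes E: "axis_conditions E"
  shows "\<exists>R. \<forall>a. mdeg a \<ge> R \<longrightarrow> a \<in> sums_of E"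
proof -
  have "\<exists>c. \<forall>e\<ge>c. single j e \<in> sums_of E" for j
  proof -
    have "Gcd {e. single j e \<in> sums_of E} dvd Gcd {e. single j e \<in> E}"
    proof (rule Gcd_greatest)
      fix e assume "e \<in> {e. single j e \<in> E}"
      then have "e \<in> {e. single j e \<in> sums_of E}" using sums_of_base[of "single j e" E] by simp
      then show "Gcd {e. single j e \<in> sums_of E} dvd e" by (rule Gcd_dvd)
    qed
    then have "Gcd {e. single j e \<in> sums_of E} = 1"
      using E unfolding axis_conditions_def by simp
    have "\<exists>c. \<forall>e\<ge>c. e \<in> {e. single j e \<in> sums_of E}"
    proof (rule numerical_semigroup_conductor)
      show "Gcd {e. single j e \<in> sums_of E} = 1" by fact
      show "0 \<in> {e. single j e \<in> sums_of E}"
        using sums_of.zero[of E] by (simp add: single_def)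
      fix x y assume "x \<in> {e. single j e \<in> sums_of E}" "y \<in> {e. single j e \<in> sums_of E}"
      moreover have "(\<lambda>t. single j x t + single j y t) = single j (x + y)"
        by (auto simp: single_def)
      ultimately show "x + y \<in> {e. single j e \<in> sums_of E}"
        using sums_of_add[of "single j x" E "single j y"] by simp
    qed
    then show ?thesis by simp
  qed
  then obtain c where c: "\<And>j e. e \<ge> c j \<Longrightarrow> single j e \<in> sums_of E" by metis
  have "\<forall>i j. \<exists>l. i \<noteq> j \<longrightarrow> pair i l j \<in> E"
    using E unfolding axis_conditions_def by blast
  then obtain l where l: "\<And>i j. i \<noteq> j \<Longrightarrow> pair i (l i j) j \<in> E" by metis
  define m where "m i = (\<Sum>j\<in>UNIV. c j * l i j)" for i
  show ?thesis
  proof (intro exI allI impI)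
    fix a :: "'n \<Rightarrow> nat" assume a: "mdeg a \<ge> (\<Sum>i\<in>UNIV. m i + c i)"
    have "\<exists>i. a i \<ge> m i + c i"
    proof (rule ccontr)
      assume "\<not> ?thesis"
      then have lt: "a i < m i + c i" for i by (simp add: not_le)
      have "mdeg a < (\<Sum>i\<in>UNIV. m i + c i)"
        unfolding mdeg_def by (rule sum_strict_mono) (use lt in auto)
      then show False using a by linarith
    qed
    then obtain i where i: "a i \<ge> m i + c i" by blast
    define g where "g j = (if a j \<ge> c j then single j (a j) else (\<lambda>t. a j * pair i (l i j) j t))" for j
    define u where "u = (\<Sum>j\<in>UNIV - {i}. g j i)"
    have "u \<le> m i"
    proof -
      have "u \<le> (\<Sum>j\<in>UNIV - {i}. c j * l i j)"
        unfolding u_def g_def by (intro sum_mono) (auto simp: single_def pair_def)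
      also have "\<dots> \<le> m i" unfolding m_def by (intro sum_mono2) auto
      finally show ?thesis .
    qed
    with i have u: "a i - u \<ge> c i" "u \<le> a i" by linarith+
    have "g j \<in> sums_of E" if "j \<noteq> i" for j
      using that c[of j "a j"] sums_of_mult[OF sums_of_base[OF l[of i j]], of "a j"] unfolding g_def
      by (cases "a j \<ge> c j") simp_all
    then have "(\<lambda>t. \<Sum>j\<in>UNIV - {i}. g j t) \<in> sums_of E"
      using sums_of_sum[of "UNIV - {i}" g E] by simp
    from sums_of_add[OF this c[OF u(1)]]
    have "(\<lambda>t. (\<Sum>j\<in>UNIV - {i}. g j t) + single i (a i - u) t) \<in> sums_of E" .
    also have "(\<lambda>t. (\<Sum>j\<in>UNIV - {i}. g j t) + single i (a i - u) t) = a"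
    proof
      fix t
      show "(\<Sum>j\<in>UNIV - {i}. g j t) + single i (a i - u) t = a t"
      proof (cases "t = i")
        case True
        then show ?thesis using u(2) unfolding u_def by (simp add: single_def)
      next
        case False
        have "(\<Sum>j\<in>UNIV - {i}. g j t) = (\<Sum>j\<in>UNIV - {i}. if j = t then a t else 0)"
          using False by (intro sum.cong) (auto simp: g_def single_def pair_def)
        also have "\<dots> = a t" using False by simp
        finally show ?thesis using False by (simp add: single_def)
      qed
    qed
    finally show "a \<in> sums_of E" .
  qed
qed

section \<open>Monomials as germs and the target coordinate change\<close>

definition germ_exponents :: "(complex^'n \<Rightarrow> complex^'p) \<Rightarrow> ('n \<Rightarrow> nat) set" where
  "germ_exponents f = {a. \<exists>k. \<forall>\<^sub>F z in nhds 0. f z $ k = mon a z}"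

text \<open>At a point with all coordinates nonzero, halving the i-th coordinate multiplies a
  monomial by (1/2) ^ a i, which determines a i.\<close>

lemma mon_inj:
  fixes a b :: "'n::finite \<Rightarrow> nat"
  assumes "\<forall>\<^sub>F z in nhds 0. mon a z = mon b z"
  shows "a = b"
proof
  fix i :: 'n
  obtain e where e: "e > 0" "\<And>z. norm z < e \<Longrightarrow> mon a z = mon b z"
    using assms unfolding eventually_nhds_metric by (auto simp: dist_norm)
  define s where "s = complex_of_real (e / (2 * CARD('n)))"
  have s: "s \<noteq> 0" "norm s = e / (2 * CARD('n))" using e unfolding s_def by (simp_all only: norm_of_real) simp_all
  define z where "z c = (\<chi> j. if j = i then c * s else s)" for c :: complex
  have "norm (z c) < e" if "norm c \<le> 1" for c
  proof -
    have "norm (z c) \<le> (\<Sum>j\<in>UNIV. norm (z c $ j))" by (rule norm_le_sum_norm_nth)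
    also have "\<dots> \<le> (\<Sum>j\<in>(UNIV::'n set). norm s)"
      using that by (intro sum_mono) (auto simp: z_def norm_mult mult_left_le_one_le)
    also have "\<dots> < e" using e s(2) by simp
    finally show ?thesis .
  qed
  then have eq: "mon a (z c) = mon b (z c)" if "norm c \<le> 1" for c using e(2) that by blast
  have z1: "z 1 = (\<chi> j. s)" by (simp add: z_def vec_eq_iff)
  have mz: "mon a (z c) = c ^ a i * mon a (z 1)" for a c
  proof -
    have "mon a (z c) = (\<Prod>j\<in>UNIV. (if j = i then c ^ a i else 1) * s ^ a j)"
      unfolding mon_def z_def by (intro prod.cong) (auto simp: power_mult_distrib)
    also have "\<dots> = c ^ a i * (\<Prod>j\<in>UNIV. s ^ a j)" by (simp add: prod.distrib)
    finally show ?thesis using z1 by (simp add: mon_def)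
  qed
  have nz: "mon a (z 1) \<noteq> 0" using s by (simp add: mon_def z1)
  have "(1 / 2 :: complex) ^ a i * mon a (z 1) = (1 / 2) ^ b i * mon b (z 1)"
    using eq[of "1 / 2"] unfolding mz[of a "1 / 2"] mz[of b "1 / 2"] by simp
  then have "(1 / 2 :: complex) ^ a i = (1 / 2) ^ b i" using eq[of 1] nz by simp
  then have "(2 :: complex) ^ a i = 2 ^ b i" by (simp add: power_divide)
  then have "(2 :: real) ^ a i = 2 ^ b i" by (metis norm_numeral norm_power)
  then show "a i = b i" by simp
qed

lemma norm_mon_le: "norm (mon b w) \<le> norm w ^ mdeg b"
proof -
  have "norm (mon b w) \<le> (\<Prod>k\<in>UNIV. norm w ^ b k)"
    unfolding mon_def prod_norm[symmetric] norm_power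
    by (intro prod_mono conjI power_mono Finite_Cartesian_Product.norm_nth_le) auto
  then show ?thesis by (simp add: mdeg_def power_sum)
qed

lemma holomorphic_at_mon: "holomorphic_at (mon a) z"
  unfolding mon_def[abs_def] by (intro holomorphic_at_prod holomorphic_at_power holomorphic_at_nth)

lemma sums_of_representation:
  fixes A :: "'p::finite \<Rightarrow> 'n::finite \<Rightarrow> nat"
  assumes "a \<in> sums_of (A ` K)"
  shows "\<exists>b. (\<forall>k. k \<notin> K \<longrightarrow> b k = 0) \<and> (\<forall>t. a t = (\<Sum>k\<in>UNIV. b k * A k t))"
  using assms
proof (induction rule: sums_of.induct)
  case zero
  then show ?case by (intro exI[of _ "\<lambda>_. 0"]) simp
next
  case (add a a')
  then obtain k b where k: "k \<in> K" "a = A k"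
    and b: "\<forall>k. k \<notin> K \<longrightarrow> b k = 0" "\<forall>t. a' t = (\<Sum>k\<in>UNIV. b k * A k t)" by blast
  have "a t + a' t = (\<Sum>k'\<in>UNIV. (b(k := Suc (b k))) k' * A k' t)" for t
  proof -
    have "(\<Sum>k'\<in>UNIV. (b(k := Suc (b k))) k' * A k' t)
        = (\<Sum>k'\<in>UNIV. (if k' = k then A k t else 0) + b k' * A k' t)"
      by (intro sum.cong) auto
    then show ?thesis using b k by (simp add: sum.distrib)
  qed
  then show ?case using b k by (intro exI[of _ "b(k := Suc (b k))"]) auto
qed

text \<open>Every monomial of large degree is a product of components of \<open>f\<close>; substituting such products
  term by term into the Taylor series of \<open>G - F\<close> gives \<open>\<eta>\<close>.\<close>

lemma factor_through_monomials:
  fixes f :: "complex^'n \<Rightarrow> complex^'p" and F G :: "complex^'n \<Rightarrow> complex"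
  assumes K: "\<And>k. k \<in> K \<Longrightarrow> \<forall>\<^sub>F z in nhds 0. f z $ k = mon (A k) z"
    and R: "\<And>a. mdeg a > R \<Longrightarrow> a \<in> sums_of (A ` K)"
    and D: "\<And>k. mdeg (A k) \<le> D" "2 * D \<le> R"
    and F: "\<forall>\<^sub>F z in nhds 0. holomorphic_at F z" and G: "\<forall>\<^sub>F z in nhds 0. holomorphic_at G z"
    and jets: "\<And>a. mdeg a \<le> R \<Longrightarrow> taylor_coeff F a = taylor_coeff G a"
  shows "\<exists>\<eta> C. (\<forall>\<^sub>F w in nhds 0. holomorphic_at \<eta> w) \<and> (\<forall>\<^sub>F w in nhds 0. norm (\<eta> w) \<le> C * (norm w)\<^sup>2) \<and>
    (\<forall>\<^sub>F z in nhds 0. G z - F z = \<eta> (f z))"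
proof -
  obtain r1 B1 where 1: "r1 > 0" "B1 \<ge> 0" "\<And>a. norm (taylor_coeff F a) \<le> B1 / r1 ^ mdeg a"
    "\<And>z. z \<in> polydisc r1 \<Longrightarrow> ((\<lambda>a. taylor_coeff F a * mon a z) has_sum F z) UNIV"
    using Taylor_expansion[OF F] by blast
  obtain r2 B2 where 2: "r2 > 0" "B2 \<ge> 0" "\<And>a. norm (taylor_coeff G a) \<le> B2 / r2 ^ mdeg a"
    "\<And>z. z \<in> polydisc r2 \<Longrightarrow> ((\<lambda>a. taylor_coeff G a * mon a z) has_sum G z) UNIV"
    using Taylor_expansion[OF G] by blast
  define r where "r = min 1 (min r1 r2)"
  define B where "B = B1 + B2"
  define d where "d a = taylor_coeff G a - taylor_coeff F a" for a
  have r: "0 < r" "r \<le> 1" "r \<le> r1" "r \<le> r2" using 1 2 by (auto simp: r_def)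
  have dB: "norm (d a) \<le> B / r ^ mdeg a" for a
  proof -
    have "norm (d a) \<le> B2 / r2 ^ mdeg a + B1 / r1 ^ mdeg a"
      unfolding d_def using 1(3)[of a] 2(3)[of a] norm_triangle_ineq4[of "taylor_coeff G a" "taylor_coeff F a"] by linarith
    also have "\<dots> \<le> B2 / r ^ mdeg a + B1 / r ^ mdeg a"
      using 1 2 r by (intro add_mono divide_left_mono power_mono mult_pos_pos zero_less_power) auto
    finally show ?thesis by (simp add: B_def add_divide_distrib)
  qed
  have "\<forall>a. \<exists>b. mdeg a > R \<longrightarrow> (\<forall>k. k \<notin> K \<longrightarrow> b k = 0) \<and> (\<forall>t. a t = (\<Sum>k\<in>UNIV. b k * A k t))"
    using sums_of_representation[OF R] by blast
  then obtain \<beta> where \<beta>: "\<And>a k. mdeg a > R \<Longrightarrow> k \<notin> K \<Longrightarrow> \<beta> a k = 0"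
    "\<And>a t. mdeg a > R \<Longrightarrow> a t = (\<Sum>k\<in>UNIV. \<beta> a k * A k t)" by metis
  have deg: "mdeg a \<le> D * mdeg (\<beta> a)" if "mdeg a > R" for a
  proof -
    have "mdeg a = (\<Sum>t\<in>UNIV. \<Sum>k\<in>UNIV. \<beta> a k * A k t)"
      unfolding mdeg_def using \<beta>(2)[OF that] by simp
    also have "\<dots> = (\<Sum>k\<in>UNIV. \<beta> a k * mdeg (A k))"
      by (subst sum.swap) (simp add: mdeg_def sum_distrib_left)
    also have "\<dots> \<le> (\<Sum>k\<in>UNIV. \<beta> a k * D)" by (intro sum_mono mult_left_mono D) auto
    finally show ?thesis by (simp add: mdeg_def sum_distrib_left mult.commute)
  qed
  \<comment> \<open>A product of fewer than two components has degree at most \<open>D\<close>,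
    while a has degree above R \<ge> 2 * \<open>D\<close>. This is what makes \<eta> start in order
    2.\<close>
  have deg2: "2 \<le> mdeg (\<beta> a)" if "mdeg a > R" for a
  proof (rule ccontr)
    assume "\<not> 2 \<le> mdeg (\<beta> a)"
    then have "D * mdeg (\<beta> a) \<le> D * 1" by (intro mult_left_mono) auto
    then show False using deg[OF that] D(2) that by linarith
  qed
  define h where "h a w = (if mdeg a > R then d a * mon (\<beta> a) w else 0)" for a w
  \<comment> \<open>For |w| \<le> \<open>\<delta>\<close>, the inequality deg a \<le> D deg (\<beta>
    a) bounds the monomial by (r/2)^(deg a) times (|w| / \<open>\<delta>\<close>)^2. The first
    factor beats the Cauchy bound B / r^(deg a) and leaves the summable 2^(- deg a); the second
    gives the quadratic bound on \<eta>.\<close>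
  define \<delta> where "\<delta> = (r / 2) ^ D"
  define M where "M a = B * (\<Prod>i\<in>UNIV. (1 / 2 :: real) ^ a i)" for a :: "'n \<Rightarrow> nat"
  have \<delta>: "0 < \<delta>" using r by (simp add: \<delta>_def)
  have B0: "B \<ge> 0" using 1 2 by (simp add: B_def)
  have M: "M summable_on UNIV"
    unfolding M_def using summable_geometric_expo[of "UNIV :: 'n set" "\<lambda>_. 1 / 2"]
    by (intro summable_on_cmult_right) (simp add: expo_def)
  have M_eq: "M a = B * (1 / 2) ^ mdeg a" for a by (simp add: M_def mdeg_def power_sum)
  have hM: "norm (h a w) \<le> M a * (norm w / \<delta>)\<^sup>2" if w: "norm w \<le> \<delta>" for a w
  proof (cases "mdeg a > R")
    case True
    let ?m = "mdeg (\<beta> a)"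
    have h_le: "norm (h a w) \<le> B / r ^ mdeg a * norm w ^ ?m"
      using mult_mono[OF dB[of a] norm_mon_le[of "\<beta> a" w]] True B0 r by (simp add: h_def norm_mult)
    have "norm w ^ ?m = \<delta> ^ ?m * (norm w / \<delta>) ^ ?m"
      using \<delta> by (simp add: power_divide)
    also have "\<dots> \<le> (r / 2) ^ mdeg a * (norm w / \<delta>)\<^sup>2"
    proof (rule mult_mono)
      have "\<delta> ^ ?m = (r / 2) ^ (D * ?m)" by (simp add: \<delta>_def power_mult)
      also have "\<dots> \<le> (r / 2) ^ mdeg a"
        using deg[OF True] r by (intro power_decreasing) auto
      finally show "\<delta> ^ ?m \<le> (r / 2) ^ mdeg a" .
      show "(norm w / \<delta>) ^ ?m \<le> (norm w / \<delta>)\<^sup>2"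
        using deg2[OF True] w \<delta> by (intro power_decreasing) auto
    qed (use r \<delta> in auto)
    finally have "B / r ^ mdeg a * norm w ^ ?m \<le> B / r ^ mdeg a * ((r / 2) ^ mdeg a * (norm w / \<delta>)\<^sup>2)"
      by (rule mult_left_mono) (use B0 r in simp)
    note order_trans[OF h_le this]
    also have "\<dots> = M a * (norm w / \<delta>)\<^sup>2"
      using r by (simp add: M_eq power_divide)
    finally show ?thesis .
  next
    case False
    then show ?thesis using B0 by (simp add: h_def M_eq)
  qed
  have hM1: "norm (h a w) \<le> M a" if w: "norm w \<le> \<delta>" for a w
  proof -
    have "(norm w / \<delta>)\<^sup>2 \<le> 1" using w \<delta> by (intro power_le_one) auto
    then have "M a * (norm w / \<delta>)\<^sup>2 \<le> M a * 1" using B0 by (intro mult_left_mono) (auto simp: M_eq)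
    then show ?thesis using hM[OF w, of a] by simp
  qed
  define \<eta> where "\<eta> w = (\<Sum>\<^sub>\<infinity>a. h a w)" for w
  have \<eta>1: "holomorphic_at \<eta> w" if "norm w < \<delta>" for w
    unfolding \<eta>_def
  proof (rule holomorphic_at_infsum[OF _ _ _ M])
    show "0 < \<delta> - norm w" using that by simp
    fix a x assume "x \<in> ball w (\<delta> - norm w)"
    then have "norm x \<le> \<delta>" using norm_triangle_ineq2[of x w] by (simp add: dist_norm norm_minus_commute)
    then show "norm (h a x) \<le> M a" by (rule hM1)
    show "holomorphic_at (h a) x" unfolding h_def[abs_def]
      by (cases "mdeg a > R") (auto intro: holomorphic_at_mult holomorphic_at_mon)
  qed
  have \<eta>2: "norm (\<eta> w) \<le> (infsum M UNIV / \<delta>\<^sup>2) * (norm w)\<^sup>2" if w: "norm w < \<delta>" for w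
  proof -
    have 1: "((\<lambda>a. M a * (norm w / \<delta>)\<^sup>2) has_sum (infsum M UNIV * (norm w / \<delta>)\<^sup>2)) UNIV"
      by (intro has_sum_cmult_left has_sum_infsum M)
    have 2: "((\<lambda>a. h a w) has_sum \<eta> w) UNIV"
      unfolding \<eta>_def by (rule has_sum_infsum, rule summable_on_norm_bound[OF M]) (use hM1 w in auto)
    have "norm (\<eta> w) \<le> infsum M UNIV * (norm w / \<delta>)\<^sup>2"
      by (rule norm_infsum_le[OF 2 1]) (use hM w in simp)
    then show ?thesis by (simp add: power_divide)
  qed
  have "\<forall>\<^sub>F z in nhds 0. \<forall>k\<in>K. f z $ k = mon (A k) z"
    using K by (intro eventually_ball_finite) auto
  moreover have "\<forall>\<^sub>F z in nhds (0 :: complex^'n). norm z < r"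
    using r(1) by (rule eventually_norm_less)
  ultimately have \<eta>3: "\<forall>\<^sub>F z in nhds 0. G z - F z = \<eta> (f z)"
  proof eventually_elim
    case (elim z)
    have "norm (z $ i) < r" for i using elim(2) Finite_Cartesian_Product.norm_nth_le[of z i] by linarith
    then have z: "z \<in> polydisc r1" "z \<in> polydisc r2" using r unfolding polydisc_def by (force intro: less_le_trans)+
    have "((\<lambda>a. taylor_coeff G a * mon a z - taylor_coeff F a * mon a z) has_sum (G z - F z)) UNIV"
      by (rule has_sum_diff[OF 2(4)[OF z(2)] 1(4)[OF z(1)]])
    moreover have coeff: "taylor_coeff G a * mon a z - taylor_coeff F a * mon a z = h a (f z)" for a
    proof (cases "mdeg a > R")
      case True
      have "mon (\<beta> a) (f z) = (\<Prod>k\<in>UNIV. mon (A k) z ^ \<beta> a k)"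
        unfolding mon_def[of "\<beta> a"]
      proof (rule prod.cong[OF refl])
        fix k show "f z $ k ^ \<beta> a k = mon (A k) z ^ \<beta> a k"
          using elim(1) \<beta>(1)[OF True, of k] by (cases "k \<in> K") auto
      qed
      also have "\<dots> = (\<Prod>k\<in>UNIV. \<Prod>t\<in>UNIV. z $ t ^ (\<beta> a k * A k t))"
        unfolding mon_def by (simp add: prod_power_distrib power_mult[symmetric] mult.commute)
      also have "\<dots> = (\<Prod>t\<in>UNIV. \<Prod>k\<in>UNIV. z $ t ^ (\<beta> a k * A k t))" by (rule prod.swap)
      also have "\<dots> = mon a z"
        unfolding mon_def using \<beta>(2)[OF True] by (simp add: power_sum)
      finally show ?thesis using True by (simp add: h_def d_def algebra_simps)
    next
      case False
      then show ?thesis using jets[of a] by (simp add: h_def)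
    qed
    ultimately have "((\<lambda>a. h a (f z)) has_sum (G z - F z)) UNIV" by (simp only: coeff)
    then show ?case unfolding \<eta>_def by (rule infsumI[symmetric])
  qed
  have \<delta>_near: "\<forall>\<^sub>F w in nhds (0 :: complex^'p). norm w < \<delta>"
    using \<delta> by (rule eventually_norm_less)
  have "\<forall>\<^sub>F w in nhds 0. holomorphic_at \<eta> w"
    by (rule eventually_mono[OF \<delta>_near]) (rule \<eta>1)
  moreover have "\<forall>\<^sub>F w in nhds 0. norm (\<eta> w) \<le> (infsum M UNIV / \<delta>\<^sup>2) * (norm w)\<^sup>2"
    by (rule eventually_mono[OF \<delta>_near]) (rule \<eta>2)
  ultimately show ?thesis using \<eta>3 by blast
qed

lemma germ_exponents_representation:
  fixes f :: "complex^'n \<Rightarrow> complex^'p"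
  shows "\<exists>K A. germ_exponents f = A ` K \<and> (\<forall>k\<in>K. \<forall>\<^sub>F z in nhds 0. f z $ k = mon (A k) z)"
proof -
  define K where "K = {k. \<exists>a. \<forall>\<^sub>F z in nhds 0. f z $ k = mon a z}"
  define A where "A k = (SOME a. \<forall>\<^sub>F z in nhds 0. f z $ k = mon a z)" for k
  have A: "\<forall>\<^sub>F z in nhds 0. f z $ k = mon (A k) z" if "k \<in> K" for k
    using that unfolding K_def A_def mem_Collect_eq by (rule someI_ex)
  have AK: "germ_exponents f = A ` K"
  proof (intro equalityI subsetI)
    fix a assume "a \<in> germ_exponents f"
    then obtain k where k: "\<forall>\<^sub>F z in nhds 0. f z $ k = mon a z" unfolding germ_exponents_def by blast
    then have "k \<in> K" unfolding K_def by blast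
    from eventually_elim2[OF k A[OF this], of "\<lambda>z. mon a z = mon (A k) z"] have "a = A k"
      by (intro mon_inj) auto
    then show "a \<in> A ` K" using \<open>k \<in> K\<close> by blast
  qed (auto simp: germ_exponents_def intro: A)
  show ?thesis using AK A by (intro exI[of _ K] exI[of _ A]) simp
qed

lemma map_germ_holomorphic_at: "map_germ f \<Longrightarrow> \<forall>\<^sub>F z in nhds 0. holomorphic_at (\<lambda>z. f z $ k) z"
  unfolding map_germ_def complex_differentiable_at_iff by (auto elim: eventually_mono)

lemma map_germ_isCont: "map_germ f \<Longrightarrow> isCont f 0"
  unfolding map_germ_def using complex_differentiable_at_continuous eventually_nhds_x_imp_x by blast

lemma map_germ_filterlim: "map_germ f \<Longrightarrow> filterlim f (nhds 0) (nhds 0)"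
  using map_germ_isCont[of f] unfolding isCont_def tendsto_at_iff_tendsto_nhds map_germ_def by simp

lemma map_germ_id: "map_germ (\<lambda>z. z)"
  unfolding map_germ_def complex_differentiable_at_iff by simp

lemma inverse_germs_id: "inverse_germs (\<lambda>z. z) (\<lambda>z. z)"
  unfolding inverse_germs_def using map_germ_id by simp

lemma axis_conditions_imp_A_finite:
  fixes f :: "complex^'n \<Rightarrow> complex^'p"
  assumes f: "map_germ f" and E: "axis_conditions (germ_exponents f)"
  shows "A_finite f"
proof -
  obtain K A where AK: "germ_exponents f = A ` K"
    and A: "\<And>k. k \<in> K \<Longrightarrow> \<forall>\<^sub>F z in nhds 0. f z $ k = mon (A k) z"
    using germ_exponents_representation[of f] by metis
  obtain R0 where R0: "\<And>a. mdeg a \<ge> R0 \<Longrightarrow> a \<in> sums_of (A ` K)"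
    using axis_conditions_conductor[OF E] unfolding AK by blast
  define D where "D = Max (range (\<lambda>k. mdeg (A k)))"
  have D: "mdeg (A k) \<le> D" for k unfolding D_def by (rule Max_ge) auto
  \<comment> \<open>\<open>R0\<close> makes all monomials of higher degree products of components; 2
    * \<open>D\<close> makes at least two factors necessary.\<close>
  define R where "R = max R0 (2 * D)"
  show ?thesis unfolding A_finite_def
  proof (intro exI allI impI)
    fix g :: "complex^'n \<Rightarrow> complex^'p" assume g: "map_germ g \<and> same_jet R f g"
    define Q where "Q k \<eta> C \<longleftrightarrow> (\<forall>\<^sub>F w in nhds 0. holomorphic_at \<eta> w) \<and> (\<forall>\<^sub>F w in nhds 0. norm (\<eta> w) \<le> C * (norm w)\<^sup>2) \<and>
      (\<forall>\<^sub>F z in nhds 0. g z $ k - f z $ k = \<eta> (f z))" for k and \<eta> :: "complex^'p \<Rightarrow> complex" and C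
    have "\<exists>\<eta> C. Q k \<eta> C" for k
      unfolding Q_def
    proof (rule factor_through_monomials[where F = "\<lambda>z. f z $ k" and G = "\<lambda>z. g z $ k" and f = f, OF A _ D])
      show "a \<in> sums_of (A ` K)" if "mdeg a > R" for a using that by (intro R0) (simp add: R_def)
      show "2 * D \<le> R" by (simp add: R_def)
      show "\<forall>\<^sub>F z in nhds 0. holomorphic_at (\<lambda>z. f z $ k) z" by (rule map_germ_holomorphic_at[OF f])
      show "\<forall>\<^sub>F z in nhds 0. holomorphic_at (\<lambda>z. g z $ k) z" using g map_germ_holomorphic_at by blast
      show "taylor_coeff (\<lambda>z. f z $ k) a = taylor_coeff (\<lambda>z. g z $ k) a" if "mdeg a \<le> R" for a
        using g that unfolding same_jet_def taylor_coeff_def by (simp add: length_jet_list_index_list)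
    qed
    then obtain \<eta> where "\<And>k. \<exists>C. Q k (\<eta> k) C" by metis
    then obtain C where Q: "\<And>k. Q k (\<eta> k) (C k)" by metis
    have \<eta>: "\<And>k. \<forall>\<^sub>F w in nhds 0. holomorphic_at (\<eta> k) w"
      "\<And>k. \<forall>\<^sub>F w in nhds 0. norm (\<eta> k w) \<le> C k * (norm w)\<^sup>2"
      "\<And>k. \<forall>\<^sub>F z in nhds 0. g z $ k - f z $ k = \<eta> k (f z)"
      using Q unfolding Q_def by blast+
    define H where "H w = (\<chi> k. \<eta> k w)" for w
    have "\<forall>\<^sub>F w in nhds 0. complex_differentiable_at H w"
      unfolding complex_differentiable_at_iff H_def using \<eta>(1) by (simp add: eventually_all_finite)
    moreover have "\<forall>\<^sub>F w in nhds 0. norm (H w) \<le> (\<Sum>k\<in>UNIV. C k) * (norm w)\<^sup>2"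
    proof -
      have "\<forall>\<^sub>F w in nhds 0. \<forall>k. norm (\<eta> k w) \<le> C k * (norm w)\<^sup>2"
        using \<eta>(2) by (rule eventually_all_finite)
      then show ?thesis
      proof eventually_elim
        case (elim w)
        have "norm (H w) \<le> (\<Sum>k\<in>UNIV. norm (H w $ k))" by (rule norm_le_sum_norm_nth)
        also have "\<dots> \<le> (\<Sum>k\<in>UNIV. C k * (norm w)\<^sup>2)" using elim by (intro sum_mono) (simp add: H_def)
        finally show ?case by (simp add: sum_distrib_right)
      qed
    qed
    ultimately obtain \<psi>' where \<psi>: "inverse_germs (\<lambda>w. w + H w) \<psi>'"
      using inverse_germ_near_identity by blast
    then have \<psi>': "inverse_germs \<psi>' (\<lambda>w. w + H w)" unfolding inverse_germs_def by blast
    have "\<forall>\<^sub>F w in nhds 0. \<psi>' (w + H w) = w" using \<psi> unfolding inverse_germs_def by blast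
    then have "\<forall>\<^sub>F z in nhds 0. \<psi>' (f z + H (f z)) = f z"
      using map_germ_filterlim[OF f] unfolding filterlim_iff by blast
    moreover have "\<forall>\<^sub>F z in nhds 0. \<forall>k. g z $ k - f z $ k = \<eta> k (f z)"
      using \<eta>(3) by (rule eventually_all_finite)
    ultimately have "\<forall>\<^sub>F z in nhds 0. f z = \<psi>' (g z)"
    proof eventually_elim
      case (elim z)
      have "g z $ k = f z $ k + \<eta> k (f z)" for k using elim(2)[rule_format, of k] by (simp add: algebra_simps)
      then have "g z = f z + H (f z)" by (simp add: vec_eq_iff H_def)
      then show ?case using elim(1) by simp
    qed
    then show "A_equivalent g f" unfolding A_equivalent_def
      using inverse_germs_id \<psi>' by blast
  qed
qed

subsection \<open>Non-immersive points and double points\<close>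

definition nonimmersive_near_0 :: "(complex^'n \<Rightarrow> complex^'p) \<Rightarrow> bool" where
  "nonimmersive_near_0 f \<longleftrightarrow>
     (\<forall>e>0. \<exists>z D u. z \<noteq> 0 \<and> norm z < e \<and> (f has_derivative D) (at z) \<and> u \<noteq> 0 \<and> D u = 0)"

text \<open>A connected set with two points replaces a parametrized curve: this is preserved by
  homeomorphisms, and it suffices for meeting a hyperplane with a rational coordinate.\<close>

definition double_curves_near_0 :: "(complex^'n \<Rightarrow> complex^'p) \<Rightarrow> bool" where
  "double_curves_near_0 f \<longleftrightarrow>
     (\<forall>e>0. \<exists>C \<subseteq> ball 0 e \<times> ball 0 e. connected C \<and> (\<exists>x\<in>C. \<exists>y\<in>C. x \<noteq> y) \<and>
        (\<forall>x\<in>C. fst x \<noteq> snd x \<and> f (fst x) = f (snd x)))"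

definition degenerate :: "(complex^'n \<Rightarrow> complex^'p) \<Rightarrow> bool" where
  "degenerate f \<longleftrightarrow> nonimmersive_near_0 f \<or> double_curves_near_0 f"

lemma A_equivalent_sym:
  assumes f: "map_germ f" and "A_equivalent f g"
  shows "A_equivalent g f"
proof -
  obtain \<rho> \<rho>' \<psi> \<psi>' where \<rho>: "inverse_germs \<rho> \<rho>'" and \<psi>: "inverse_germs \<psi> \<psi>'"
    and g: "\<forall>\<^sub>F z in nhds 0. g z = \<psi> (f (\<rho>' z))"
    using assms(2) unfolding A_equivalent_def by blast
  have "\<forall>\<^sub>F z in nhds 0. \<psi>' (\<psi> (f z)) = f z"
    using map_germ_filterlim[OF f] \<psi> unfolding filterlim_iff inverse_germs_def by blast
  moreover have "\<forall>\<^sub>F z in nhds 0. \<rho>' (\<rho> z) = z" using \<rho> unfolding inverse_germs_def by blast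
  moreover have "\<forall>\<^sub>F z in nhds 0. g (\<rho> z) = \<psi> (f (\<rho>' (\<rho> z)))"
    using map_germ_filterlim[of \<rho>] \<rho> g unfolding filterlim_iff inverse_germs_def by blast
  ultimately have "\<forall>\<^sub>F z in nhds 0. f z = \<psi>' (g (\<rho> z))" by eventually_elim simp
  moreover have "inverse_germs \<rho>' \<rho>" "inverse_germs \<psi>' \<psi>"
    using \<rho> \<psi> unfolding inverse_germs_def by blast+
  ultimately show ?thesis unfolding A_equivalent_def by blast
qed

text \<open>A non-immersive point z with kernel vector u is moved to \<rho> z with kernel vector
  d\<rho> u, and a connected set of double points to its image under \<rho> in both entries.
  Injectivity of \<rho> near 0 keeps points off the origin, pairs off the diagonal, and the set
  nontrivial.\<close>

lemma degenerate_A_equivalent: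
  assumes f: "map_germ f" and eq: "A_equivalent f g" and deg: "degenerate f"
  shows "degenerate g"
proof -
  obtain \<rho> \<rho>' \<psi> \<psi>' where \<rho>: "inverse_germs \<rho> \<rho>'" and \<psi>: "inverse_germs \<psi> \<psi>'"
    and g: "\<forall>\<^sub>F z in nhds 0. g z = \<psi> (f (\<rho>' z))"
    using eq unfolding A_equivalent_def by blast
  have mg: "map_germ \<rho>" "map_germ \<rho>'" "map_germ \<psi>"
    using \<rho> \<psi> unfolding inverse_germs_def by blast+
  have \<rho>lim: "filterlim \<rho> (nhds 0) (nhds 0)" by (rule map_germ_filterlim[OF mg(1)])
  have 1: "\<forall>\<^sub>F z in nhds 0. complex_differentiable_at \<rho> z"
    using mg unfolding map_germ_def by blast
  have 2: "\<forall>\<^sub>F z in nhds 0. complex_differentiable_at \<rho>' (\<rho> z)"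
    using mg(2) \<rho>lim unfolding map_germ_def filterlim_iff by blast
  have 3: "\<forall>\<^sub>F z in nhds 0. complex_differentiable_at \<psi> (f z)"
    using mg(3) map_germ_filterlim[OF f] unfolding map_germ_def filterlim_iff by blast
  \<comment> \<open>The chain rule at a point z other than 0 needs the identities of germs on a
    whole neighbourhood of z, hence the nested \<open>eventually\<close>.\<close>
  have 4: "\<forall>\<^sub>F z in nhds 0. \<forall>\<^sub>F y in nhds z. \<rho>' (\<rho> y) = y"
    using \<rho> unfolding inverse_germs_def eventually_eventually by blast
  have "\<forall>\<^sub>F x in nhds 0. \<forall>\<^sub>F y in nhds x. g y = \<psi> (f (\<rho>' y))"
    using g unfolding eventually_eventually .
  then have 5: "\<forall>\<^sub>F z in nhds 0. \<forall>\<^sub>F y in nhds (\<rho> z). g y = \<psi> (f (\<rho>' y))"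
    using \<rho>lim unfolding filterlim_iff by blast
  define good where "good e z \<longleftrightarrow> norm (\<rho> z) < e \<and> complex_differentiable_at \<rho> z \<and>
      complex_differentiable_at \<rho>' (\<rho> z) \<and> complex_differentiable_at \<psi> (f z) \<and>
      (\<forall>\<^sub>F y in nhds z. \<rho>' (\<rho> y) = y) \<and> (\<forall>\<^sub>F y in nhds (\<rho> z). g y = \<psi> (f (\<rho>' y)))" for e z
  have small: "\<exists>\<delta>>0. \<forall>z. norm z < \<delta> \<longrightarrow> good e z"
    if e: "e > 0" for e
  proof -
    have "\<forall>\<^sub>F y in nhds (0 :: complex^'a). norm y < e"
      using e by (rule eventually_norm_less)
    then have "\<forall>\<^sub>F z in nhds 0. norm (\<rho> z) < e" using \<rho>lim unfolding filterlim_iff by blast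
    with 1 2 3 4 5 have "\<forall>\<^sub>F z in nhds 0. good e z"
      by eventually_elim (simp add: good_def)
    then show ?thesis unfolding eventually_nhds_metric by (simp add: dist_norm)
  qed
  have \<rho>'0: "\<rho>' 0 = 0" using mg unfolding map_germ_def by blast
  from deg show ?thesis unfolding degenerate_def
  proof (elim disjE)
    assume bad: "nonimmersive_near_0 f"
    have "nonimmersive_near_0 g" unfolding nonimmersive_near_0_def
    proof (intro allI impI)
      fix e :: real assume "e > 0"
      then obtain \<delta> where \<delta>: "\<delta> > 0" "\<And>z. norm z < \<delta> \<Longrightarrow> good e z"
        using small[OF \<open>e > 0\<close>] by blast
      obtain z D u where z: "z \<noteq> 0" "norm z < \<delta>" "(f has_derivative D) (at z)" "u \<noteq> 0" "D u = 0"
        using bad \<delta>(1) unfolding nonimmersive_near_0_def by blast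
      note P = \<delta>(2)[OF z(2), unfolded good_def]
      have \<rho>_inv: "\<rho>' (\<rho> z) = z" using P eventually_nhds_x_imp_x by blast
      obtain R where R: "(\<rho> has_derivative R) (at z)" using P unfolding complex_differentiable_at_def by blast
      obtain R' where R': "(\<rho>' has_derivative R') (at (\<rho> z))" using P unfolding complex_differentiable_at_def by blast
      obtain S where S: "(\<psi> has_derivative S) (at (f z))" using P unfolding complex_differentiable_at_def by blast
      have "((\<lambda>y. \<rho>' (\<rho> y)) has_derivative (\<lambda>v. R' (R v))) (at z)"
        by (rule has_derivative_compose[OF R R'])
      then have "((\<lambda>y. y) has_derivative (\<lambda>v. R' (R v))) (at z)"
        by (rule has_derivative_cong_nhds) (use P in blast)
      then have "(\<lambda>v. R' (R v)) = (\<lambda>v. v)" using has_derivative_unique has_derivative_ident by blast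
      then have RR: "R' (R u) = u" by metis
      have "((\<lambda>y. f (\<rho>' y)) has_derivative (\<lambda>v. D (R' v))) (at (\<rho> z))"
        by (rule has_derivative_compose[OF R']) (simp add: \<rho>_inv z(3))
      then have "((\<lambda>y. \<psi> (f (\<rho>' y))) has_derivative (\<lambda>v. S (D (R' v)))) (at (\<rho> z))"
        by (rule has_derivative_compose) (simp add: \<rho>_inv S)
      then have "(g has_derivative (\<lambda>v. S (D (R' v)))) (at (\<rho> z))"
        by (rule has_derivative_cong_nhds) (use P in \<open>auto elim: eventually_mono\<close>)
      moreover have "\<rho> z \<noteq> 0" using \<rho>_inv z(1) \<rho>'0 by metis
      moreover have "R u \<noteq> 0" using RR z(4) linear_0[OF has_derivative_linear[OF R']] by metis
      moreover have "S (D (R' (R u))) = 0"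
        using RR z(5) linear_0[OF has_derivative_linear[OF S]] by simp
      ultimately show "\<exists>z D u. z \<noteq> 0 \<and> norm z < e \<and> (g has_derivative D) (at z) \<and> u \<noteq> 0 \<and> D u = 0"
        using P by (intro exI[of _ "\<rho> z"] exI[of _ "\<lambda>v. S (D (R' v))"] exI[of _ "R u"]) simp
    qed
    then show "nonimmersive_near_0 g \<or> double_curves_near_0 g" ..
  next
    assume bad: "double_curves_near_0 f"
    have "double_curves_near_0 g" unfolding double_curves_near_0_def
    proof (intro allI impI)
      fix e :: real assume "e > 0"
      then obtain \<delta> where \<delta>: "\<delta> > 0" "\<And>z. norm z < \<delta> \<Longrightarrow> good e z"
        using small[OF \<open>e > 0\<close>] by blast
      have \<rho>_inv: "\<rho>' (\<rho> z) = z" if "norm z < \<delta>" for z using \<delta>(2)[OF that] eventually_nhds_x_imp_x unfolding good_def by blast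
      have g\<rho>: "g (\<rho> z) = \<psi> (f z)" if z: "norm z < \<delta>" for z
      proof -
        have "\<forall>\<^sub>F y in nhds (\<rho> z). g y = \<psi> (f (\<rho>' y))" using \<delta>(2)[OF z] unfolding good_def by blast
        from eventually_nhds_x_imp_x[OF this] show ?thesis using \<rho>_inv[OF z] by simp
      qed
      obtain C where C: "C \<subseteq> ball 0 \<delta> \<times> ball 0 \<delta>" "connected C" "\<exists>x\<in>C. \<exists>y\<in>C. x \<noteq> y"
        "\<forall>x\<in>C. fst x \<noteq> snd x \<and> f (fst x) = f (snd x)"
        using bad[unfolded double_curves_near_0_def, rule_format, OF \<delta>(1)]
        by (elim exE conjE) (rule that)
      have nC: "norm (fst x) < \<delta>" "norm (snd x) < \<delta>" if "x \<in> C" for x using C(1) that by auto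
      have \<rho>_small: "norm (\<rho> z) < e" if "norm z < \<delta>" for z using \<delta>(2)[OF that] unfolding good_def by blast
      let ?h = "\<lambda>x. (\<rho> (fst x), \<rho> (snd x))"
      have "isCont \<rho> z" if "norm z < \<delta>" for z
        using \<delta>(2)[OF that] complex_differentiable_at_continuous unfolding good_def by blast
      then have cont_\<rho>: "continuous_on (ball 0 \<delta>) \<rho>"
        by (simp add: continuous_at_imp_continuous_on)
      have "continuous_on C (\<lambda>x. \<rho> (fst x))"
        by (rule continuous_on_compose2[OF cont_\<rho> continuous_on_fst[OF continuous_on_id]]) (use nC in auto)
      moreover have "continuous_on C (\<lambda>x. \<rho> (snd x))"
        by (rule continuous_on_compose2[OF cont_\<rho> continuous_on_snd[OF continuous_on_id]]) (use nC in auto)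
      ultimately have cont: "continuous_on C ?h" by (rule continuous_on_Pair)
      have inj: "?h x \<noteq> ?h y" if "x \<in> C" "y \<in> C" "x \<noteq> y" for x y
      proof
        assume "?h x = ?h y"
        then have "\<rho>' (\<rho> (fst x)) = \<rho>' (\<rho> (fst y))" "\<rho>' (\<rho> (snd x)) = \<rho>' (\<rho> (snd y))" by simp_all
        then show False using that \<rho>_inv nC by (simp add: prod_eq_iff)
      qed
      show "\<exists>C \<subseteq> ball 0 e \<times> ball 0 e. connected C \<and> (\<exists>x\<in>C. \<exists>y\<in>C. x \<noteq> y) \<and>
        (\<forall>x\<in>C. fst x \<noteq> snd x \<and> g (fst x) = g (snd x))"
      proof (intro exI[of _ "?h ` C"] conjI)
        show "?h ` C \<subseteq> ball 0 e \<times> ball 0 e" using nC \<rho>_small by auto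
        show "connected (?h ` C)" by (rule connected_continuous_image[OF cont C(2)])
        show "\<exists>x\<in>?h ` C. \<exists>y\<in>?h ` C. x \<noteq> y" using C(3) inj by blast
        show "\<forall>x\<in>?h ` C. fst x \<noteq> snd x \<and> g (fst x) = g (snd x)"
        proof
          fix x' assume "x' \<in> ?h ` C"
          then obtain x where x: "x \<in> C" "x' = ?h x" by blast
          have "\<rho> (fst x) \<noteq> \<rho> (snd x)"
            using bspec[OF C(4) x(1)] \<rho>_inv[OF nC(1)[OF x(1)]] \<rho>_inv[OF nC(2)[OF x(1)]] by metis
          moreover have "g (\<rho> (fst x)) = g (\<rho> (snd x))"
            using bspec[OF C(4) x(1)] g\<rho>[OF nC(1)[OF x(1)]] g\<rho>[OF nC(2)[OF x(1)]] by simp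
          ultimately show "fst x' \<noteq> snd x' \<and> g (fst x') = g (snd x')" using x(2) by simp
        qed
      qed
    qed
    then show "nonimmersive_near_0 g \<or> double_curves_near_0 g" ..
  qed
qed

section \<open>Derivatives of monomials\<close>

definition dmon :: "('n::finite \<Rightarrow> nat) \<Rightarrow> complex^'n \<Rightarrow> complex^'n \<Rightarrow> complex" where
  "dmon a z u = (\<Sum>i\<in>UNIV. of_nat (a i) * u $ i * z $ i ^ (a i - 1) * (\<Prod>j\<in>UNIV - {i}. z $ j ^ a j))"

text \<open>The truncated a i - 1 in \<open>dmon\<close> is harmless: for a i = 0 the factor a i
  already kills the term.\<close>

lemma has_derivative_mon: "(mon a has_derivative dmon a z) (at z)"
proof -
  have "((\<lambda>z. z $ i ^ a i) has_derivative (\<lambda>u. of_nat (a i) * u $ i * z $ i ^ (a i - 1))) (at z)" for i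
    by (rule has_derivative_power[OF bounded_linear_imp_has_derivative[OF bounded_linear_vec_nth]])
  then show ?thesis
    unfolding mon_def[abs_def] dmon_def[abs_def] by (rule has_derivative_prod)
qed

lemma dmon_axis: "dmon a z (axis j 1) = of_nat (a j) * z $ j ^ (a j - 1) * (\<Prod>m\<in>UNIV - {j}. z $ m ^ a m)"
proof -
  have "dmon a z (axis j 1) =
      (\<Sum>i\<in>UNIV. if i = j then of_nat (a j) * z $ j ^ (a j - 1) * (\<Prod>m\<in>UNIV - {j}. z $ m ^ a m) else 0)"
    unfolding dmon_def by (intro sum.cong) (auto simp: axis_def)
  then show ?thesis by simp
qed

lemma mon_single: "mon (single i e) z = z $ i ^ e"
proof -
  have "mon (single i e) z = (\<Prod>j\<in>UNIV. if j = i then z $ i ^ e else 1)"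
    unfolding mon_def single_def by (intro prod.cong) auto
  then show ?thesis by simp
qed

lemma dmon_single: "dmon (single i e) z u = of_nat e * u $ i * z $ i ^ (e - 1)"
proof -
  have "dmon (single i e) z u = (\<Sum>j\<in>UNIV. if j = i then of_nat e * u $ i * z $ i ^ (e - 1) else 0)"
    unfolding dmon_def by (intro sum.cong) (auto simp: single_def)
  then show ?thesis by simp
qed

lemma mon_pair: "i \<noteq> j \<Longrightarrow> mon (pair i l j) z = z $ i ^ l * z $ j"
proof -
  assume ij: "i \<noteq> j"
  have "mon (pair i l j) z = (\<Prod>m\<in>UNIV. (if m = i then z $ i ^ l else 1) * (if m = j then z $ j else 1))"
    unfolding mon_def pair_def using ij by (intro prod.cong) auto
  then show ?thesis by (simp add: prod.distrib)
qed

lemma dmon_pair: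
  fixes u :: "complex^'n"
  assumes "i \<noteq> j" "u $ i = 0"
  shows "dmon (pair i l j) z u = z $ i ^ l * u $ j"
proof -
  have "(\<Prod>m\<in>UNIV - {j}. z $ m ^ pair i l j m) = (\<Prod>m\<in>UNIV - {j}. if m = i then z $ i ^ l else 1)"
    by (intro prod.cong) (auto simp: pair_def)
  also have "\<dots> = z $ i ^ l" using assms(1) by simp
  finally have p: "(\<Prod>m\<in>UNIV - {j}. z $ m ^ pair i l j m) = z $ i ^ l" .
  have "dmon (pair i l j) z u = (\<Sum>m\<in>UNIV. if m = j then z $ i ^ l * u $ j else 0)"
    unfolding dmon_def using assms p by (intro sum.cong) (auto simp: pair_def)
  then show ?thesis by simp
qed

text \<open>For y \<noteq> 0 the exponents e with (x / y) ^ e = 1 form a numerical semigroup with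
  Gcd 1, so two consecutive ones occur and x / y = 1. For y = 0 a positive exponent in
  \<open>S\<close> forces x = 0.\<close>

lemma eq_if_powers_eq:
  fixes x y :: complex
  assumes "\<And>e. e \<in> S \<Longrightarrow> x ^ e = y ^ e" and gcd: "Gcd S = 1"
  shows "x = y"
proof (cases "y = 0")
  case True
  have "\<exists>e\<in>S. e \<noteq> 0" using gcd Gcd_0_iff[of S] by auto
  then obtain e where "e \<in> S" "e \<noteq> 0" by blast
  with assms(1)[of e] True show ?thesis by (simp add: zero_power)
next
  case False
  define T where "T = {e. (x / y) ^ e = 1}"
  have "S \<subseteq> T" using assms(1) False by (auto simp: T_def power_divide)
  then have "Gcd T dvd Gcd S" by (intro Gcd_greatest) (auto intro: Gcd_dvd)
  then have "\<exists>c. \<forall>e\<ge>c. e \<in> T"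
    using gcd by (intro numerical_semigroup_conductor) (auto simp: T_def power_add)
  then obtain c where c: "\<And>e. c \<le> e \<Longrightarrow> (x / y) ^ e = 1" unfolding T_def by blast
  from c[of c] c[of "Suc c"] have "x / y = 1" by simp
  then show ?thesis using False by simp
qed

text \<open>If z_i \<noteq> 0 and u is in the kernel of the derivative, a power of z_i forces u_i =
  0, and then z_i^l z_j forces u_j = 0 for every other j. Coprime powers of each coordinate make the
  germ injective near 0, so it has no double points there.\<close>

lemma axis_conditions_not_degenerate:
  fixes g :: "complex^'n \<Rightarrow> complex^'p"
  assumes E: "axis_conditions (germ_exponents g)"
  shows "\<not> degenerate g"
proof -
  obtain K A where AK: "germ_exponents g = A ` K"
    and A: "\<forall>k\<in>K. \<forall>\<^sub>F z in nhds 0. g z $ k = mon (A k) z"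
    using germ_exponents_representation[of g] by metis
  have "\<forall>\<^sub>F z in nhds 0. \<forall>k\<in>K. g z $ k = mon (A k) z"
    using A by (intro eventually_ball_finite) auto
  then obtain e where e: "e > 0" "\<And>z k. norm z < e \<Longrightarrow> k \<in> K \<Longrightarrow> g z $ k = mon (A k) z"
    unfolding eventually_nhds_metric by (auto simp: dist_norm)
  have G: "Gcd {e. single j e \<in> A ` K} = 1" for j
    using E unfolding axis_conditions_def AK by blast
  have P: "\<exists>l. pair i l j \<in> A ` K" if "i \<noteq> j" for i j
    using E that unfolding axis_conditions_def AK by blast
  have "\<not> nonimmersive_near_0 g"
  proof
    assume "nonimmersive_near_0 g"
    then obtain z D u where z: "z \<noteq> 0" "norm z < e" "(g has_derivative D) (at z)" "u \<noteq> 0" "D u = 0"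
      using e(1) unfolding nonimmersive_near_0_def by blast
    have d0: "dmon a z u = 0" if a: "a \<in> A ` K" for a
    proof -
      obtain k where k: "k \<in> K" "a = A k" using a by blast
      have "((\<lambda>z. g z $ k) has_derivative (\<lambda>v. D v $ k)) (at z)"
        by (rule bounded_linear.has_derivative[OF bounded_linear_vec_nth z(3)])
      moreover have "\<forall>\<^sub>F y in nhds z. g y $ k = mon a y"
      proof -
        have "\<forall>\<^sub>F y in nhds z. y \<in> ball 0 e" using z(2) by (intro eventually_nhds_in_open) auto
        then show ?thesis by eventually_elim (use e(2)[OF _ k(1)] k(2) in simp)
      qed
      ultimately have "(mon a has_derivative (\<lambda>v. D v $ k)) (at z)" by (rule has_derivative_cong_nhds)
      from fun_cong[OF has_derivative_unique[OF this has_derivative_mon], of u] z(5)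
      show ?thesis by simp
    qed
    obtain i where i: "z $ i \<noteq> 0" using z(1) by (auto simp: vec_eq_iff)
    have "\<exists>e\<in>{e. single i e \<in> A ` K}. e \<noteq> 0" using G[of i] Gcd_0_iff[of "{e. single i e \<in> A ` K}"] by auto
    then obtain m where m: "single i m \<in> A ` K" "m \<noteq> 0" by blast
    have ui: "u $ i = 0" using d0[OF m(1)] m(2) i unfolding dmon_single by simp
    have "u $ j = 0" for j
    proof (cases "j = i")
      case False
      obtain l where l: "pair i l j \<in> A ` K" using P[of i j] False by blast
      show ?thesis using d0[OF l] i unfolding dmon_pair[OF False[symmetric] ui] by simp
    qed (use ui in simp)
    then show False using z(4) by (simp add: vec_eq_iff)
  qed
  moreover have "\<not> double_curves_near_0 g"
  proof
    assume "double_curves_near_0 g"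
    from this[unfolded double_curves_near_0_def, rule_format, OF e(1)]
    obtain C where C: "C \<subseteq> ball 0 e \<times> ball 0 e" "connected C" "\<exists>x\<in>C. \<exists>y\<in>C. x \<noteq> y"
        "\<forall>x\<in>C. fst x \<noteq> snd x \<and> g (fst x) = g (snd x)"
      by (elim exE conjE) (rule that)
    then obtain x where x: "x \<in> C" by blast
    define z w where "z = fst x" and "w = snd x"
    have zw: "z \<noteq> w" "g z = g w" using bspec[OF C(4) x] by (simp_all add: z_def w_def)
    have n: "norm z < e" "norm w < e" using C(1) x by (auto simp: z_def w_def)
    have "z $ j = w $ j" for j
    proof (rule eq_if_powers_eq[OF _ G[of j]])
      fix m assume "m \<in> {e. single j e \<in> A ` K}"
      then obtain k where k: "k \<in> K" "single j m = A k" by blast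
      then show "z $ j ^ m = w $ j ^ m"
        using e(2)[OF n(1) k(1)] e(2)[OF n(2) k(1)] zw(2) by (simp add: k(2)[symmetric] mon_single)
    qed
    then show False using zw(1) by (simp add: vec_eq_iff)
  qed
  ultimately show ?thesis unfolding degenerate_def by blast
qed

text \<open>Gathers the finitely many components on one common ball, with the zero components as
  those outside \<open>K\<close>. The constant monomial is excluded because a germ sends 0 to
  0.\<close>

lemma monomial_germ_representation:
  fixes f :: "complex^'n \<Rightarrow> complex^'p"
  assumes "map_germ f" "monomial_germ f"
  shows "\<exists>K A. \<exists>e>0. germ_exponents f = A ` K \<and> (\<forall>k\<in>K. A k \<noteq> (\<lambda>_. 0)) \<and>
    (\<forall>z k. norm z < e \<longrightarrow> f z $ k = (if k \<in> K then mon (A k) z else 0))"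
proof -
  have "\<forall>k. \<exists>c. monomial_or_zero c \<and> (\<forall>\<^sub>F z in nhds 0. f z $ k = c z)"
    using assms(2) unfolding monomial_germ_def by blast
  then obtain c where c: "\<And>k. monomial_or_zero (c k)" "\<And>k. \<forall>\<^sub>F z in nhds 0. f z $ k = c k z" by metis
  define K where "K = {k. c k \<noteq> (\<lambda>z. 0)}"
  have "\<exists>a. k \<in> K \<longrightarrow> c k = mon a" for k
    using c(1)[of k] unfolding K_def monomial_or_zero_def mon_def[abs_def] by auto
  then obtain A where A: "\<And>k. k \<in> K \<Longrightarrow> c k = mon (A k)" by metis
  have "\<forall>\<^sub>F z in nhds 0. \<forall>k. f z $ k = c k z" using c(2) by (rule eventually_all_finite)
  then obtain e where e: "e > 0" "\<And>z k. norm z < e \<Longrightarrow> f z $ k = c k z"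
    unfolding eventually_nhds_metric by (auto simp: dist_norm)
  have nz: "A k \<noteq> (\<lambda>_. 0)" if "k \<in> K" for k
  proof
    assume "A k = (\<lambda>_. 0)"
    then have "f 0 $ k = 1" using e(2)[of 0 k] e(1) A[OF that] by (simp add: mon_def)
    then show False using assms(1) by (simp add: map_germ_def)
  qed
  have "germ_exponents f = A ` K"
  proof (intro equalityI subsetI)
    fix a assume "a \<in> germ_exponents f"
    then obtain k where k: "\<forall>\<^sub>F z in nhds 0. f z $ k = mon a z" unfolding germ_exponents_def by blast
    with c(2)[of k] have ev: "\<forall>\<^sub>F z in nhds 0. c k z = mon a z" by eventually_elim simp
    have "k \<in> K"
    proof (rule ccontr)
      assume "k \<notin> K"
      then have "\<forall>\<^sub>F z in nhds 0. mon a z = 0" using ev by (simp add: K_def)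
      then obtain d where d: "d > 0" "\<And>z. norm z < d \<Longrightarrow> mon a z = 0"
        unfolding eventually_nhds_metric by (auto simp: dist_norm)
      let ?z = "\<chi> j::'n. complex_of_real (d / (2 * CARD('n)))"
      have "norm ?z \<le> (\<Sum>j\<in>UNIV. norm (?z $ j))" by (rule norm_le_sum_norm_nth)
      also have "\<dots> = real CARD('n) * (d / (2 * CARD('n)))"
        using d(1) by (simp only: vec_lambda_beta norm_of_real) simp
      also have "\<dots> < d" using d(1) by simp
      finally have "mon a ?z = 0" by (rule d(2))
      then show False using d(1) by (simp add: mon_def)
    qed
    moreover have "a = A k" using ev unfolding A[OF \<open>k \<in> K\<close>] by (intro mon_inj) (auto elim: eventually_mono)
    ultimately show "a \<in> A ` K" by blast
  next
    fix a assume "a \<in> A ` K"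
    then obtain k where "k \<in> K" "a = A k" by blast
    then have "\<forall>\<^sub>F z in nhds 0. f z $ k = mon a z" using c(2)[of k] A[of k] by simp
    then show "a \<in> germ_exponents f" unfolding germ_exponents_def by blast
  qed
  moreover have "f z $ k = (if k \<in> K then mon (A k) z else 0)" if "norm z < e" for z k
    using e(2)[OF that, of k] A[of k] by (auto simp: K_def)
  ultimately show ?thesis using e(1) nz by blast
qed

lemma mon_axis: "mon a (axis j t) = (if \<forall>i. i \<noteq> j \<longrightarrow> a i = 0 then t ^ a j else 0)"
proof -
  have "mon a (axis j t) = t ^ a j * (\<Prod>i\<in>UNIV - {j}. axis j t $ i ^ a i)"
    unfolding mon_def by (subst prod.remove[of _ j]) auto
  also have "(\<Prod>i\<in>UNIV - {j}. axis j t $ i ^ a i) = (\<Prod>i\<in>UNIV - {j}. if a i = 0 then 1 else 0)"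
    by (intro prod.cong) (auto simp: axis_def)
  also have "\<dots> = (if \<forall>i. i \<noteq> j \<longrightarrow> a i = 0 then 1 else 0)"
    by (auto simp: prod_zero_iff intro!: prod.neutral)
  finally have eq: "mon a (axis j t) = t ^ a j * (if \<forall>i. i \<noteq> j \<longrightarrow> a i = 0 then 1 else 0)" .
  show ?thesis
  proof (cases "\<forall>i. i \<noteq> j \<longrightarrow> a i = 0")
    case True
    show ?thesis unfolding eq if_P[OF True] by simp
  next
    case False
    show ?thesis unfolding eq if_not_P[OF False] by simp
  qed
qed

lemma norm_axis_complex: "norm (axis j t :: complex^'n) = norm t"
proof -
  have "axis j t = t *s (axis j 1 :: complex^'n)" by (simp add: vec_eq_iff axis_def)
  then show ?thesis by (simp add: norm_smult_complex norm_axis_1)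
qed

text \<open>If no z_i^l z_j occurs, the derivative in direction j vanishes along the i-th axis. If
  no positive power of z_j occurs (Gcd 0), it vanishes along the j-th axis. If all powers of z_j
  have a common divisor d > 1, then on the j-th axis f does not distinguish t from \<zeta> t for a
  d-th root of unity \<zeta>, which gives a curve of double points.\<close>

lemma not_axis_conditions_imp_degenerate:
  fixes f :: "complex^'n \<Rightarrow> complex^'p"
  assumes f: "map_germ f" "monomial_germ f" and E: "\<not> axis_conditions (germ_exponents f)"
  shows "degenerate f"
proof -
  obtain K A e where e: "e > 0" and AK: "germ_exponents f = A ` K" and nz: "\<And>k. k \<in> K \<Longrightarrow> A k \<noteq> (\<lambda>_. 0)"
    and fz: "\<And>z k. norm z < e \<Longrightarrow> f z $ k = (if k \<in> K then mon (A k) z else 0)"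
    using monomial_germ_representation[OF f] by blast
  have der: "(f has_derivative (\<lambda>u. \<chi> k. if k \<in> K then dmon (A k) z u else 0)) (at z)" if z: "norm z < e" for z
  proof (rule has_derivative_cong_nhds)
    show "((\<lambda>z. \<chi> k. if k \<in> K then mon (A k) z else 0) has_derivative (\<lambda>u. \<chi> k. if k \<in> K then dmon (A k) z u else 0)) (at z)"
    proof (rule has_derivative_vec_lambda)
      fix k show "((\<lambda>z. if k \<in> K then mon (A k) z else 0) has_derivative (\<lambda>u. if k \<in> K then dmon (A k) z u else 0)) (at z)"
        using has_derivative_mon[of "A k" z] by (cases "k \<in> K") simp_all
    qed
    have "\<forall>\<^sub>F y in nhds z. y \<in> ball 0 e" using z by (intro eventually_nhds_in_open) auto
    then show "\<forall>\<^sub>F y in nhds z. (\<chi> k. if k \<in> K then mon (A k) y else 0) = f y"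
      by eventually_elim (simp add: vec_eq_iff fz)
  qed
  have nonimm: "nonimmersive_near_0 f" if vanish: "\<And>k t. k \<in> K \<Longrightarrow> dmon (A k) (axis i t) (axis j 1) = 0" for i j
    unfolding nonimmersive_near_0_def
  proof (intro allI impI)
    fix d :: real assume "d > 0"
    define t where "t = min e d / 2"
    have t: "0 < t" "t < e" "t < d" using e \<open>d > 0\<close> by (auto simp: t_def)
    let ?z = "axis i (complex_of_real t) :: complex^'n"
    have n: "norm ?z = t" using t unfolding norm_axis_complex by simp
    have "?z \<noteq> 0" using n t(1) by auto
    moreover have "axis j (1 :: complex) \<noteq> (0 :: complex^'n)" by simp
    moreover have "(\<chi> k. if k \<in> K then dmon (A k) ?z (axis j 1) else 0) = (0 :: complex^'p)"
      using vanish by (simp add: vec_eq_iff)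
    ultimately show "\<exists>z D u. z \<noteq> 0 \<and> norm z < d \<and> (f has_derivative D) (at z) \<and> u \<noteq> 0 \<and> D u = 0"
      using der[of ?z] n t by (intro exI[of _ ?z] exI[of _ "\<lambda>u. \<chi> k. if k \<in> K then dmon (A k) ?z u else 0"]
          exI[of _ "axis j 1"]) simp
  qed
  obtain j where "Gcd {e. single j e \<in> A ` K} \<noteq> 1 \<or> (\<exists>i. i \<noteq> j \<and> (\<forall>l. pair i l j \<notin> A ` K))"
    using E unfolding axis_conditions_def AK by blast
  then show ?thesis
  proof (elim disjE exE conjE)
    fix i assume i: "i \<noteq> j" "\<forall>l. pair i l j \<notin> A ` K"
    have "dmon (A k) (axis i t) (axis j 1) = 0" if k: "k \<in> K" for k t
    proof -
      have "A k j \<noteq> 1 \<or> (\<exists>m. m \<noteq> i \<and> m \<noteq> j \<and> A k m \<noteq> 0)"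
      proof (rule ccontr)
        assume "\<not> ?thesis"
        then have "A k = pair i (A k i) j" by (auto simp: pair_def fun_eq_iff)
        then show False using i(2) k by (metis image_eqI)
      qed
      then show ?thesis
      proof (elim disjE exE conjE)
        assume "A k j \<noteq> 1"
        then have "of_nat (A k j) * (axis i t $ j) ^ (A k j - 1) = (0 :: complex)"
          using i(1) by (cases "A k j = 0") (auto simp: axis_def)
        then show ?thesis unfolding dmon_axis by simp
      next
        fix m assume m: "m \<noteq> i" "m \<noteq> j" "A k m \<noteq> 0"
        then have "(axis i t $ m) ^ A k m = (0 :: complex)" by (simp add: axis_def)
        then have "(\<Prod>m\<in>UNIV - {j}. (axis i t $ m) ^ A k m) = (0 :: complex)"
          using m(2) by (intro prod_zero) auto
        then show ?thesis unfolding dmon_axis by simp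
      qed
    qed
    then show ?thesis using nonimm degenerate_def by blast
  next
    let ?G = "{e. single j e \<in> A ` K}"
    define d where "d = Gcd ?G"
    assume "Gcd ?G \<noteq> 1"
    then have d1: "d \<noteq> 1" by (simp add: d_def)
    have pure: "A k j \<in> ?G" if "k \<in> K" "\<forall>i. i \<noteq> j \<longrightarrow> A k i = 0" for k
    proof -
      have "single j (A k j) = A k" using that(2) by (auto simp: single_def fun_eq_iff)
      then show ?thesis using that(1) by simp
    qed
    show ?thesis
    proof (cases "d = 0")
      case True
      have "dmon (A k) (axis j t) (axis j 1) = 0" if k: "k \<in> K" for k t
      proof -
        have "\<exists>i. i \<noteq> j \<and> A k i \<noteq> 0"
        proof (rule ccontr)
          assume no: "\<not> ?thesis"
          then have "A k j \<in> ?G" using pure[OF k] by blast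
          then have "A k j = 0" using True unfolding d_def Gcd_0_iff by blast
          then have "A k = (\<lambda>_. 0)" using no by (metis ext)
          then show False using nz[OF k] by blast
        qed
        then obtain i where i: "i \<noteq> j" "A k i \<noteq> 0" by blast
        then have "(axis j t $ i) ^ A k i = (0 :: complex)" by (simp add: axis_def)
        then have "(\<Prod>m\<in>UNIV - {j}. (axis j t $ m) ^ A k m) = (0 :: complex)"
          using i by (intro prod_zero) auto
        then show ?thesis unfolding dmon_axis by simp
      qed
      then show ?thesis using nonimm degenerate_def by blast
    next
      case False
      define \<zeta> where "\<zeta> = exp (2 * of_real pi * \<i> / of_nat d)"
      have \<zeta>d: "\<zeta> ^ d = 1" using False complex_root_unity[of d 1] by (simp add: \<zeta>_def)
      have \<zeta>1: "\<zeta> \<noteq> 1" using False d1 complex_root_unity_eq_1[of d 1] by (simp add: \<zeta>_def)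
      have \<zeta>n: "norm \<zeta> = 1" using \<zeta>d False by (metis norm_one norm_power power_eq_1_iff norm_ge_zero)
      have feq: "f (axis j t) = f (axis j (\<zeta> * t))" if t: "norm t < e" for t
      proof -
        have "mon (A k) (axis j t) = mon (A k) (axis j (\<zeta> * t))" if k: "k \<in> K" for k
        proof (cases "\<forall>i. i \<noteq> j \<longrightarrow> A k i = 0")
          case True
          then have "d dvd A k j" unfolding d_def using pure[OF k] by (intro Gcd_dvd) blast
          then have "\<zeta> ^ A k j = 1" using \<zeta>d by (auto simp: power_mult elim!: dvdE)
          moreover have "mon (A k) (axis j s) = s ^ A k j" for s
            unfolding mon_axis by (rule if_P[OF True])
          ultimately show ?thesis by (simp add: power_mult_distrib)
        next
          case False
          have "mon (A k) (axis j s) = 0" for s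
            unfolding mon_axis by (rule if_not_P[OF False])
          then show ?thesis by simp
        qed
        moreover have "norm (axis j t :: complex^'n) < e" "norm (axis j (\<zeta> * t) :: complex^'n) < e"
          using t \<zeta>n by (simp_all add: norm_axis_complex norm_mult)
        ultimately show ?thesis using fz by (simp add: vec_eq_iff)
      qed
      have "double_curves_near_0 f" unfolding double_curves_near_0_def
      proof (intro allI impI)
        \<comment> \<open>From here on \<open>d\<close> is the radius and no longer the Gcd. The
          segment from t/2 to t stays away from 0, where the two points would coincide.\<close>
        fix d :: real assume "d > 0"
        define t where "t = min e d / 2"
        have t: "0 < t" "t < e" "t < d" using e \<open>d > 0\<close> by (auto simp: t_def)
        let ?h = "\<lambda>s. (axis j (complex_of_real s), axis j (\<zeta> * complex_of_real s)) :: (complex^'n) \<times> (complex^'n)"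
        show "\<exists>C \<subseteq> ball 0 d \<times> ball 0 d. connected C \<and> (\<exists>x\<in>C. \<exists>y\<in>C. x \<noteq> y) \<and>
            (\<forall>x\<in>C. fst x \<noteq> snd x \<and> f (fst x) = f (snd x))"
        proof (intro exI[of _ "?h ` {t/2..t}"] conjI)
          show "?h ` {t/2..t} \<subseteq> ball 0 d \<times> ball 0 d"
            using t \<zeta>n by (auto simp: norm_axis_complex norm_mult)
          have "continuous_on {t/2..t} ?h"
            by (intro continuous_on_Pair bounded_linear.continuous_on[OF bounded_linear_axis] continuous_intros)
          then show "connected (?h ` {t/2..t})" by (rule connected_continuous_image) simp
          show "\<exists>x\<in>?h ` {t/2..t}. \<exists>y\<in>?h ` {t/2..t}. x \<noteq> y"
          proof (rule bexI[where x = "?h (t/2)"], rule bexI[where x = "?h t"])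
            show "?h (t/2) \<in> ?h ` {t/2..t}" by (rule imageI) (use t in simp)
            show "?h t \<in> ?h ` {t/2..t}" by (rule imageI) (use t in simp)
            show "?h (t/2) \<noteq> ?h t" using t(1) by (simp add: axis_eq_axis)
          qed
          show "\<forall>x\<in>?h ` {t/2..t}. fst x \<noteq> snd x \<and> f (fst x) = f (snd x)"
          proof
            fix x assume "x \<in> ?h ` {t/2..t}"
            then obtain s where s: "s \<in> {t/2..t}" "x = ?h s" by blast
            then have "s > 0" "norm (complex_of_real s) < e" using t by auto
            then show "fst x \<noteq> snd x \<and> f (fst x) = f (snd x)"
              using feq \<zeta>1 s(2) by (simp add: axis_eq_axis)
          qed
        qed
      qed
      then show ?thesis unfolding degenerate_def ..
    qed
  qed
qed

subsection \<open>Generic perturbations\<close>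

lemma partial_eq_derivative:
  fixes p :: "complex^'n \<Rightarrow> complex"
  assumes "(p has_derivative D) (at z)" "\<And>c v. D (c *s v) = c * D v"
  shows "partial j p z = D (axis j 1)"
proof -
  have ax: "axis j t = t *s (axis j 1 :: complex^'n)" for t and j :: 'n by (simp add: vec_eq_iff axis_def)
  have "((\<lambda>t. p (z + t *s axis j 1)) has_field_derivative D (axis j 1)) (at 0)"
    by (rule holomorphic_at_line_derivative) (use assms in simp_all)
  then show ?thesis unfolding partial_def by (subst ax) (rule DERIV_imp_deriv)
qed

lemma partial_add: "holomorphic_at p z \<Longrightarrow> holomorphic_at q z \<Longrightarrow> partial j (\<lambda>z. p z + q z) z = partial j p z + partial j q z"
proof -
  assume "holomorphic_at p z" "holomorphic_at q z"
  then obtain D E where D: "(p has_derivative D) (at z)" "\<And>c v. D (c *s v) = c * D v"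
    and E: "(q has_derivative E) (at z)" "\<And>c v. E (c *s v) = c * E v" unfolding holomorphic_at_def by blast
  have "partial j (\<lambda>z. p z + q z) z = D (axis j 1) + E (axis j 1)"
    by (rule partial_eq_derivative[OF has_derivative_add[OF D(1) E(1)]]) (simp add: D E algebra_simps)
  then show ?thesis using partial_eq_derivative[OF D] partial_eq_derivative[OF E] by simp
qed

lemma partial_coord_mult:
  assumes "holomorphic_at p z"
  shows "partial j (\<lambda>z. z $ i * p z) z = (if i = j then p z else 0) + z $ i * partial j p z"
proof -
  obtain D where D: "(p has_derivative D) (at z)" "\<And>c v. D (c *s v) = c * D v"
    using assms unfolding holomorphic_at_def by blast
  have "partial j (\<lambda>z. z $ i * p z) z = z $ i * D (axis j 1) + axis j 1 $ i * p z"
    by (rule partial_eq_derivative[OF has_derivative_mult[OF bounded_linear_imp_has_derivative[OF bounded_linear_vec_nth] D(1)]])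
      (simp add: D algebra_simps)
  then show ?thesis using partial_eq_derivative[OF D] by (simp add: axis_def)
qed

text \<open>Polynomials all of whose monomials have degree at least \<open>k\<close>. The inductive
  form makes closure under partial derivatives, with loss of one order, a rule induction.\<close>

inductive poly_order :: "nat \<Rightarrow> (complex^'n \<Rightarrow> complex) \<Rightarrow> bool" where
  const: "poly_order 0 (\<lambda>z. c)"
| zero: "poly_order k (\<lambda>z. 0)"
| coord: "poly_order k p \<Longrightarrow> poly_order (Suc k) (\<lambda>z. z $ i * p z)"
| add: "poly_order k p \<Longrightarrow> poly_order k q \<Longrightarrow> poly_order k (\<lambda>z. p z + q z)"
| weaken: "poly_order (Suc k) p \<Longrightarrow> poly_order k p"

lemma poly_order_holomorphic_at: "poly_order k p \<Longrightarrow> holomorphic_at p z"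
  by (induction rule: poly_order.induct) (auto intro: holomorphic_at_add holomorphic_at_mult)

lemma poly_order_le:
  assumes "poly_order k p" "k' \<le> k" shows "poly_order k' p"
  using assms(2,1) by (induction rule: dec_induct) (auto intro: poly_order.weaken)

lemma poly_order_at_0: "poly_order k p \<Longrightarrow> k > 0 \<Longrightarrow> p 0 = 0"
  by (induction rule: poly_order.induct) auto

lemma poly_order_partial: "poly_order k p \<Longrightarrow> poly_order (k - 1) (partial j p)"
proof (induction rule: poly_order.induct)
  case (const c)
  have "partial j (\<lambda>z. c) = (\<lambda>z. 0)" by (simp add: partial_def fun_eq_iff)
  then show ?case using poly_order.zero by simp
next
  case (zero k)
  have "partial j (\<lambda>z. 0) = (\<lambda>z. 0)" by (simp add: partial_def fun_eq_iff)
  then show ?case using poly_order.zero by simp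
next
  case (coord k p i)
  have eq: "partial j (\<lambda>z. z $ i * p z) = (\<lambda>z. (if i = j then p z else 0) + z $ i * partial j p z)"
    using partial_coord_mult[OF poly_order_holomorphic_at[OF coord.hyps]] by (rule ext)
  have "poly_order k (\<lambda>z. if i = j then p z else 0)"
    using coord.hyps poly_order.zero by (cases "i = j") simp_all
  moreover have "poly_order k (\<lambda>z. z $ i * partial j p z)"
    by (rule poly_order_le[OF poly_order.coord[OF coord.IH]]) simp
  ultimately have "poly_order k (\<lambda>z. (if i = j then p z else 0) + z $ i * partial j p z)"
    by (rule poly_order.add)
  then show ?case unfolding eq by simp
next
  case (add k p q)
  have "partial j (\<lambda>z. p z + q z) = (\<lambda>z. partial j p z + partial j q z)"
    using partial_add[OF poly_order_holomorphic_at[OF add.hyps(1)] poly_order_holomorphic_at[OF add.hyps(2)]] by (rule ext)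
  then show ?case using poly_order.add[OF add.IH] by simp
next
  case (weaken k p)
  then show ?case using poly_order_le[of k "partial j p" "k - 1"] by simp
qed

text \<open>Each derivative lowers the order of q by at most one, so with fewer than k derivatives
  the order stays positive and the value at 0 vanishes.\<close>

lemma fold_partial_add_high_order:
  "poly_order 0 p \<Longrightarrow> poly_order k q \<Longrightarrow> length js < k \<Longrightarrow>
    fold partial js (\<lambda>z. p z + q z) 0 = fold partial js p 0"
proof (induction js arbitrary: p q k)
  case Nil
  then show ?case using poly_order_at_0[of k q] by simp
next
  case (Cons j js)
  have eq: "partial j (\<lambda>z. p z + q z) = (\<lambda>z. partial j p z + partial j q z)"
    using partial_add[OF poly_order_holomorphic_at[OF Cons.prems(1)] poly_order_holomorphic_at[OF Cons.prems(2)]] by (rule ext)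
  have "poly_order 0 (partial j p)" using poly_order_partial[OF Cons.prems(1)] by simp
  moreover have "poly_order (k - 1) (partial j q)" by (rule poly_order_partial[OF Cons.prems(2)])
  moreover have "length js < k - 1" using Cons.prems(3) by simp
  ultimately have "fold partial js (\<lambda>z. partial j p z + partial j q z) 0 = fold partial js (partial j p) 0"
    by (rule Cons.IH)
  then show ?case by (simp add: eq)
qed

lemma poly_order_power_mult: "poly_order k p \<Longrightarrow> poly_order (k + e) (\<lambda>z. z $ i ^ e * p z)"
proof (induction e)
  case (Suc e)
  from poly_order.coord[OF Suc.IH[OF Suc.prems], of i] show ?case by (simp add: mult.assoc)
qed simp

lemma poly_order_mon: "poly_order (mdeg a) (\<lambda>z. mon a z * c)"
proof -
  have "finite S \<Longrightarrow> poly_order (\<Sum>i\<in>S. a i) (\<lambda>z. (\<Prod>i\<in>S. z $ i ^ a i) * c)" for S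
  proof (induction S rule: finite_induct)
    case empty
    then show ?case using poly_order.const[of c] by simp
  next
    case (insert i S)
    from poly_order_power_mult[OF insert.IH, where e = "a i" and i = i] insert.hyps
    show ?case by (simp add: mult.assoc add.commute)
  qed
  from this[of UNIV] show ?thesis unfolding mdeg_def mon_def by simp
qed

lemma poly_order_sum: "finite I \<Longrightarrow> (\<And>i. i \<in> I \<Longrightarrow> poly_order k (p i)) \<Longrightarrow> poly_order k (\<lambda>z. \<Sum>i\<in>I. p i z)"
proof (induction I rule: finite_induct)
  case empty
  then show ?case using poly_order.zero by simp
next
  case (insert i I)
  have "poly_order k (\<lambda>z. p i z + (\<Sum>i\<in>I. p i z))"
    by (rule poly_order.add) (use insert in auto)
  then show ?case using insert.hyps by simp
qed

lemma eventually_partial_cong: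
  fixes p q :: "complex^'n \<Rightarrow> complex"
  assumes "\<forall>\<^sub>F z in nhds 0. p z = q z"
  shows "\<forall>\<^sub>F z in nhds 0. partial j p z = partial j q z"
proof -
  have "\<forall>\<^sub>F x in nhds 0. \<forall>\<^sub>F y in nhds x. p y = q y" using assms unfolding eventually_eventually .
  then show ?thesis
  proof eventually_elim
    case (elim x)
    have "isCont (\<lambda>t. x + axis j t) 0"
      by (intro continuous_intros bounded_linear.isCont[OF bounded_linear_axis])
    then have "filterlim (\<lambda>t. x + axis j t) (nhds (x + axis j 0)) (nhds 0)"
      using iffD1[OF tendsto_at_iff_tendsto_nhds[of "\<lambda>t. x + axis j t" 0]] unfolding isCont_def by blast
    moreover have "axis j (0 :: complex) = (0 :: complex^'n)" by (simp add: axis_eq_0_iff)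
    ultimately have "filterlim (\<lambda>t. x + axis j t) (nhds x) (nhds 0)" by simp
    then have "\<forall>\<^sub>F t in nhds 0. p (x + axis j t) = q (x + axis j t)" using elim unfolding filterlim_iff by blast
    then show ?case unfolding partial_def by (intro deriv_cong_ev) auto
  qed
qed

lemma fold_partial_cong:
  "\<forall>\<^sub>F z in nhds 0. p z = q z \<Longrightarrow> fold partial js p 0 = fold partial js q 0"
proof (induction js arbitrary: p q)
  case Nil
  then show ?case using eventually_nhds_x_imp_x by fastforce
next
  case (Cons j js)
  from Cons.IH[OF eventually_partial_cong[OF Cons.prems]] show ?case by simp
qed

section \<open>Null sets of bad parameters\<close>

lemma differentiable_smult:
  fixes g :: "'x::real_normed_vector \<Rightarrow> complex^'p"
  assumes "f differentiable (at x within S)" "g differentiable (at x within S)"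
  shows "(\<lambda>x. f x *s g x) differentiable (at x within S)"
  using assms bounded_bilinear.FDERIV[OF bounded_bilinear_smult] unfolding differentiable_def by blast

lemma differentiable_bounded_linear:
  "bounded_linear L \<Longrightarrow> f differentiable (at x within S) \<Longrightarrow> (\<lambda>x. L (f x)) differentiable (at x within S)"
  using bounded_linear.has_derivative unfolding differentiable_def by blast

text \<open>Solving the equation \<open>c \<xi> + (\<Sum>\<beta>. G \<beta> \<xi> *s a $ \<beta>) = 0\<close> for one of the vectors \<open>a $ \<alpha>\<close> parametrizes
  the bad parameters by \<open>\<xi>\<close> and the other \<open>a $ \<beta>\<close>; the slot of \<open>a $ \<alpha>\<close> has room for \<open>\<xi>\<close>.
  A curve of solutions \<open>\<xi>\<close> meets a hyperplane with a rational coordinate, so the bad parameters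
  lie in countably many images of null sets.\<close>

lemma negligible_parameters_with_solution_curve:
  fixes c :: "'x::euclidean_space \<Rightarrow> complex^'p" and G :: "'m::finite \<Rightarrow> 'x \<Rightarrow> complex"
  assumes dim: "DIM('x) \<le> DIM(complex^'p)"
    and c: "\<And>x. c differentiable (at x)" and G: "\<And>\<beta> x. G \<beta> differentiable (at x)"
  shows "negligible {a :: (complex^'p)^'m. \<exists>C. connected C \<and> (\<exists>x\<in>C. \<exists>y\<in>C. x \<noteq> y) \<and>
    (\<forall>\<xi>\<in>C. (\<exists>\<alpha>. G \<alpha> \<xi> \<noteq> 0) \<and> c \<xi> + (\<Sum>\<beta>\<in>UNIV. G \<beta> \<xi> *s (a $ \<beta>)) = 0)}" (is "negligible ?bad")
proof -
  \<comment> \<open>An injection between bases embeds the space of \<xi> into one parameter slot: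
    \<open>\<sigma>\<close> is the embedding, \<open>\<pi>\<close> its linear left inverse.\<close>
  obtain \<phi> :: "'x \<Rightarrow> complex^'p" where \<phi>: "\<phi> ` Basis \<subseteq> Basis" "inj_on \<phi> Basis"
    using card_le_inj[OF finite_Basis finite_Basis dim] by blast
  define \<sigma> where "\<sigma> x = (\<Sum>b\<in>Basis. (x \<bullet> b) *\<^sub>R \<phi> b)" for x
  define \<pi> where "\<pi> y = (\<Sum>b\<in>Basis. (y \<bullet> \<phi> b) *\<^sub>R b)" for y
  have \<pi>b: "\<pi> y \<bullet> b = y \<bullet> \<phi> b" if "b \<in> Basis" for y b
    using that unfolding \<pi>_def by (simp add: inner_sum_left inner_Basis if_distrib cong: if_cong)
  have \<sigma>b: "\<sigma> x \<bullet> \<phi> b = x \<bullet> b" if b: "b \<in> Basis" for x b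
  proof -
    have "\<sigma> x \<bullet> \<phi> b = (\<Sum>b'\<in>Basis. if b' = b then x \<bullet> b else 0)"
      unfolding \<sigma>_def inner_sum_left
    proof (rule sum.cong[OF refl])
      fix b' :: 'x assume b': "b' \<in> Basis"
      have "\<phi> b' \<bullet> \<phi> b = (if b' = b then 1 else 0)"
        using \<phi> b b' by (simp add: inner_Basis image_subset_iff inj_on_eq_iff)
      then show "(x \<bullet> b') *\<^sub>R \<phi> b' \<bullet> \<phi> b = (if b' = b then x \<bullet> b else 0)" by simp
    qed
    then show ?thesis using b by simp
  qed
  have \<pi>\<sigma>: "\<pi> (\<sigma> x) = x" for x
    by (rule euclidean_eqI) (simp add: \<pi>b \<sigma>b)
  have \<pi>lin: "bounded_linear \<pi>"
    unfolding \<pi>_def by (intro bounded_linear_sum bounded_linear_scaleR_const bounded_linear_inner_left)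
  \<comment> \<open>Reads \<xi> off slot \<alpha> through \<open>\<pi>\<close> and overwrites this
    slot with the value that the equation forces, keeping the other slots. A bad parameter is thus
    the image of the one that stores \<open>\<sigma>\<close> \<xi> in slot \<alpha>.\<close>
  define \<Phi> where "\<Phi> \<alpha> a = a + axis \<alpha> (- (inverse (G \<alpha> (\<pi> (a $ \<alpha>))) *s (c (\<pi> (a $ \<alpha>)) +
      (\<Sum>\<gamma>\<in>UNIV - {\<alpha>}. G \<gamma> (\<pi> (a $ \<alpha>)) *s (a $ \<gamma>)))) - a $ \<alpha>)" for \<alpha> and a :: "(complex^'p)^'m"
  define T where "T \<alpha> b \<rho> = {a :: (complex^'p)^'m. \<pi> (a $ \<alpha>) \<bullet> b = \<rho> \<and> G \<alpha> (\<pi> (a $ \<alpha>)) \<noteq> 0}" for \<alpha> b \<rho>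
  have "\<Phi> \<alpha> differentiable_on T \<alpha> b \<rho>" for \<alpha> b \<rho>
    unfolding differentiable_on_def
  proof
    fix a assume a: "a \<in> T \<alpha> b \<rho>"
    have p: "(\<lambda>a. \<pi> (a $ \<alpha>)) differentiable (at a within T \<alpha> b \<rho>)"
      by (intro differentiable_bounded_linear[OF \<pi>lin] differentiable_bounded_linear[OF bounded_linear_vec_nth]) simp
    have Gp: "(\<lambda>a. G \<beta> (\<pi> (a $ \<alpha>))) differentiable (at a within T \<alpha> b \<rho>)" for \<beta>
      by (rule differentiable_compose[OF G p])
    have cp: "(\<lambda>a. c (\<pi> (a $ \<alpha>))) differentiable (at a within T \<alpha> b \<rho>)"
      by (rule differentiable_compose[OF c p])
    have nth: "(\<lambda>a. a $ \<gamma>) differentiable (at a within T \<alpha> b \<rho>)" for \<gamma>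
      by (intro differentiable_bounded_linear[OF bounded_linear_vec_nth]) simp
    have Ginv: "(\<lambda>a. inverse (G \<alpha> (\<pi> (a $ \<alpha>)))) differentiable (at a within T \<alpha> b \<rho>)"
      using a by (intro differentiable_inverse Gp) (simp add: T_def)
    show "\<Phi> \<alpha> differentiable (at a within T \<alpha> b \<rho>)"
      unfolding \<Phi>_def[abs_def]
      by (intro differentiable_add differentiable_ident differentiable_bounded_linear[OF bounded_linear_axis]
          differentiable_diff differentiable_minus differentiable_smult differentiable_sum ballI Ginv cp Gp nth) simp
  qed
  moreover have "negligible (T \<alpha> b \<rho>)" if b: "b \<in> Basis" for \<alpha> b \<rho>
  proof (rule negligible_subset[OF negligible_hyperplane])
    have "axis \<alpha> (\<phi> b) \<noteq> (0 :: (complex^'p)^'m)"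
      using \<phi>(1) b nonzero_Basis by (auto simp: axis_eq_0_iff image_subset_iff)
    then show "axis \<alpha> (\<phi> b) \<noteq> (0 :: (complex^'p)^'m) \<or> \<rho> \<noteq> 0" ..
    show "T \<alpha> b \<rho> \<subseteq> {a. axis \<alpha> (\<phi> b) \<bullet> a = \<rho>}"
    proof
      fix a assume "a \<in> T \<alpha> b \<rho>"
      then have "\<pi> (a $ \<alpha>) \<bullet> b = \<rho>" by (simp add: T_def)
      then have "a $ \<alpha> \<bullet> \<phi> b = \<rho>" by (simp only: \<pi>b[OF b])
      moreover have "axis \<alpha> (\<phi> b) \<bullet> a = a $ \<alpha> \<bullet> \<phi> b"
        by (rule trans[OF inner_commute inner_axis])
      ultimately show "a \<in> {a. axis \<alpha> (\<phi> b) \<bullet> a = \<rho>}" by simp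
    qed
  qed
  \<comment> \<open>\<open>\<Phi> \<alpha>\<close> maps the parameter space to itself, so the
    dimension does not rise and a differentiable image of a null set is null.\<close>
  ultimately have neg: "negligible (\<Phi> \<alpha> ` T \<alpha> b \<rho>)" if "b \<in> Basis" for \<alpha> b \<rho>
    using that by (intro negligible_differentiable_image_negligible) auto
  have "?bad \<subseteq> \<Union> ((\<lambda>(\<alpha>, b, \<rho>). \<Phi> \<alpha> ` T \<alpha> b \<rho>) ` (UNIV \<times> Basis \<times> \<rat>))"
  proof
    fix a assume "a \<in> ?bad"
    then obtain C x y where C: "connected C" "x \<in> C" "y \<in> C" "x \<noteq> y"
      and sol: "\<And>\<xi>. \<xi> \<in> C \<Longrightarrow> (\<exists>\<alpha>. G \<alpha> \<xi> \<noteq> 0) \<and> c \<xi> + (\<Sum>\<beta>\<in>UNIV. G \<beta> \<xi> *s (a $ \<beta>)) = 0" by blast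
    obtain b where b: "b \<in> Basis" "x \<bullet> b \<noteq> y \<bullet> b" using C(4) euclidean_eqI by blast
    have "\<exists>\<rho>\<in>\<rat>. \<exists>\<xi>\<in>C. \<xi> \<bullet> b = \<rho>"
    proof -
      have *: "\<exists>\<rho>\<in>\<rat>. \<exists>\<xi>\<in>C. \<xi> \<bullet> b = \<rho>" if lt: "u \<bullet> b < v \<bullet> b" and uv: "u \<in> C" "v \<in> C" for u v
      proof -
        obtain \<rho> where \<rho>: "\<rho> \<in> \<rat>" "u \<bullet> b < \<rho>" "\<rho> < v \<bullet> b" using Rats_dense_in_real[OF lt] by blast
        have "\<exists>z\<in>C. z \<bullet> b = \<rho>"
          by (rule connected_ivt_component[OF C(1) uv]) (use \<rho> in auto)
        then show ?thesis using \<rho>(1) by blast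
      qed
      show ?thesis using b(2) *[of x y] *[of y x] C(2,3) by linarith
    qed
    then obtain \<xi> where \<xi>: "\<xi> \<in> C" "\<xi> \<bullet> b \<in> \<rat>" by blast
    obtain \<alpha> where \<alpha>: "G \<alpha> \<xi> \<noteq> 0" and eq: "c \<xi> + (\<Sum>\<beta>\<in>UNIV. G \<beta> \<xi> *s (a $ \<beta>)) = 0"
      using sol[OF \<xi>(1)] by blast
    define a' where "a' = (\<chi> \<beta>. if \<beta> = \<alpha> then \<sigma> \<xi> else a $ \<beta>)"
    have "a' \<in> T \<alpha> b (\<xi> \<bullet> b)" using \<alpha> by (simp add: T_def a'_def \<pi>\<sigma>)
    moreover have "\<Phi> \<alpha> a' = a"
    proof -
      let ?s = "\<Sum>\<gamma>\<in>UNIV - {\<alpha>}. G \<gamma> \<xi> *s (a $ \<gamma>)"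
      have "(\<Sum>\<beta>\<in>UNIV. G \<beta> \<xi> *s (a $ \<beta>)) = G \<alpha> \<xi> *s (a $ \<alpha>) + ?s" by (rule sum.remove) auto
      then have "c \<xi> + (G \<alpha> \<xi> *s (a $ \<alpha>) + ?s) = 0" using eq by simp
      then have e2: "c \<xi> + ?s = - (G \<alpha> \<xi> *s (a $ \<alpha>))" by (simp add: eq_neg_iff_add_eq_0 add_ac)
      have key: "- (inverse (G \<alpha> \<xi>) *s (c \<xi> + ?s)) = a $ \<alpha>"
        unfolding e2 using \<alpha> by (simp add: vec_eq_iff)
      have "(\<Sum>\<gamma>\<in>UNIV - {\<alpha>}. G \<gamma> \<xi> *s (a' $ \<gamma>)) = ?s" by (intro sum.cong) (auto simp: a'_def)
      then have "\<Phi> \<alpha> a' = a' + axis \<alpha> (a $ \<alpha> - \<sigma> \<xi>)"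
        using key unfolding \<Phi>_def by (simp add: a'_def \<pi>\<sigma>)
      also have "\<dots> = a" by (simp add: vec_eq_iff a'_def axis_def)
      finally show ?thesis .
    qed
    ultimately show "a \<in> \<Union> ((\<lambda>(\<alpha>, b, \<rho>). \<Phi> \<alpha> ` T \<alpha> b \<rho>) ` (UNIV \<times> Basis \<times> \<rat>))"
      using b(1) \<xi>(2) by (intro UnionI[of "\<Phi> \<alpha> ` T \<alpha> b (\<xi> \<bullet> b)"]) (auto intro!: image_eqI[of _ _ "(\<alpha>, b, \<xi> \<bullet> b)"])
  qed
  moreover have "negligible (\<Union> ((\<lambda>(\<alpha>, b, \<rho>). \<Phi> \<alpha> ` T \<alpha> b \<rho>) ` (UNIV \<times> Basis \<times> \<rat>)))"
  proof (rule negligible_countable_Union)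
    show "countable ((\<lambda>(\<alpha>, b, \<rho>). \<Phi> \<alpha> ` T \<alpha> b \<rho>) ` ((UNIV :: 'm set) \<times> (Basis :: 'x set) \<times> \<rat>))"
      by (intro countable_image countable_SIGMA countable_rat) (auto simp: countable_finite)
  qed (use neg in auto)
  ultimately show ?thesis by (rule negligible_subset[rotated])
qed

lemma differentiable_prod:
  fixes f :: "'i \<Rightarrow> 'x::real_normed_vector \<Rightarrow> 'b::real_normed_field"
  shows "(\<And>i. i \<in> I \<Longrightarrow> f i differentiable (at x within S)) \<Longrightarrow> (\<lambda>x. \<Prod>i\<in>I. f i x) differentiable (at x within S)"
  by (induction I rule: infinite_finite_induct) auto

text \<open>The perturbing monomials satisfy the axis conditions by themselves. Hence at every
  candidate for a bad point some coefficient of the linear system in the parameters is nonzero, as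
  the null-set lemma requires.\<close>

lemma perturbation_not_degenerate:
  fixes f :: "complex^'n \<Rightarrow> complex^'p"
  assumes f: "map_germ f" "monomial_germ f" and dim: "CARD('p) \<ge> 2 * CARD('n)"
  shows "\<exists>g :: complex^'n \<Rightarrow> complex^'p. map_germ g \<and> same_jet r f g \<and> \<not> degenerate g"
proof -
  obtain K A e where e: "e > 0" and nz: "\<And>k. k \<in> K \<Longrightarrow> A k \<noteq> (\<lambda>_. 0)"
    and fz: "\<And>z k. norm z < e \<Longrightarrow> f z $ k = (if k \<in> K then mon (A k) z else 0)"
    using monomial_germ_representation[OF f] by metis
  define N where "N = Suc r"
  have N0: "N \<noteq> 0" by (simp add: N_def)
  \<comment> \<open>The monomials z_i^N, z_i^(N+1) and z_i^N z_j for j \<noteq> i, all of degree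
    above r. The index (i, \<open>None\<close>) stands for the first kind and (i,
    \<open>Some j\<close>) for the others, with j = i for the second. Each gets a free coefficient
    vector \<open>a $ \<beta>\<close> in the target.\<close>
  define B :: "'n \<times> 'n option \<Rightarrow> 'n \<Rightarrow> nat" where
    "B \<beta> = (case \<beta> of (i, None) \<Rightarrow> single i N
       | (i, Some j) \<Rightarrow> (if i = j then single i (Suc N) else pair i N j))" for \<beta>
  have deg_single: "mdeg (single i m) = m" for i :: 'n and m
    unfolding mdeg_def single_def by simp
  have deg_pair: "mdeg (pair i m j) = Suc m" if "i \<noteq> j" for i j :: 'n and m
  proof -
    have "mdeg (pair i m j) = (\<Sum>t\<in>UNIV. (if t = j then 1 else 0) + (if t = i then m else 0))"
      unfolding mdeg_def pair_def using that by (intro sum.cong) auto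
    then show ?thesis by (simp add: sum.distrib)
  qed
  have degB: "mdeg (B \<beta>) \<ge> N" for \<beta>
    unfolding B_def by (auto split: prod.split option.split simp: deg_single deg_pair)
  define f0 where "f0 z = (\<chi> k. if k \<in> K then mon (A k) z else 0)" for z
  define df0 where "df0 z u = (\<chi> k. if k \<in> K then dmon (A k) z u else 0)" for z u
  define F where "F a z = f0 z + (\<Sum>\<beta>\<in>UNIV. mon (B \<beta>) z *s (a $ \<beta>))" for a z
  have f0_der: "(f0 has_derivative df0 z) (at z)" for z
    unfolding f0_def[abs_def] df0_def[abs_def]
  proof (rule has_derivative_vec_lambda)
    fix k show "((\<lambda>z. if k \<in> K then mon (A k) z else 0) has_derivative (\<lambda>u. if k \<in> K then dmon (A k) z u else 0)) (at z)"
      using has_derivative_mon[of "A k" z] by (cases "k \<in> K") simp_all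
  qed
  have F_der: "(F a has_derivative (\<lambda>u. df0 z u + (\<Sum>\<beta>\<in>UNIV. dmon (B \<beta>) z u *s (a $ \<beta>)))) (at z)" for a z
    unfolding F_def[abs_def]
    by (intro has_derivative_add f0_der has_derivative_sum
        bounded_linear.has_derivative[OF bounded_bilinear.bounded_linear_left[OF bounded_bilinear_smult]] has_derivative_mon)
  \<comment> \<open>The unknowns are pairs: a point with a kernel vector, or two points with the
    same image. Here p \<ge> 2n enters.\<close>
  have dimX: "DIM((complex^'n) \<times> (complex^'n)) \<le> DIM(complex^'p)" using dim by simp
  have fst_d: "(\<lambda>x :: (complex^'n) \<times> (complex^'n). fst x $ i) differentiable (at x)"
    and snd_d: "(\<lambda>x :: (complex^'n) \<times> (complex^'n). snd x $ i) differentiable (at x)" for i x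
    by (intro differentiable_bounded_linear[OF bounded_linear_vec_nth] differentiable_bounded_linear[OF bounded_linear_fst]
        differentiable_bounded_linear[OF bounded_linear_snd] differentiable_ident)+
  have mon_d: "(\<lambda>x :: (complex^'n) \<times> (complex^'n). mon a (fst x)) differentiable (at x)"
    "(\<lambda>x :: (complex^'n) \<times> (complex^'n). mon a (snd x)) differentiable (at x)" for a x
    unfolding mon_def by (intro differentiable_prod differentiable_power fst_d snd_d)+
  have dmon_d: "(\<lambda>x :: (complex^'n) \<times> (complex^'n). dmon a (fst x) (snd x)) differentiable (at x)" for a x
    unfolding dmon_def
    by (intro differentiable_sum ballI differentiable_mult differentiable_prod differentiable_power fst_d snd_d differentiable_const) simp
  have vec_d: "(\<lambda>x. \<chi> k. if k \<in> K then h k x else 0 :: complex^'p) differentiable (at x)"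
    if "\<And>k. h k differentiable (at x)" for h and x :: "(complex^'n) \<times> (complex^'n)"
    unfolding vec_lambda_eq_sum_axis
  proof (intro differentiable_sum ballI differentiable_bounded_linear[OF bounded_linear_axis])
    show "(\<lambda>x. if k \<in> K then h k x else 0) differentiable (at x)" for k
      using that by (cases "k \<in> K") simp_all
  qed simp
  have "negligible {a. \<exists>C. connected C \<and> (\<exists>x\<in>C. \<exists>y\<in>C. x \<noteq> y) \<and>
    (\<forall>\<xi>\<in>C. (\<exists>\<alpha>. dmon (B \<alpha>) (fst \<xi>) (snd \<xi>) \<noteq> 0) \<and>
      df0 (fst \<xi>) (snd \<xi>) + (\<Sum>\<beta>\<in>UNIV. dmon (B \<beta>) (fst \<xi>) (snd \<xi>) *s (a $ \<beta>)) = 0)}" (is "negligible ?bad1")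
    by (rule negligible_parameters_with_solution_curve[OF dimX _ dmon_d]) (unfold df0_def, intro vec_d dmon_d)
  moreover have "negligible {a. \<exists>C. connected C \<and> (\<exists>x\<in>C. \<exists>y\<in>C. x \<noteq> y) \<and>
    (\<forall>\<xi>\<in>C. (\<exists>\<alpha>. mon (B \<alpha>) (fst \<xi>) - mon (B \<alpha>) (snd \<xi>) \<noteq> 0) \<and>
      (f0 (fst \<xi>) - f0 (snd \<xi>)) + (\<Sum>\<beta>\<in>UNIV. (mon (B \<beta>) (fst \<xi>) - mon (B \<beta>) (snd \<xi>)) *s (a $ \<beta>)) = 0)}" (is "negligible ?bad2")
  proof (rule negligible_parameters_with_solution_curve[OF dimX])
    show "(\<lambda>x. f0 (fst x) - f0 (snd x)) differentiable (at x)" for x :: "(complex^'n) \<times> (complex^'n)"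
      unfolding f0_def by (intro differentiable_diff vec_d mon_d)
    show "(\<lambda>x. mon (B \<beta>) (fst x) - mon (B \<beta>) (snd x)) differentiable (at x)" for \<beta> and x :: "(complex^'n) \<times> (complex^'n)"
      by (intro differentiable_diff mon_d)
  qed
  ultimately have "negligible (?bad1 \<union> ?bad2)" by (rule negligible_Un)
  then have "?bad1 \<union> ?bad2 \<noteq> UNIV" using non_negligible_UNIV by metis
  then obtain a where a1: "a \<notin> ?bad1" and a2: "a \<notin> ?bad2" by blast
  define g where "g = F a"
  have "\<not> nonimmersive_near_0 g"
  proof
    assume "nonimmersive_near_0 g"
    \<comment> \<open>\<open>g\<close> is a polynomial map without bad curves anywhere, so any
      radius will do; 1 is taken.\<close>
    then obtain z D u where z: "z \<noteq> 0" "(g has_derivative D) (at z)" "u \<noteq> 0" "D u = 0"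
      unfolding nonimmersive_near_0_def using zero_less_one by blast
    have "D = (\<lambda>u. df0 z u + (\<Sum>\<beta>\<in>UNIV. dmon (B \<beta>) z u *s (a $ \<beta>)))"
      using has_derivative_unique[OF z(2)] F_der unfolding g_def by blast
    then have D0: "df0 z u + (\<Sum>\<beta>\<in>UNIV. dmon (B \<beta>) z u *s (a $ \<beta>)) = 0" using z(4) by simp
    obtain i where i: "z $ i \<noteq> 0" using z(1) by (auto simp: vec_eq_iff)
    have "\<exists>\<alpha>. dmon (B \<alpha>) z u \<noteq> 0"
    proof (cases "u $ i = 0")
      case False
      then have "dmon (B (i, None)) z u \<noteq> 0" using i N0 by (simp add: B_def dmon_single)
      then show ?thesis ..
    next
      case True
      obtain j where j: "u $ j \<noteq> 0" using z(3) by (auto simp: vec_eq_iff)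
      then have "i \<noteq> j" using True by blast
      then have "dmon (B (i, Some j)) z u \<noteq> 0" using i j True by (simp add: B_def dmon_pair)
      then show ?thesis ..
    qed
    then obtain \<alpha> where \<alpha>: "dmon (B \<alpha>) z u \<noteq> 0" by blast
    have dmon_s: "dmon b z (complex_of_real s *s u) = complex_of_real s * dmon b z u" for b s
      unfolding dmon_def sum_distrib_left by (intro sum.cong) auto
    have df0_s: "df0 z (complex_of_real s *s u) = complex_of_real s *s df0 z u" for s
      by (simp add: df0_def vec_eq_iff dmon_s)
    \<comment> \<open>The kernel equation is homogeneous in u, so a single non-immersive point
      already produces a segment of solutions.\<close>
    let ?C = "(\<lambda>s. (z, complex_of_real s *s u)) ` {1..2}"
    have "continuous_on {1..2} (\<lambda>s. (z, complex_of_real s *s u))"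
      by (intro continuous_on_Pair continuous_on_const
          bounded_linear.continuous_on[OF bounded_bilinear.bounded_linear_left[OF bounded_bilinear_smult]] continuous_intros)
    then have "connected ?C" by (rule connected_continuous_image) simp
    moreover have "\<exists>x\<in>?C. \<exists>y\<in>?C. x \<noteq> y"
    proof (rule bexI[where x = "(z, complex_of_real 1 *s u)"], rule bexI[where x = "(z, complex_of_real 2 *s u)"])
      show "(z, complex_of_real 1 *s u) \<noteq> (z, complex_of_real 2 *s u)"
        using z(3) by (auto simp: vec_eq_iff)
      show "(z, complex_of_real 1 *s u) \<in> ?C" by (rule imageI) simp
      show "(z, complex_of_real 2 *s u) \<in> ?C" by (rule imageI) simp
    qed
    moreover have "\<forall>\<xi>\<in>?C. (\<exists>\<alpha>. dmon (B \<alpha>) (fst \<xi>) (snd \<xi>) \<noteq> 0) \<and>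
      df0 (fst \<xi>) (snd \<xi>) + (\<Sum>\<beta>\<in>UNIV. dmon (B \<beta>) (fst \<xi>) (snd \<xi>) *s (a $ \<beta>)) = 0"
    proof
      fix \<xi> assume "\<xi> \<in> ?C"
      then obtain s where s: "s \<in> {1..2}" "\<xi> = (z, complex_of_real s *s u)" by blast
      have "complex_of_real s *s (df0 z u + (\<Sum>\<beta>\<in>UNIV. dmon (B \<beta>) z u *s (a $ \<beta>)))
        = df0 z (complex_of_real s *s u) + (\<Sum>\<beta>\<in>UNIV. dmon (B \<beta>) z (complex_of_real s *s u) *s (a $ \<beta>))"
        by (simp add: df0_s dmon_s vec_eq_iff sum_distrib_left algebra_simps)
      then have "df0 (fst \<xi>) (snd \<xi>) + (\<Sum>\<beta>\<in>UNIV. dmon (B \<beta>) (fst \<xi>) (snd \<xi>) *s (a $ \<beta>)) = 0"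
        using s(2) D0 by simp
      moreover have "dmon (B \<alpha>) (fst \<xi>) (snd \<xi>) \<noteq> 0"
        using s \<alpha> by (simp add: dmon_s)
      ultimately show "(\<exists>\<alpha>. dmon (B \<alpha>) (fst \<xi>) (snd \<xi>) \<noteq> 0) \<and>
        df0 (fst \<xi>) (snd \<xi>) + (\<Sum>\<beta>\<in>UNIV. dmon (B \<beta>) (fst \<xi>) (snd \<xi>) *s (a $ \<beta>)) = 0" by blast
    qed
    ultimately show False using a1 by blast
  qed
  moreover have "\<not> double_curves_near_0 g"
  proof
    assume "double_curves_near_0 g"
    from this[unfolded double_curves_near_0_def, rule_format, OF zero_less_one]
    obtain C where "C \<subseteq> ball 0 1 \<times> ball 0 1" and C: "connected C" "\<exists>x\<in>C. \<exists>y\<in>C. x \<noteq> y"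
      "\<forall>x\<in>C. fst x \<noteq> snd x \<and> g (fst x) = g (snd x)"
      by (elim exE conjE) (rule that)
    have "\<forall>\<xi>\<in>C. (\<exists>\<alpha>. mon (B \<alpha>) (fst \<xi>) - mon (B \<alpha>) (snd \<xi>) \<noteq> 0) \<and>
      (f0 (fst \<xi>) - f0 (snd \<xi>)) + (\<Sum>\<beta>\<in>UNIV. (mon (B \<beta>) (fst \<xi>) - mon (B \<beta>) (snd \<xi>)) *s (a $ \<beta>)) = 0"
    proof
      fix \<xi> assume "\<xi> \<in> C"
      then have \<xi>: "\<xi> \<in> C" .
      define z w where "z = fst \<xi>" and "w = snd \<xi>"
      have zw: "z \<noteq> w" "F a z = F a w" using bspec[OF C(3) \<xi>] by (simp_all add: g_def z_def w_def)
      obtain i where i: "z $ i \<noteq> w $ i" using zw(1) by (auto simp: vec_eq_iff)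
      \<comment> \<open>The exponents N and N + 1 are coprime, so both powers agree only if the
        coordinates do.\<close>
      have "z $ i ^ N \<noteq> w $ i ^ N \<or> z $ i ^ Suc N \<noteq> w $ i ^ Suc N"
      proof (rule ccontr)
        assume "\<not> ?thesis"
        then have "z $ i ^ m = w $ i ^ m" if "m \<in> {N, Suc N}" for m using that by blast
        moreover have "Gcd {N, Suc N} = 1" by (simp add: gcd.commute[of N])
        ultimately show False using eq_if_powers_eq[of "{N, Suc N}"] i by blast
      qed
      then have "mon (B (i, None)) z \<noteq> mon (B (i, None)) w \<or> mon (B (i, Some i)) z \<noteq> mon (B (i, Some i)) w"
        by (simp add: B_def mon_single)
      then have "\<exists>\<alpha>. mon (B \<alpha>) z - mon (B \<alpha>) w \<noteq> 0" by auto
      moreover have "(f0 z - f0 w) + (\<Sum>\<beta>\<in>UNIV. (mon (B \<beta>) z - mon (B \<beta>) w) *s (a $ \<beta>)) = F a z - F a w"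
        unfolding F_def by (simp add: vec_eq_iff sum_subtractf algebra_simps)
      ultimately show "(\<exists>\<alpha>. mon (B \<alpha>) (fst \<xi>) - mon (B \<alpha>) (snd \<xi>) \<noteq> 0) \<and>
        (f0 (fst \<xi>) - f0 (snd \<xi>)) + (\<Sum>\<beta>\<in>UNIV. (mon (B \<beta>) (fst \<xi>) - mon (B \<beta>) (snd \<xi>)) *s (a $ \<beta>)) = 0"
        using zw(2) unfolding z_def w_def by simp
    qed
    then show False using a2 C(1,2) by blast
  qed
  ultimately have "\<not> degenerate g" by (simp add: degenerate_def)
  have gk: "g z $ k = f0 z $ k + (\<Sum>\<beta>\<in>UNIV. mon (B \<beta>) z * a $ \<beta> $ k)" for z k
    by (simp add: g_def F_def)
  have oB: "poly_order N (\<lambda>z. \<Sum>\<beta>\<in>UNIV. mon (B \<beta>) z * a $ \<beta> $ k)" for k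
    by (intro poly_order_sum poly_order_le[OF poly_order_mon degB]) simp
  have of0: "poly_order 0 (\<lambda>z. f0 z $ k)" for k
  proof (cases "k \<in> K")
    case True
    then show ?thesis using poly_order_le[OF poly_order_mon[of "A k" 1]] by (simp add: f0_def)
  qed (simp add: f0_def poly_order.zero)
  have "map_germ g"
  proof -
    have "f 0 = 0" using f by (simp add: map_germ_def)
    then have "f0 0 $ k = 0" for k using fz[of 0 k] e by (simp add: f0_def)
    moreover have "(\<Sum>\<beta>\<in>UNIV. mon (B \<beta>) 0 * a $ \<beta> $ k) = 0" for k
      using poly_order_at_0[OF oB] by (simp add: N_def)
    ultimately have "g 0 = 0" by (simp add: vec_eq_iff gk)
    moreover have "holomorphic_at (\<lambda>z. g z $ k) z" for z k
      unfolding gk by (intro holomorphic_at_add poly_order_holomorphic_at[OF of0] poly_order_holomorphic_at[OF oB])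
    ultimately show ?thesis unfolding map_germ_def complex_differentiable_at_iff by simp
  qed
  moreover have "same_jet r f g"
    unfolding same_jet_def
  proof (intro allI impI)
    fix js :: "'n list" and k assume js: "length js \<le> r"
    have "\<forall>\<^sub>F z in nhds (0 :: complex^'n). norm z < e" using e by (rule eventually_norm_less)
    then have "\<forall>\<^sub>F z in nhds 0. f z $ k = f0 z $ k" by eventually_elim (simp add: fz f0_def)
    then have "fold partial js (\<lambda>z. f z $ k) 0 = fold partial js (\<lambda>z. f0 z $ k) 0" by (rule fold_partial_cong)
    also have "\<dots> = fold partial js (\<lambda>z. f0 z $ k + (\<Sum>\<beta>\<in>UNIV. mon (B \<beta>) z * a $ \<beta> $ k)) 0"
      by (rule fold_partial_add_high_order[OF of0 oB, symmetric]) (use js in \<open>simp add: N_def\<close>)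
    finally show "fold partial js (\<lambda>z. f z $ k) 0 = fold partial js (\<lambda>z. g z $ k) 0" unfolding gk .
  qed
  ultimately show ?thesis using \<open>\<not> degenerate g\<close> by blast
qed

subsection \<open>Normal forms\<close>

text \<open>Flattens a nested list comprehension to one list of index pairs, so that the blocks of a
  normal form become a \<open>map\<close> over it and distinctness reduces to injectivity.\<close>

definition dpairs :: "'a list \<Rightarrow> ('a \<Rightarrow> 'b list) \<Rightarrow> ('a \<times> 'b) list" where
  "dpairs js ts = concat (map (\<lambda>j. map (Pair j) (ts j)) js)"

lemma set_dpairs: "set (dpairs js ts) = {(j, t). j \<in> set js \<and> t \<in> set (ts j)}"
  by (auto simp: dpairs_def)

lemma distinct_dpairs: "distinct js \<Longrightarrow> (\<And>j. distinct (ts j)) \<Longrightarrow> distinct (dpairs js ts)"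
  by (induction js) (auto simp: dpairs_def distinct_map inj_on_def)

lemma map_dpairs: "map (\<lambda>(j, t). h j t) (dpairs js ts) = concat (map (\<lambda>j. map (h j) (ts j)) js)"
  by (induction js) (auto simp: dpairs_def)

lemma map_filter_dpairs:
  "map (\<lambda>(j, t). h j t) (filter (\<lambda>(j, t). P j t) (dpairs js ts)) =
    concat (map (\<lambda>j. concat (map (\<lambda>t. if P j t then [h j t] else []) (ts j))) js)"
proof -
  have "map (\<lambda>(j, t). h j t) (filter (\<lambda>(j, t). P j t) (map (Pair j) ys)) =
      concat (map (\<lambda>t. if P j t then [h j t] else []) ys)" for j ys
    by (induction ys) auto
  then show ?thesis by (induction js) (auto simp: dpairs_def)
qed

text \<open>The exponents of the components of a normal form other than \<open>h\<close>, where \<open>X i\<close> and \<open>Y j\<close> are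
  the coordinates called \<open>x\<^sub>i\<close> and \<open>y\<^sub>j\<close>, and \<open>d = n - q\<close>.\<close>

definition normal_form_exponents ::
  "nat \<Rightarrow> nat \<Rightarrow> (nat \<Rightarrow> 'n) \<Rightarrow> (nat \<Rightarrow> 'n) \<Rightarrow> (nat \<Rightarrow> nat list) \<Rightarrow> (nat \<Rightarrow> nat \<Rightarrow> nat) \<Rightarrow>
    (nat \<Rightarrow> nat \<Rightarrow> nat) \<Rightarrow> ('n \<Rightarrow> nat) list" where
  "normal_form_exponents d q X Y m lam mu =
     map (\<lambda>i. single (X i) 1) [0..<d] @
     map (\<lambda>(j, e). single (Y j) e) (dpairs [0..<q] m) @
     map (\<lambda>(j, i). pair (X i) (lam i j) (Y j)) (dpairs [0..<q] (\<lambda>_. [0..<d])) @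
     map (\<lambda>(j, t). pair (Y j) (mu j t) (Y t))
       (filter (\<lambda>(j, t). t \<noteq> j \<and> \<not> (t < j \<and> mu j t = 1 \<and> mu t j = 1)) (dpairs [0..<q] (\<lambda>_. [0..<q])))"

text \<open>The second point w allows for a renaming of coordinates: a given normal form is read
  with w = z, while in its construction w is z permuted into the coordinates of f.\<close>

lemma blocks_eq_map_mon:
  fixes z w :: "complex^'n"
  assumes X: "\<And>i. i < CARD('n) - q \<Longrightarrow> xc src i z = w $ X i"
    and Y: "\<And>j. j < q \<Longrightarrow> yc src q j z = w $ Y j"
    and XY: "\<And>i j. i < CARD('n) - q \<Longrightarrow> j < q \<Longrightarrow> X i \<noteq> Y j"
    and YY: "\<And>j t. j < q \<Longrightarrow> t < q \<Longrightarrow> j \<noteq> t \<Longrightarrow> Y j \<noteq> Y t"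
  shows "x_block src q z @ phi_block src q m z @ xy_block src q lam z @ yy_block src q mu z =
    map (\<lambda>a. mon a w) (normal_form_exponents (CARD('n) - q) q X Y m lam mu)"
proof -
  let ?d = "CARD('n) - q"
  let ?P = "\<lambda>j t. t \<noteq> j \<and> \<not> (t < j \<and> mu j t = 1 \<and> mu t j = 1)"
  have 1: "x_block src q z = map (\<lambda>a. mon a w) (map (\<lambda>i. single (X i) 1) [0..<?d])"
    unfolding x_block_def by (simp add: mon_single X)
  have "phi_block src q m z = map (\<lambda>(j, e). yc src q j z ^ e) (dpairs [0..<q] m)"
    unfolding phi_block_def map_dpairs ..
  also have "\<dots> = map (\<lambda>a. mon a w) (map (\<lambda>(j, e). single (Y j) e) (dpairs [0..<q] m))"
    by (auto simp: set_dpairs mon_single Y)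
  finally have 2: "phi_block src q m z = map (\<lambda>a. mon a w) (map (\<lambda>(j, e). single (Y j) e) (dpairs [0..<q] m))" .
  have "xy_block src q lam z = map (\<lambda>(j, i). xc src i z ^ lam i j * yc src q j z) (dpairs [0..<q] (\<lambda>_. [0..<?d]))"
    unfolding xy_block_def map_dpairs ..
  also have "\<dots> = map (\<lambda>a. mon a w) (map (\<lambda>(j, i). pair (X i) (lam i j) (Y j)) (dpairs [0..<q] (\<lambda>_. [0..<?d])))"
    by (auto simp: set_dpairs mon_pair XY X Y)
  finally have 3: "xy_block src q lam z =
    map (\<lambda>a. mon a w) (map (\<lambda>(j, i). pair (X i) (lam i j) (Y j)) (dpairs [0..<q] (\<lambda>_. [0..<?d])))" .
  have "yy_block src q mu z = map (\<lambda>(j, t). yc src q j z ^ mu j t * yc src q t z)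
      (filter (\<lambda>(j, t). ?P j t) (dpairs [0..<q] (\<lambda>_. [0..<q])))"
    unfolding yy_block_def map_filter_dpairs ..
  also have "\<dots> = map (\<lambda>a. mon a w) (map (\<lambda>(j, t). pair (Y j) (mu j t) (Y t))
      (filter (\<lambda>(j, t). ?P j t) (dpairs [0..<q] (\<lambda>_. [0..<q]))))"
    unfolding map_map
  proof (rule map_cong[OF refl])
    fix p assume "p \<in> set (filter (\<lambda>(j, t). ?P j t) (dpairs [0..<q] (\<lambda>_. [0..<q])))"
    then obtain j t where p: "p = (j, t)" "j < q" "t < q" "t \<noteq> j" by (auto simp: set_dpairs)
    then show "(case p of (j, t) \<Rightarrow> yc src q j z ^ mu j t * yc src q t z) =
        ((\<lambda>a. mon a w) \<circ> (\<lambda>(j, t). pair (Y j) (mu j t) (Y t))) p"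
      using YY[of j t] by (simp add: mon_pair Y)
  qed
  finally have 4: "yy_block src q mu z = map (\<lambda>a. mon a w) (map (\<lambda>(j, t). pair (Y j) (mu j t) (Y t))
      (filter (\<lambda>(j, t). ?P j t) (dpairs [0..<q] (\<lambda>_. [0..<q]))))" .
  show ?thesis unfolding 1 2 3 4 normal_form_exponents_def by simp
qed

lemma pair_0: "i \<noteq> j \<Longrightarrow> pair i 0 j = single j 1"
  by (auto simp: pair_def single_def)

lemma pair_1_commute: "pair i 1 j = pair j 1 i"
  by (auto simp: pair_def)

lemma single_eq_iff: "e \<noteq> 0 \<Longrightarrow> single i e = single j e' \<longleftrightarrow> i = j \<and> e = e'"
  unfolding single_def fun_eq_iff by (metis (full_types))

lemma single_neq_pair: "i \<noteq> j \<Longrightarrow> l \<noteq> 0 \<Longrightarrow> single k e \<noteq> pair i l j"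
  unfolding single_def pair_def fun_eq_iff by (metis zero_neq_one)

text \<open>Distinctness is what allows the listed monomials to be matched with distinct components
  of f, so that the target dimension suffices. The only possible coincidence is y_j y_t = y_t y_j
  with both exponents 1, and the filter keeps just one of the two.\<close>

lemma distinct_normal_form_exponents:
  assumes X: "inj_on X {..<d}" and Y: "inj_on Y {..<q}"
    and XY: "\<And>i j. i < d \<Longrightarrow> j < q \<Longrightarrow> X i \<noteq> Y j"
    and m: "\<And>j. distinct (m j)" "\<And>j e. j < q \<Longrightarrow> e \<in> set (m j) \<Longrightarrow> e \<noteq> 0"
    and lam: "\<And>i j. i < d \<Longrightarrow> j < q \<Longrightarrow> lam i j \<noteq> 0"
    and mu: "\<And>j t. j < q \<Longrightarrow> t < q \<Longrightarrow> t \<noteq> j \<Longrightarrow> mu j t \<noteq> 0"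
  shows "distinct (normal_form_exponents d q X Y m lam mu)"
proof -
  let ?P = "\<lambda>j t. t \<noteq> j \<and> \<not> (t < j \<and> mu j t = 1 \<and> mu t j = 1)"
  let ?L1 = "map (\<lambda>i. single (X i) 1) [0..<d]"
  let ?L2 = "map (\<lambda>(j, e). single (Y j) e) (dpairs [0..<q] m)"
  let ?L3 = "map (\<lambda>(j, i). pair (X i) (lam i j) (Y j)) (dpairs [0..<q] (\<lambda>_. [0..<d]))"
  let ?L4 = "map (\<lambda>(j, t). pair (Y j) (mu j t) (Y t)) (filter (\<lambda>(j, t). ?P j t) (dpairs [0..<q] (\<lambda>_. [0..<q])))"
  have Yeq: "Y j = Y t \<longleftrightarrow> j = t" if "j < q" "t < q" for j t using Y that by (auto simp: inj_on_def)
  have Xeq: "X j = X t \<longleftrightarrow> j = t" if "j < d" "t < d" for j t using X that by (auto simp: inj_on_def)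
  have 1: "distinct ?L1"
    unfolding distinct_map
  proof (intro conjI inj_onI)
    fix i i' assume "i \<in> set [0..<d]" "i' \<in> set [0..<d]" "single (X i) 1 = single (X i') 1"
    then show "i = i'" using Xeq by (simp add: single_eq_iff)
  qed simp
  have 2: "distinct ?L2"
    unfolding distinct_map
  proof (intro conjI inj_onI)
    fix p p' assume p: "p \<in> set (dpairs [0..<q] m)" "p' \<in> set (dpairs [0..<q] m)"
      and eq: "(case p of (j, e) \<Rightarrow> single (Y j) e) = (case p' of (j, e) \<Rightarrow> single (Y j) e)"
    obtain j e j' e' where pp: "p = (j, e)" "p' = (j', e')" by (cases p, cases p') blast
    have b: "j < q" "j' < q" "e \<in> set (m j)" using p pp by (auto simp: set_dpairs)
    show "p = p'" using eq m(2)[OF b(1,3)] Yeq[OF b(1,2)] unfolding pp by (simp add: single_eq_iff)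
  qed (simp add: distinct_dpairs m)
  have 3: "distinct ?L3"
    unfolding distinct_map
  proof (intro conjI inj_onI)
    fix p p' assume p: "p \<in> set (dpairs [0..<q] (\<lambda>_. [0..<d]))" "p' \<in> set (dpairs [0..<q] (\<lambda>_. [0..<d]))"
      and eq: "(case p of (j, i) \<Rightarrow> pair (X i) (lam i j) (Y j)) = (case p' of (j, i) \<Rightarrow> pair (X i) (lam i j) (Y j))"
    obtain j i j' i' where pp: "p = (j, i)" "p' = (j', i')" by (cases p, cases p') blast
    have b: "j < q" "j' < q" "i < d" "i' < d" using p pp by (auto simp: set_dpairs)
    have eq': "pair (X i) (lam i j) (Y j) = pair (X i') (lam i' j') (Y j')" using eq pp by simp
    have "1 = (if Y j = Y j' then 1 else if Y j = X i' then lam i' j' else 0)"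
      using fun_cong[OF eq', of "Y j"] by (simp add: pair_def)
    then have "j = j'" using XY[OF b(4,1)] Yeq[OF b(1,2)] by (metis zero_neq_one)
    have "lam i j = (if X i = Y j' then 1 else if X i = X i' then lam i' j' else 0)"
      using fun_cong[OF eq', of "X i"] XY[OF b(3,1)] by (simp add: pair_def)
    then have "i = i'" using XY[OF b(3,2)] Xeq[OF b(3,4)] lam[OF b(3,1)] by metis
    with \<open>j = j'\<close> show "p = p'" unfolding pp by simp
  qed (simp add: distinct_dpairs)
  have 4: "distinct ?L4"
    unfolding distinct_map
  proof (intro conjI inj_onI)
    fix p p' assume p: "p \<in> set (filter (\<lambda>(j, t). ?P j t) (dpairs [0..<q] (\<lambda>_. [0..<q])))"
        "p' \<in> set (filter (\<lambda>(j, t). ?P j t) (dpairs [0..<q] (\<lambda>_. [0..<q])))"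
      and eq: "(case p of (j, t) \<Rightarrow> pair (Y j) (mu j t) (Y t)) = (case p' of (j, t) \<Rightarrow> pair (Y j) (mu j t) (Y t))"
    obtain j t j' t' where pp: "p = (j, t)" "p' = (j', t')" by (cases p, cases p') blast
    have b: "j < q" "t < q" "j' < q" "t' < q" "?P j t" "?P j' t'" using p pp by (auto simp: set_dpairs)
    have eq': "pair (Y j) (mu j t) (Y t) = pair (Y j') (mu j' t') (Y t')" using eq pp by simp
    note Ys = Yeq[OF b(1,3)] Yeq[OF b(1,4)] Yeq[OF b(2,3)] Yeq[OF b(2,4)] Yeq[OF b(1,2)] Yeq[OF b(3,4)]
    have tj: "t \<noteq> j" and nz: "mu j t \<noteq> 0" using mu[OF b(1,2)] b(5) by blast+
    have "1 = (if Y t = Y t' then 1 else if Y t = Y j' then mu j' t' else 0)"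
      using fun_cong[OF eq', of "Y t"] by (simp add: pair_def)
    then have at_t: "t = t' \<or> (t = j' \<and> mu j' t' = 1)"
      unfolding Ys by (cases "t = t'"; cases "t = j'") simp_all
    have "mu j t = (if Y j = Y t' then 1 else if Y j = Y j' then mu j' t' else 0)"
      using fun_cong[OF eq', of "Y j"] Ys(5) tj by (simp add: pair_def)
    then have at_j: "(j = t' \<and> mu j t = 1) \<or> j = j'"
      unfolding Ys using nz by (cases "j = t'"; cases "j = j'") simp_all
    have "j = j' \<and> t = t'"
    proof (cases "t = t'")
      case True
      then show ?thesis using at_j tj by blast
    next
      case False
      then have 1: "t = j'" "mu j' t' = 1" using at_t by blast+
      then have 2: "j = t'" "mu j t = 1" using at_j tj by blast+
      have 3: "mu t j = 1" using 1 2(1) by simp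
      have "\<not> t < j" using b(5) 2(2) 3 by blast
      moreover have "\<not> j < t" using b(6) 3 2 1(1) by blast
      ultimately show ?thesis using tj by simp
    qed
    then show "p = p'" unfolding pp by simp
  qed (simp add: distinct_dpairs)
  have 12: "set ?L1 \<inter> set ?L2 = {}"
  proof -
    have "single (X i) 1 \<noteq> single (Y j) e" if "i < d" "j < q" for i j e
      using XY[OF that] by (simp add: single_eq_iff)
    then show ?thesis by (auto simp: set_dpairs)
  qed
  have pure: "a \<in> set ?L1 \<union> set ?L2 \<Longrightarrow> \<exists>i e. a = single i e" for a by auto
  have L3: "\<exists>i j l. i < d \<and> j < q \<and> l \<noteq> 0 \<and> a = pair (X i) l (Y j)" if "a \<in> set ?L3" for a
  proof -
    from that obtain j i where "j < q" "i < d" "a = pair (X i) (lam i j) (Y j)"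
      by (auto simp: set_dpairs)
    then show ?thesis using lam by blast
  qed
  have L4: "\<exists>j t l. j < q \<and> t < q \<and> j \<noteq> t \<and> l \<noteq> 0 \<and> a = pair (Y j) l (Y t)" if "a \<in> set ?L4" for a
  proof -
    from that obtain j t where "j < q" "t < q" "t \<noteq> j" "a = pair (Y j) (mu j t) (Y t)"
      by (auto simp: set_dpairs)
    then show ?thesis using mu by blast
  qed
  have d3: "(set ?L1 \<union> set ?L2) \<inter> set ?L3 = {}"
  proof (rule ccontr)
    assume "\<not> ?thesis"
    then obtain a where a: "a \<in> set ?L1 \<union> set ?L2" "a \<in> set ?L3" by blast
    obtain i e where 1: "a = single i e" using pure[OF a(1)] by blast
    obtain i' j l where 2: "i' < d" "j < q" "l \<noteq> 0" "a = pair (X i') l (Y j)" using L3[OF a(2)] by blast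
    show False using single_neq_pair[OF XY[OF 2(1,2)] 2(3), of i e] 1 2(4) by simp
  qed
  have d4: "(set ?L1 \<union> set ?L2) \<inter> set ?L4 = {}"
  proof (rule ccontr)
    assume "\<not> ?thesis"
    then obtain a where a: "a \<in> set ?L1 \<union> set ?L2" "a \<in> set ?L4" by blast
    obtain i e where 1: "a = single i e" using pure[OF a(1)] by blast
    obtain j t l where 2: "j < q" "t < q" "j \<noteq> t" "l \<noteq> 0" "a = pair (Y j) l (Y t)" using L4[OF a(2)] by blast
    have "Y j \<noteq> Y t" using Yeq[OF 2(1,2)] 2(3) by simp
    then show False using single_neq_pair[OF _ 2(4), of "Y j" "Y t" i e] 1 2(5) by simp
  qed
  have 34: "set ?L3 \<inter> set ?L4 = {}"
  proof (rule ccontr)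
    assume "\<not> ?thesis"
    then obtain a where a: "a \<in> set ?L3" "a \<in> set ?L4" by blast
    obtain i j l where 1: "i < d" "j < q" "l \<noteq> 0" "a = pair (X i) l (Y j)" using L3[OF a(1)] by blast
    obtain j' t l' where 2: "j' < q" "t < q" "j' \<noteq> t" "l' \<noteq> 0" "a = pair (Y j') l' (Y t)" using L4[OF a(2)] by blast
    have "a (X i) = l" using 1(4) XY[OF 1(1,2)] by (simp add: pair_def)
    moreover have "a (X i) = 0" using 2(5) XY[OF 1(1) 2(1)] XY[OF 1(1) 2(2)] by (simp add: pair_def)
    ultimately show False using 1(3) by simp
  qed
  have "distinct (a @ b @ c @ e)"
    if "distinct a" "distinct b" "distinct c" "distinct e" "set a \<inter> set b = {}"
      "(set a \<union> set b) \<inter> set c = {}" "(set a \<union> set b) \<inter> set e = {}" "set c \<inter> set e = {}"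
    for a b c e :: "('a \<Rightarrow> nat) list"
    using that by auto
  from this[OF 1 2 3 4 12 d3 d4 34] show ?thesis unfolding normal_form_exponents_def .
qed

section \<open>Coordinate changes used for normal forms\<close>

lemma map_germ_permute: "map_germ (\<lambda>z :: complex^'n. \<chi> j. z $ \<tau> j)"
  unfolding map_germ_def complex_differentiable_at_iff by (simp add: vec_eq_iff)

lemma inverse_germs_permute:
  fixes \<tau> :: "'n::finite \<Rightarrow> 'n"
  assumes "bij \<tau>"
  shows "inverse_germs (\<lambda>z :: complex^'n. \<chi> j. z $ inv \<tau> j) (\<lambda>z. \<chi> j. z $ \<tau> j)"
  unfolding inverse_germs_def using assms
  by (simp add: map_germ_permute bij_is_surj bij_is_inj surj_f_inv_f inv_f_f)

lemma inverse_germs_compose: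
  assumes "inverse_germs \<psi> \<psi>'" "inverse_germs \<phi> \<phi>'"
  shows "inverse_germs (\<lambda>w. \<phi> (\<psi> w)) (\<lambda>w. \<psi>' (\<phi>' w))"
proof -
  have mg: "map_germ (\<lambda>w. b (a w))" if ab: "map_germ a" "map_germ b" for a b :: "complex^'a \<Rightarrow> complex^'a"
  proof -
    have "\<forall>\<^sub>F z in nhds 0. complex_differentiable_at b (a z)"
      using map_germ_filterlim[OF ab(1)] ab(2) unfolding filterlim_iff map_germ_def by blast
    moreover have "\<forall>\<^sub>F z in nhds 0. complex_differentiable_at a z" using ab unfolding map_germ_def by blast
    ultimately have "\<forall>\<^sub>F z in nhds 0. complex_differentiable_at (\<lambda>w. b (a w)) z"
      by eventually_elim (rule complex_differentiable_at_compose)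
    then show ?thesis using ab unfolding map_germ_def by simp
  qed
  have inv: "\<forall>\<^sub>F z in nhds 0. a' (b' (b (a z))) = z"
    if "map_germ a" "\<forall>\<^sub>F z in nhds 0. a' (a z) = z" "\<forall>\<^sub>F z in nhds 0. b' (b z) = z"
    for a a' b b' :: "complex^'a \<Rightarrow> complex^'a"
  proof -
    have "\<forall>\<^sub>F z in nhds 0. b' (b (a z)) = a z"
      using map_germ_filterlim[OF that(1)] that(3) unfolding filterlim_iff by blast
    with that(2) show ?thesis by eventually_elim simp
  qed
  have 1: "map_germ \<psi>" "map_germ \<psi>'" "\<forall>\<^sub>F z in nhds 0. \<psi>' (\<psi> z) = z" "\<forall>\<^sub>F z in nhds 0. \<psi> (\<psi>' z) = z"
    and 2: "map_germ \<phi>" "map_germ \<phi>'" "\<forall>\<^sub>F z in nhds 0. \<phi>' (\<phi> z) = z" "\<forall>\<^sub>F z in nhds 0. \<phi> (\<phi>' z) = z"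
    using assms unfolding inverse_germs_def by blast+
  show ?thesis unfolding inverse_germs_def
    using mg[OF 1(1) 2(1)] mg[OF 2(2) 1(2)]
      inv[where a = \<psi> and a' = \<psi>' and b = \<phi> and b' = \<phi>', OF 1(1,3) 2(3)]
      inv[where a = \<phi>' and a' = \<phi> and b = \<psi>' and b' = \<psi>, OF 2(2,4) 1(4)] by (intro conjI)
qed

text \<open>Components in \<open>T\<close> are altered by powers of components outside
  \<open>T\<close>, which stay fixed; so the inverse differs only by the sign. Positive exponents
  keep 0 fixed.\<close>

lemma inverse_germs_shear:
  fixes k0 :: "'p::finite \<Rightarrow> 'p"
  assumes "\<And>k. k \<in> T \<Longrightarrow> k0 k \<notin> T" "\<And>k. k \<in> T \<Longrightarrow> ex k \<noteq> 0"
  shows "inverse_germs (\<lambda>w :: complex^'p. \<chi> k. if k \<in> T then w $ k - w $ k0 k ^ ex k else w $ k)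
    (\<lambda>w. \<chi> k. if k \<in> T then w $ k + w $ k0 k ^ ex k else w $ k)"
proof -
  have "map_germ (\<lambda>w :: complex^'p. \<chi> k. if k \<in> T then w $ k - w $ k0 k ^ ex k else w $ k)"
    unfolding map_germ_def complex_differentiable_at_iff
  proof (intro conjI always_eventually allI)
    fix z :: "complex^'p" and k
    show "holomorphic_at (\<lambda>w. (\<chi> k. if k \<in> T then w $ k - w $ k0 k ^ ex k else w $ k) $ k) z"
      using holomorphic_at_diff[OF holomorphic_at_nth holomorphic_at_power[OF holomorphic_at_nth]] by (cases "k \<in> T") simp_all
  qed (use assms(2) in \<open>simp add: vec_eq_iff zero_power\<close>)
  moreover have "map_germ (\<lambda>w :: complex^'p. \<chi> k. if k \<in> T then w $ k + w $ k0 k ^ ex k else w $ k)"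
    unfolding map_germ_def complex_differentiable_at_iff
  proof (intro conjI always_eventually allI)
    fix z :: "complex^'p" and k
    show "holomorphic_at (\<lambda>w. (\<chi> k. if k \<in> T then w $ k + w $ k0 k ^ ex k else w $ k) $ k) z"
      using holomorphic_at_add[OF holomorphic_at_nth holomorphic_at_power[OF holomorphic_at_nth]] by (cases "k \<in> T") simp_all
  qed (use assms(2) in \<open>simp add: vec_eq_iff zero_power\<close>)
  ultimately show ?thesis unfolding inverse_germs_def using assms(1) by (simp add: vec_eq_iff)
qed

section \<open>Corank, and the passage between exponents and normal forms\<close>

lemma dmon_complex_linear: "dmon a z (c *s v) = c * dmon a z v"
  unfolding dmon_def sum_distrib_left by (intro sum.cong) auto

text \<open>At 0 only a monomial of degree 1 has a nonzero derivative, so each row is zero or a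
  standard basis vector. Repeated components repeat rows, hence the count is over coordinates and
  not over components.\<close>

lemma rank_jacobian_monomial:
  fixes f :: "complex^'n \<Rightarrow> complex^'p"
  assumes e: "e > 0" and nz: "\<And>k. k \<in> K \<Longrightarrow> A k \<noteq> (\<lambda>_. 0)"
    and fz: "\<And>z k. norm z < e \<Longrightarrow> f z $ k = (if k \<in> K then mon (A k) z else 0)"
  shows "rank (jacobian_at_0 f) = card {j. single j 1 \<in> A ` K}"
proof -
  let ?Lin = "{j. single j 1 \<in> A ` K}"
  let ?B = "(\<lambda>j. axis j (1 :: complex)) ` ?Lin"
  let ?J = "jacobian_at_0 f"
  have J: "?J $ k $ j = (if k \<in> K \<and> A k = single j 1 then 1 else 0)" for k j
  proof -
    have "\<forall>\<^sub>F z in nhds (0 :: complex^'n). norm z < e" using e by (rule eventually_norm_less)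
    then have ev: "\<forall>\<^sub>F z in nhds 0. f z $ k = (if k \<in> K then mon (A k) z else 0)"
      by eventually_elim (rule fz)
    have "?J $ k $ j = partial j (\<lambda>z. if k \<in> K then mon (A k) z else 0) 0"
      unfolding jacobian_at_0_def using eventually_nhds_x_imp_x[OF eventually_partial_cong[OF ev]] by simp
    also have "\<dots> = (if k \<in> K \<and> A k = single j 1 then 1 else 0)"
    proof (cases "k \<in> K")
      case True
      have "partial j (mon (A k)) 0 = dmon (A k) 0 (axis j 1)"
        by (rule partial_eq_derivative[OF has_derivative_mon dmon_complex_linear])
      also have "\<dots> = (if A k = single j 1 then 1 else 0)"
      proof (cases "A k = single j 1")
        case True
        then show ?thesis by (simp add: dmon_single)
      next
        case False
        have "A k j \<noteq> 1 \<or> (\<exists>m. m \<noteq> j \<and> A k m \<noteq> 0)"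
        proof (rule ccontr)
          assume "\<not> ?thesis"
          then have "A k = single j 1" by (auto simp: single_def fun_eq_iff)
          then show False using False by blast
        qed
        then have "dmon (A k) 0 (axis j 1) = 0"
        proof (elim disjE exE conjE)
          assume "A k j \<noteq> 1"
          then have "of_nat (A k j) * (0 :: complex) ^ (A k j - 1) = 0" by (cases "A k j") auto
          then show ?thesis unfolding dmon_axis by simp
        next
          fix m assume m: "m \<noteq> j" "A k m \<noteq> 0"
          have "(\<Prod>m\<in>UNIV - {j}. (0 :: complex^'n) $ m ^ A k m) = 0"
            by (rule prod_zero) (use m in \<open>auto intro!: bexI[of _ m]\<close>)
          then show ?thesis unfolding dmon_axis by simp
        qed
        then show ?thesis using False by simp
      qed
      finally show ?thesis using True by simp
    qed (simp add: partial_def)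
    finally show ?thesis .
  qed
  have row_lin: "row k ?J = axis j 1" if "k \<in> K" "A k = single j 1" for k j
    unfolding row_def vec_eq_iff using that by (auto simp: J axis_def single_eq_iff)
  have row_0: "row k ?J = 0" if "\<not> (\<exists>j. k \<in> K \<and> A k = single j 1)" for k
    unfolding row_def vec_eq_iff using that by (auto simp: J)
  have "rows ?J \<subseteq> insert 0 ?B"
  proof
    fix v assume "v \<in> rows ?J"
    then obtain k where k: "v = row k ?J" unfolding rows_def by blast
    show "v \<in> insert 0 ?B"
    proof (cases "\<exists>j. k \<in> K \<and> A k = single j 1")
      case True
      then obtain j where j: "k \<in> K" "A k = single j 1" by blast
      then have "j \<in> ?Lin" using imageI[of k K A] by simp
      then show ?thesis using row_lin[OF j] k by blast
    qed (use row_0 k in blast)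
  qed
  then have "vec.span (rows ?J) \<subseteq> vec.span ?B"
    using vec.span_mono[of "rows ?J" "insert 0 ?B"] unfolding vec.span_insert_0 by blast
  moreover have "?B \<subseteq> rows ?J"
  proof
    fix v assume "v \<in> ?B"
    then obtain j k where "v = axis j 1" "k \<in> K" "A k = single j 1" by (auto simp: image_iff)
    then have "v = row k ?J" using row_lin by simp
    then show "v \<in> rows ?J" unfolding rows_def by blast
  qed
  then have "vec.span ?B \<subseteq> vec.span (rows ?J)" by (rule vec.span_mono)
  ultimately have "vec.span (rows ?J) = vec.span ?B" by blast
  then have "vec.dim (rows ?J) = vec.dim ?B" by (metis vec.dim_span)
  also have "\<dots> = card ?B"
  proof (rule vec.dim_eq_card_independent)
    have "?B \<subseteq> cart_basis" unfolding cart_basis_def by blast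
    then show "vec.independent ?B" using independent_cart_basis vec.independent_mono by blast
  qed
  also have "\<dots> = card ?Lin"
    by (intro card_image inj_onI) (simp add: axis_eq_axis)
  finally show ?thesis unfolding row_rank_def_gen .
qed

text \<open>For a coordinate x_i the component x_i settles both conditions, the second with exponent
  l = 0. For y_j the primitive curve gives the Gcd, and the blocks of \<open>H_map\<close> other
  than h give the mixed monomials.\<close>

lemma normal_form_imp_axis_conditions:
  fixes g :: "complex^'n \<Rightarrow> complex^'p" and src :: "nat \<Rightarrow> 'n" and tgt :: "nat \<Rightarrow> 'p"
  assumes src: "bij_betw src {..<CARD('n)} UNIV" and q: "q \<le> CARD('n)"
    and g: "normal_form src tgt q g"
  shows "axis_conditions (germ_exponents g)"
proof -
  obtain m lam mu hs where data: "normal_form_data q m lam mu hs"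
    and comps: "has_components tgt g (\<lambda>z. x_block src q z @ phi_block src q m z @ H_map src q lam mu hs z)"
    using g unfolding normal_form_def by blast
  let ?d = "CARD('n) - q"
  define X where "X i = src i" for i
  define Y where "Y j = src (?d + j)" for j
  let ?EL = "normal_form_exponents ?d q X Y m lam mu"
  have src_inj: "src i = src j \<longleftrightarrow> i = j" if "i < CARD('n)" "j < CARD('n)" for i j
    using src that unfolding bij_betw_def inj_on_def by blast
  have XY: "X i \<noteq> Y j" if "i < ?d" "j < q" for i j
    using src_inj[of i "?d + j"] that unfolding X_def Y_def by simp
  have YY: "Y j \<noteq> Y t" if "j < q" "t < q" "j \<noteq> t" for j t
    using src_inj[of "?d + j" "?d + t"] that q unfolding Y_def by simp
  have blocks: "x_block src q z @ phi_block src q m z @ xy_block src q lam z @ yy_block src q mu z =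
      map (\<lambda>a. mon a z) ?EL" for z :: "complex^'n"
    by (rule blocks_eq_map_mon) (use XY YY in \<open>simp_all add: xc_def yc_def X_def Y_def\<close>)
  have L: "x_block src q z @ phi_block src q m z @ H_map src q lam mu hs z = map (\<lambda>a. mon a z) ?EL @ map (\<lambda>c. c z) hs" for z
    using blocks[of z] unfolding H_map_def by simp
  have mem: "a \<in> germ_exponents g" if a: "a \<in> set ?EL" for a
  proof -
    obtain k where k: "k < length ?EL" "a = ?EL ! k" using a by (metis in_set_conv_nth)
    have "g z $ tgt k = mon a z" for z
    proof -
      have len: "length (map (\<lambda>a. mon a z) ?EL @ map (\<lambda>c. c z) hs) = CARD('p)"
        and nth: "\<And>k. k < CARD('p) \<Longrightarrow> g z $ tgt k = (map (\<lambda>a. mon a z) ?EL @ map (\<lambda>c. c z) hs) ! k"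
        using comps unfolding has_components_def L by blast+
      have "k < CARD('p)" using len k(1) by simp
      then show ?thesis using nth[of k] k by (simp add: nth_append)
    qed
    then show ?thesis unfolding germ_exponents_def by (intro CollectI exI[of _ "tgt k"]) simp
  qed
  have memX: "single (X i) 1 \<in> germ_exponents g" if "i < ?d" for i
    using that by (intro mem) (auto simp: normal_form_exponents_def)
  have memY: "single (Y j) e \<in> germ_exponents g" if "j < q" "e \<in> set (m j)" for j e
  proof (rule mem)
    have p: "(j, e) \<in> set (dpairs [0..<q] m)" using that by (simp add: set_dpairs)
    show "single (Y j) e \<in> set ?EL" unfolding normal_form_exponents_def set_append set_map
      by (rule UnI2, rule UnI1, rule image_eqI[OF _ p]) simp
  qed
  have memXY: "pair (X i) (lam i j) (Y j) \<in> germ_exponents g" if "i < ?d" "j < q" for i j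
  proof (rule mem)
    have p: "(j, i) \<in> set (dpairs [0..<q] (\<lambda>_. [0..<?d]))" using that by (simp add: set_dpairs)
    show "pair (X i) (lam i j) (Y j) \<in> set ?EL" unfolding normal_form_exponents_def set_append set_map
      by (rule UnI2, rule UnI2, rule UnI1, rule image_eqI[OF _ p]) simp
  qed
  have memYY: "pair (Y j) (mu j t) (Y t) \<in> germ_exponents g"
    if "j < q" "t < q" "t \<noteq> j" "\<not> (t < j \<and> mu j t = 1 \<and> mu t j = 1)" for j t
  proof (rule mem)
    let ?F = "filter (\<lambda>(j, t). t \<noteq> j \<and> \<not> (t < j \<and> mu j t = 1 \<and> mu t j = 1)) (dpairs [0..<q] (\<lambda>_. [0..<q]))"
    have p: "(j, t) \<in> set ?F" using that by (simp add: set_dpairs)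
    show "pair (Y j) (mu j t) (Y t) \<in> set ?EL" unfolding normal_form_exponents_def set_append set_map
      by (rule UnI2, rule UnI2, rule UnI2, rule image_eqI[OF _ p]) simp
  qed
  have coord: "(\<exists>i<?d. c = X i) \<or> (\<exists>j<q. c = Y j)" for c
  proof -
    have "c \<in> src ` {..<CARD('n)}" using src unfolding bij_betw_def by simp
    then obtain i where i: "i < CARD('n)" "c = src i" by auto
    show ?thesis
    proof (cases "i < ?d")
      case True
      then show ?thesis using i unfolding X_def by blast
    next
      case False
      then have "i - ?d < q" "?d + (i - ?d) = i" using i(1) q by simp_all
      then show ?thesis using i(2) unfolding Y_def by metis
    qed
  qed
  show ?thesis
    unfolding axis_conditions_def
  proof (intro allI)
    fix c :: 'n
    show "Gcd {e. single c e \<in> germ_exponents g} = 1 \<and> (\<forall>i. i \<noteq> c \<longrightarrow> (\<exists>l. pair i l c \<in> germ_exponents g))"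
      using coord[of c]
    proof (elim disjE exE conjE)
      fix i assume i: "i < ?d" "c = X i"
      have "1 \<in> {e. single c e \<in> germ_exponents g}" using memX[OF i(1)] i(2) by simp
      then have "Gcd {e. single c e \<in> germ_exponents g} dvd 1" by (rule Gcd_dvd)
      moreover have "\<exists>l. pair k l c \<in> germ_exponents g" if "k \<noteq> c" for k
        using memX[OF i(1)] pair_0[OF that] i(2) by metis
      ultimately show ?thesis by simp
    next
      fix j assume j: "j < q" "c = Y j"
      have "Gcd {e. single c e \<in> germ_exponents g} dvd Gcd (set (m j))"
      proof (rule Gcd_greatest)
        fix e assume "e \<in> set (m j)"
        then have "e \<in> {e. single c e \<in> germ_exponents g}" using memY[OF j(1)] j(2) by simp
        then show "Gcd {e. single c e \<in> germ_exponents g} dvd e" by (rule Gcd_dvd)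
      qed
      moreover have "Gcd (set (m j)) = 1" using data j(1) unfolding normal_form_data_def primitive_def by blast
      ultimately have "Gcd {e. single c e \<in> germ_exponents g} = 1" by simp
      moreover have "\<exists>l. pair k l c \<in> germ_exponents g" if k: "k \<noteq> c" for k
        using coord[of k]
      proof (elim disjE exE conjE)
        fix i assume "i < ?d" "k = X i"
        then show ?thesis using memXY[OF _ j(1)] j(2) by blast
      next
        fix t assume t: "t < q" "k = Y t"
        have tj: "t \<noteq> j" using k t(2) j(2) by blast
        \<comment> \<open>The monomial needed may be the one dropped as a duplicate; then both
          exponents are 1, and it is found in the block of the smaller index with the roles of the
          two coordinates exchanged.\<close>
        show ?thesis
        proof (cases "j < t \<and> mu t j = 1 \<and> mu j t = 1")
          case False
          then have "pair (Y t) (mu t j) (Y j) \<in> germ_exponents g"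
            using tj by (intro memYY t(1) j(1)) auto
          then show ?thesis using t(2) j(2) by blast
        next
          case True
          then have "pair (Y j) (mu j t) (Y t) \<in> germ_exponents g"
            using tj by (intro memYY t(1) j(1)) auto
          then have "pair k 1 c \<in> germ_exponents g" using True t(2) j(2) pair_1_commute[of k c] by simp
          then show ?thesis by blast
        qed
      qed
      ultimately show ?thesis by blast
    qed
  qed
qed

text \<open>The exponents \<open>\<mu>\<^sub>j\<^sub>t\<close> are chosen minimal, so that \<open>\<mu>\<^sub>j\<^sub>t = 1\<close> iff \<open>\<mu>\<^sub>t\<^sub>j = 1\<close> and the listed components
  are pairwise distinct. The remaining powers of single coordinates are polynomials in the listed
  components and are removed by a shear of the target.\<close>

lemma axis_conditions_imp_normal_form:
  fixes f :: "complex^'n \<Rightarrow> complex^'p" and src :: "nat \<Rightarrow> 'n" and tgt :: "nat \<Rightarrow> 'p"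
  assumes src: "bij_betw src {..<CARD('n)} UNIV" and tgt: "bij_betw tgt {..<CARD('p)} UNIV"
    and f: "map_germ f" "monomial_germ f" and q: "corank f = q" and E: "axis_conditions (germ_exponents f)"
  shows "\<exists>g. normal_form src tgt q g \<and> A_equivalent f g"
proof -
  obtain K A e where e: "e > 0" and AK: "germ_exponents f = A ` K" and nz: "\<And>k. k \<in> K \<Longrightarrow> A k \<noteq> (\<lambda>_. 0)"
    and fz: "\<And>z k. norm z < e \<Longrightarrow> f z $ k = (if k \<in> K then mon (A k) z else 0)"
    using monomial_germ_representation[OF f] by metis
  define E where "E = A ` K"
  have finE: "finite E" by (simp add: E_def)
  have G: "Gcd {e. single j e \<in> E} = 1" for j
    using E unfolding axis_conditions_def AK E_def by blast
  have P: "\<exists>l. pair i l j \<in> E" if "i \<noteq> j" for i j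
    using E that unfolding axis_conditions_def AK E_def by blast
  have E0: "(\<lambda>_. 0) \<notin> E" using nz unfolding E_def by (metis imageE)
  \<comment> \<open>The coordinates that are themselves components of f. They become the x_i; by the
    rank computation there are n - q of them.\<close>
  define Lin where "Lin = {j. single j 1 \<in> E}"
  let ?n = "CARD('n)" and ?d = "CARD('n) - q"
  have rk: "rank (jacobian_at_0 f) = card Lin"
    unfolding Lin_def E_def by (rule rank_jacobian_monomial[OF e nz fz])
  have cardLin: "card Lin \<le> ?n" by (rule card_mono) auto
  have dL: "card Lin = ?d" "q \<le> ?n" using q rk cardLin unfolding corank_def by auto
  obtain xs where xs: "set xs = Lin" "distinct xs" using finite_distinct_list[of Lin] by auto
  obtain ys where ys: "set ys = - Lin" "distinct ys" using finite_distinct_list[of "- Lin"] by auto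
  have lxs: "length xs = ?d" using distinct_card[OF xs(2)] xs(1) dL by simp
  have lys: "length ys = q"
    using distinct_card[OF ys(2)] ys(1) dL by (simp add: Compl_eq_Diff_UNIV card_Diff_subset)
  define X where "X i = xs ! i" for i
  define Y where "Y j = ys ! j" for j
  define s where "s i = (xs @ ys) ! i" for i
  have s: "bij_betw s {..<?n} UNIV"
    unfolding s_def by (rule bij_betw_nth) (use xs ys lxs lys dL in auto)
  have sX: "s i = X i" if "i < ?d" for i using that lxs by (simp add: s_def X_def nth_append)
  have sY: "s (?d + j) = Y j" for j using lxs by (simp add: s_def Y_def nth_append)
  have XLin: "X i \<in> Lin" if "i < ?d" for i using that lxs xs(1) unfolding X_def by (metis nth_mem)
  have YLin: "Y j \<notin> Lin" if "j < q" for j using that lys ys(1) unfolding Y_def by (metis nth_mem ComplD)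
  have XY: "X i \<noteq> Y j" if "i < ?d" "j < q" for i j using XLin YLin that by metis
  have Xinj: "inj_on X {..<?d}" unfolding X_def inj_on_def using xs(2) lxs by (simp add: nth_eq_iff_index_eq)
  have Yinj: "inj_on Y {..<q}" unfolding Y_def inj_on_def using ys(2) lys by (simp add: nth_eq_iff_index_eq)
  have YY: "Y j \<noteq> Y t" if "j < q" "t < q" "j \<noteq> t" for j t using Yinj that unfolding inj_on_def by blast
  have Xsurj: "\<exists>i<?d. j = X i" if "j \<in> Lin" for j
    using that xs(1) lxs unfolding X_def by (metis in_set_conv_nth)
  have Ysurj: "\<exists>i<q. j = Y i" if "j \<notin> Lin" for j
    using that ys(1) lys unfolding Y_def by (metis in_set_conv_nth ComplI)
  \<comment> \<open>All pure powers of this coordinate that occur in f: the Gcd condition then says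
    exactly that the curve is primitive, and 1 does not occur because the coordinate is not in
    \<open>Lin\<close>.\<close>
  define m where "m j = sorted_list_of_set {e. single (Y j) e \<in> E}" for j
  have fin_m: "finite {e. single (Y j) e \<in> E}" for j
  proof (rule finite_subset)
    show "{e. single (Y j) e \<in> E} \<subseteq> (\<lambda>a. a (Y j)) ` E"
    proof
      fix e assume "e \<in> {e. single (Y j) e \<in> E}"
      then show "e \<in> (\<lambda>a. a (Y j)) ` E" by (intro image_eqI[of _ _ "single (Y j) e"]) (auto simp: single_def)
    qed
  qed (simp add: finE)
  have set_m: "set (m j) = {e. single (Y j) e \<in> E}" for j unfolding m_def using fin_m by simp
  have m1: "1 < e" if "j < q" "e \<in> set (m j)" for j e
  proof -
    have e: "single (Y j) e \<in> E" using that(2) set_m by simp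
    have "e \<noteq> 0"
    proof
      assume "e = 0"
      then have "single (Y j) e = (\<lambda>_. 0)" by (auto simp: single_def)
      then show False using e E0 by simp
    qed
    moreover have "e \<noteq> 1" using e YLin[OF that(1)] unfolding Lin_def by blast
    ultimately show ?thesis by simp
  qed
  define lam where "lam i j = (SOME l. pair (X i) l (Y j) \<in> E)" for i j
  have lam: "pair (X i) (lam i j) (Y j) \<in> E" "lam i j \<noteq> 0" if "i < ?d" "j < q" for i j
  proof -
    show l: "pair (X i) (lam i j) (Y j) \<in> E"
      unfolding lam_def by (rule someI_ex) (rule P[OF XY[OF that]])
    show "lam i j \<noteq> 0"
    proof
      assume "lam i j = 0"
      then have "single (Y j) 1 \<in> E" using l pair_0[OF XY[OF that]] by simp
      then show False using YLin[OF that(2)] unfolding Lin_def by blast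
    qed
  qed
  define mu where "mu j t = (LEAST l. pair (Y j) l (Y t) \<in> E)" for j t
  have mu: "pair (Y j) (mu j t) (Y t) \<in> E" "mu j t \<noteq> 0" if "j < q" "t < q" "t \<noteq> j" for j t
  proof -
    have ne: "Y j \<noteq> Y t" using YY[OF that(1,2)] that(3) by blast
    show l: "pair (Y j) (mu j t) (Y t) \<in> E"
      unfolding mu_def by (rule LeastI_ex) (rule P[OF ne])
    show "mu j t \<noteq> 0"
    proof
      assume "mu j t = 0"
      then have "single (Y t) 1 \<in> E" using l pair_0[OF ne] by simp
      then show False using YLin[OF that(2)] unfolding Lin_def by blast
    qed
  qed
  define EL where "EL = normal_form_exponents ?d q X Y m lam mu"
  have dEL: "distinct EL" unfolding EL_def
  proof (rule distinct_normal_form_exponents[OF Xinj Yinj XY])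
    show "distinct (m j)" for j unfolding m_def by simp
    show "e \<noteq> 0" if "j < q" "e \<in> set (m j)" for j e using m1[OF that] by simp
    show "lam i j \<noteq> 0" if "i < ?d" "j < q" for i j by (rule lam(2)[OF that])
    show "mu j t \<noteq> 0" if "j < q" "t < q" "t \<noteq> j" for j t by (rule mu(2)[OF that])
  qed
  have sEL: "set EL \<subseteq> E"
  proof
    fix a assume "a \<in> set EL"
    then show "a \<in> E"
      unfolding EL_def normal_form_exponents_def set_append set_map
    proof (elim UnE imageE)
      fix i assume "a = single (X i) 1" "i \<in> set [0..<?d]"
      then show "a \<in> E" using XLin[of i] unfolding Lin_def by simp
    next
      fix p assume "a = (case p of (j, e) \<Rightarrow> single (Y j) e)" "p \<in> set (dpairs [0..<q] m)"
      then show "a \<in> E" using set_m by (cases p) (simp add: set_dpairs)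
    next
      fix p assume "a = (case p of (j, i) \<Rightarrow> pair (X i) (lam i j) (Y j))" "p \<in> set (dpairs [0..<q] (\<lambda>_. [0..<?d]))"
      then show "a \<in> E" using lam(1) by (cases p) (simp add: set_dpairs)
    next
      fix p assume "a = (case p of (j, t) \<Rightarrow> pair (Y j) (mu j t) (Y t))"
        "p \<in> set (filter (\<lambda>(j, t). t \<noteq> j \<and> \<not> (t < j \<and> mu j t = 1 \<and> mu t j = 1)) (dpairs [0..<q] (\<lambda>_. [0..<q])))"
      then show "a \<in> E" using mu(1) by (cases p) (simp add: set_dpairs)
    qed
  qed
  have EL_X: "single (X i) 1 \<in> set EL" if "i < ?d" for i
    using that unfolding EL_def normal_form_exponents_def by auto
  have EL_Y: "single (Y j) e \<in> set EL" if "j < q" "single (Y j) e \<in> E" for j e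
  proof -
    have p: "(j, e) \<in> set (dpairs [0..<q] m)" using that set_m by (simp add: set_dpairs)
    show ?thesis unfolding EL_def normal_form_exponents_def set_append set_map
      by (rule UnI2, rule UnI1, rule image_eqI[OF _ p]) simp
  qed
  \<comment> \<open>Chooses one component of f for each exponent. The chosen components
    \<open>ks\<close> fill the explicit blocks; all others, namely repetitions, further mixed
    monomials and zeros, are left in \<open>rest\<close> for h.\<close>
  define \<kappa> where "\<kappa> a = (SOME k. k \<in> K \<and> A k = a)" for a
  have \<kappa>: "\<kappa> a \<in> K" "A (\<kappa> a) = a" if "a \<in> E" for a
  proof -
    have "\<exists>k. k \<in> K \<and> A k = a" using that unfolding E_def by blast
    from someI_ex[OF this] show "\<kappa> a \<in> K" "A (\<kappa> a) = a" unfolding \<kappa>_def by blast+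
  qed
  define ks where "ks = map \<kappa> EL"
  have dks: "distinct ks"
    unfolding ks_def distinct_map
  proof (intro conjI dEL inj_onI)
    fix a b assume "a \<in> set EL" "b \<in> set EL" "\<kappa> a = \<kappa> b"
    then show "a = b" using \<kappa>(2) sEL by (metis subsetD)
  qed
  obtain rest where rest: "set rest = - set ks" "distinct rest" using finite_distinct_list[of "- set ks"] by auto
  define al where "al = ks @ rest"
  have al: "distinct al" "set al = UNIV" unfolding al_def using dks rest by auto
  have lal: "length al = CARD('p)" using distinct_card[OF al(1)] al(2) by simp
  \<comment> \<open>The left-over pure powers would violate that h vanishes on the axes. Each is a
    power of a listed component: z_j^e of the listed z_j if j is in \<open>Lin\<close>, and
    otherwise a repetition of a listed z_j^e, with outer exponent 1.\<close>
  define T where "T = {k \<in> set rest. k \<in> K \<and> (\<exists>j e. A k = single j e)}"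
  have "\<exists>k0 ex. k \<in> T \<longrightarrow> k0 \<in> set ks \<and> k0 \<in> K \<and> ex \<noteq> 0 \<and> (\<forall>z. mon (A k) z = mon (A k0) z ^ ex)" for k
  proof (cases "k \<in> T")
    case True
    then obtain j e where k: "k \<in> K" "A k = single j e" unfolding T_def by blast
    have kE: "single j e \<in> E" using k unfolding E_def by (metis imageI)
    have e0: "e \<noteq> 0"
    proof
      assume "e = 0"
      then have "A k = (\<lambda>_. 0)" using k(2) by (auto simp: single_def)
      then show False using nz[OF k(1)] by blast
    qed
    show ?thesis
    proof (cases "j \<in> Lin")
      case True
      then obtain i where i: "i < ?d" "j = X i" using Xsurj by blast
      have "single j 1 \<in> set EL" using EL_X[OF i(1)] i(2) by simp
      then have "\<kappa> (single j 1) \<in> set ks" "\<kappa> (single j 1) \<in> K" "A (\<kappa> (single j 1)) = single j 1"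
        using \<kappa> sEL unfolding ks_def by auto
      then show ?thesis using e0 k(2) by (intro exI[of _ "\<kappa> (single j 1)"] exI[of _ e]) (simp add: mon_single)
    next
      case False
      then obtain i where i: "i < q" "j = Y i" using Ysurj by blast
      have "single j e \<in> set EL" using EL_Y[OF i(1)] kE i(2) by simp
      then have "\<kappa> (single j e) \<in> set ks" "\<kappa> (single j e) \<in> K" "A (\<kappa> (single j e)) = single j e"
        using \<kappa> sEL unfolding ks_def by auto
      then show ?thesis using k(2) by (intro exI[of _ "\<kappa> (single j e)"] exI[of _ 1]) simp
    qed
  qed simp
  then obtain k0 ex where k0: "\<And>k. k \<in> T \<Longrightarrow> k0 k \<in> set ks" "\<And>k. k \<in> T \<Longrightarrow> k0 k \<in> K" "\<And>k. k \<in> T \<Longrightarrow> ex k \<noteq> 0"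
    "\<And>k z. k \<in> T \<Longrightarrow> mon (A k) z = mon (A (k0 k)) z ^ ex k" by metis
  have k0T: "k0 k \<notin> T" if "k \<in> T" for k using k0(1)[OF that] rest(1) unfolding T_def by blast
  \<comment> \<open>\<open>s\<close> lists the coordinates of f with those of \<open>Lin\<close>
    first, and \<open>\<tau>\<close> renames the i-th in this list to \<open>src i\<close>. On the
    target side \<open>\<theta>\<close> does the same for the components in the order
    \<open>al\<close>.\<close>
  define \<tau> where "\<tau> j = src (inv_into {..<?n} s j)" for j
  have "bij_betw (src \<circ> inv_into {..<?n} s) UNIV UNIV"
    by (rule bij_betw_trans[OF bij_betw_inv_into[OF s] src])
  then have \<tau>: "bij \<tau>" unfolding \<tau>_def o_def .
  have \<tau>s: "\<tau> (s i) = src i" if "i < ?n" for i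
    unfolding \<tau>_def using that s by (simp add: bij_betw_inv_into_left)
  define R where "R z = (\<chi> j. z $ \<tau> j)" for z :: "complex^'n"
  define \<theta> where "\<theta> v = al ! inv_into {..<CARD('p)} tgt v" for v
  have nth_al: "bij_betw ((!) al) {..<CARD('p)} UNIV"
    by (rule bij_betw_nth) (use al lal in auto)
  have "bij_betw ((!) al \<circ> inv_into {..<CARD('p)} tgt) UNIV UNIV"
    by (rule bij_betw_trans[OF bij_betw_inv_into[OF tgt] nth_al])
  then have \<theta>: "bij \<theta>" unfolding \<theta>_def o_def .
  define S where "S w = (\<chi> k. if k \<in> T then w $ k - w $ k0 k ^ ex k else w $ k)" for w :: "complex^'p"
  \<comment> \<open>The shear \<open>S\<close> turns the components in \<open>T\<close> into zeros,
    which h may contain.\<close>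
  define h where "h k = (if k \<in> K \<and> k \<notin> T then (\<lambda>z. mon (A k) (R z)) else (\<lambda>z. 0))" for k
  define hs where "hs = map h rest"
  define L where "L z = x_block src q z @ phi_block src q m z @ H_map src q lam mu hs z" for z
  define g where "g z = (\<chi> v. L z ! inv_into {..<CARD('p)} tgt v)" for z
  have "x_block src q z @ phi_block src q m z @ xy_block src q lam z @ yy_block src q mu z =
      map (\<lambda>a. mon a (R z)) EL" for z :: "complex^'n"
    unfolding EL_def
  proof (rule blocks_eq_map_mon[OF _ _ XY YY])
    show "xc src i z = R z $ X i" if "i < ?d" for i
      using \<tau>s[of i] sX[OF that] that by (simp add: xc_def R_def)
    show "yc src q j z = R z $ Y j" if "j < q" for j
      using \<tau>s[of "?d + j"] sY[of j] that dL(2) by (simp add: yc_def R_def)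
  qed
  then have L_eq: "L z = map (\<lambda>a. mon a (R z)) EL @ map (\<lambda>k. h k z) rest" for z
    unfolding L_def H_map_def hs_def by (simp add: o_def flip: append_assoc)
  have len: "length (L z) = CARD('p)" for z
    unfolding L_eq using lal unfolding al_def ks_def by simp
  have comps: "has_components tgt g L"
    unfolding has_components_def g_def using len tgt by (simp add: bij_betw_inv_into_left)
  have hs_ok: "monomial_or_zero c \<and> zero_on_axes c" if "c \<in> set hs" for c
  proof -
    obtain k where k: "k \<in> set rest" "c = h k" using \<open>c \<in> set hs\<close> unfolding hs_def by auto
    show ?thesis
    proof (cases "k \<in> K \<and> k \<notin> T")
      case False
      then have c0: "c = (\<lambda>z. 0)" unfolding k(2) h_def by (rule if_not_P)
      show ?thesis unfolding c0 monomial_or_zero_def zero_on_axes_def by simp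
    next
      case True
      then have c: "c = (\<lambda>z. mon (A k) (R z))" unfolding k(2) h_def by (rule if_P)
      have "mon (A k) (R z) = (\<Prod>i\<in>UNIV. z $ i ^ A k (inv \<tau> i))" for z
        unfolding mon_def R_def
        using prod.reindex_bij_betw[OF \<tau>, of "\<lambda>i. z $ i ^ A k (inv \<tau> i)"] \<tau>
        by (simp add: bij_is_inj)
      then have "monomial_or_zero c" unfolding c monomial_or_zero_def
        by (intro disjI1 exI[of _ "\<lambda>i. A k (inv \<tau> i)"] ext)
      moreover have "mon (A k) (R (axis i t)) = 0" for i t
      proof -
        have "R (axis i t) = axis (inv \<tau> i) t"
          using \<tau> by (auto simp: R_def vec_eq_iff axis_def bij_is_inj bij_is_surj surj_f_inv_f)
        \<comment> \<open>A left-over monomial outside \<open>T\<close> is not a power of one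
          coordinate, so it contains a second coordinate and vanishes on every axis.\<close>
        moreover have "\<not> (\<forall>m. m \<noteq> inv \<tau> i \<longrightarrow> A k m = 0)"
        proof
          assume "\<forall>m. m \<noteq> inv \<tau> i \<longrightarrow> A k m = 0"
          then have "A k = single (inv \<tau> i) (A k (inv \<tau> i))" by (auto simp: single_def fun_eq_iff)
          then have "k \<in> T" using True k(1) unfolding T_def by blast
          then show False using True by blast
        qed
        ultimately show ?thesis unfolding mon_axis by (metis (no_types, lifting) mon_axis)
      qed
      ultimately show ?thesis unfolding c zero_on_axes_def by blast
    qed
  qed
  have "normal_form_data q m lam mu hs"
    unfolding normal_form_data_def
  proof (intro conjI allI impI ballI)
    fix j assume j: "j < q"
    show "primitive (m j)" unfolding primitive_def set_m by (rule G)
    show "sorted_wrt (<) (m j)" unfolding m_def by simp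
    show "1 < e" if "e \<in> set (m j)" for e by (rule m1[OF j that])
  next
    show "1 \<le> lam i j" if "i < ?d" "j < q" for i j using lam(2)[OF that] by simp
    show "1 \<le> mu j t" if "j < q" "t < q" "t \<noteq> j" for j t using mu(2)[OF that] by simp
  qed (use hs_ok in blast)+
  then have nf: "normal_form src tgt q g"
    unfolding normal_form_def using comps unfolding L_def by blast
  have "inverse_germs S (\<lambda>w. \<chi> k. if k \<in> T then w $ k + w $ k0 k ^ ex k else w $ k)"
    unfolding S_def by (rule inverse_germs_shear) (use k0T k0(3) in auto)
  moreover have "inverse_germs (\<lambda>w :: complex^'p. \<chi> v. w $ \<theta> v) (\<lambda>w. \<chi> v. w $ inv \<theta> v)"
    using inverse_germs_permute[OF \<theta>] unfolding inverse_germs_def by blast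
  ultimately obtain \<psi>' where \<psi>: "inverse_germs (\<lambda>w. \<chi> v. S w $ \<theta> v) \<psi>'"
    using inverse_germs_compose by blast
  have \<rho>: "inverse_germs (\<lambda>z. \<chi> j. z $ inv \<tau> j) R"
    unfolding R_def by (rule inverse_germs_permute[OF \<tau>])
  have Rlim: "filterlim R (nhds 0) (nhds 0)"
    using \<rho> map_germ_filterlim unfolding inverse_germs_def by blast
  have "\<forall>\<^sub>F z in nhds (0 :: complex^'n). norm z < e" using e by (rule eventually_norm_less)
  then have "\<forall>\<^sub>F z in nhds 0. norm (R z) < e" using Rlim unfolding filterlim_iff by blast
  then have "\<forall>\<^sub>F z in nhds 0. g z = (\<chi> v. S (f (R z)) $ \<theta> v)"
  proof eventually_elim
    case (elim z)
    have fR: "f (R z) $ k = (if k \<in> K then mon (A k) (R z) else 0)" for k by (rule fz[OF elim])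
    have "L z ! l = S (f (R z)) $ (al ! l)" if l: "l < CARD('p)" for l
    proof (cases "l < length EL")
      case True
      have aE: "EL ! l \<in> E" using sEL True by (meson nth_mem subsetD)
      have al_l: "al ! l = \<kappa> (EL ! l)" using True by (simp add: al_def ks_def nth_append)
      have "\<kappa> (EL ! l) \<in> set ks" using True unfolding ks_def by simp
      then have nT: "\<kappa> (EL ! l) \<notin> T" using rest(1) unfolding T_def by blast
      have "L z ! l = mon (EL ! l) (R z)" unfolding L_eq using True by (simp add: nth_append)
      then show ?thesis unfolding al_l S_def using nT \<kappa>[OF aE] fR by simp
    next
      case False
      define k where "k = rest ! (l - length EL)"
      have al_l: "al ! l = k" using False by (simp add: al_def ks_def nth_append k_def)
      have lr: "l - length EL < length rest" using False l lal by (simp add: al_def ks_def)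
      have Lz: "L z ! l = h k z" unfolding L_eq using False lr by (simp add: nth_append k_def)
      show ?thesis
      proof (cases "k \<in> T")
        case True
        then have kK: "k \<in> K" unfolding T_def by blast
        have "S (f (R z)) $ k = mon (A k) (R z) - mon (A (k0 k)) (R z) ^ ex k"
          unfolding S_def using True kK k0(2)[OF True] fR by simp
        also have "\<dots> = 0" using k0(4)[OF True] by simp
        finally show ?thesis unfolding Lz al_l h_def using True by simp
      next
        case nT: False
        show ?thesis unfolding Lz al_l h_def S_def using nT fR by simp
      qed
    qed
    moreover have "inv_into {..<CARD('p)} tgt v < CARD('p)" for v
      using bij_betw_inv_into[OF tgt] unfolding bij_betw_def by blast
    ultimately show ?case unfolding g_def \<theta>_def by (simp add: vec_eq_iff)
  qed
  then have "A_equivalent f g" unfolding A_equivalent_def using \<rho> \<psi> by blast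
  then show ?thesis using nf by blast
qed

text \<open>When all exponents are 1, the rule against duplicates discards every t < j, so that
  block j runs over t > j.\<close>

lemma H_map_eq_H_map_simple:
  assumes mu: "\<And>j t. j < q \<Longrightarrow> t < q \<Longrightarrow> t \<noteq> j \<Longrightarrow> mu j t = 1"
  shows "H_map src q lam mu hs z = H_map_simple src q lam hs z"
proof -
  have "concat (map (\<lambda>t. if t \<noteq> j \<and> \<not> (t < j \<and> mu j t = 1 \<and> mu t j = 1)
      then [yc src q j z ^ mu j t * yc src q t z] else []) [0..<q]) =
      map (\<lambda>t. yc src q j z * yc src q t z) [Suc j..<q]" if j: "j < q" for j
  proof -
    have split: "[0..<q] = [0..<Suc j] @ [Suc j..<q]"
      using j upt_add_eq_append[of 0 "Suc j" "q - Suc j"] by simp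
    have low: "concat (map (\<lambda>t. if t \<noteq> j \<and> \<not> (t < j \<and> mu j t = 1 \<and> mu t j = 1)
        then [yc src q j z ^ mu j t * yc src q t z] else []) [0..<Suc j]) = []"
      using mu j by (auto simp: concat_eq_Nil_conv less_Suc_eq)
    have high: "map (\<lambda>t. if t \<noteq> j \<and> \<not> (t < j \<and> mu j t = 1 \<and> mu t j = 1)
        then [yc src q j z ^ mu j t * yc src q t z] else []) [Suc j..<q] =
        map (\<lambda>t. [yc src q j z * yc src q t z]) [Suc j..<q]"
      using mu j by (intro map_cong) auto
    have flat: "concat (map (\<lambda>t. [yc src q j z * yc src q t z]) ts) = map (\<lambda>t. yc src q j z * yc src q t z) ts" for ts
      by (induction ts) auto
    show ?thesis unfolding split map_append concat_append low high flat by simp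
  qed
  then have "yy_block src q mu z = concat (map (\<lambda>j. map (\<lambda>t. yc src q j z * yc src q t z) [Suc j..<q]) [0..<q])"
    unfolding yy_block_def by (intro arg_cong[where f = concat] map_cong) auto
  then show ?thesis unfolding H_map_def H_map_simple_def by simp
qed

theorem theorem4p4:
  fixes f :: "complex^'n \<Rightarrow> complex^'p"
    and q :: nat
    and src :: "nat \<Rightarrow> 'n"
    and tgt :: "nat \<Rightarrow> 'p"
  assumes "bij_betw src {..<CARD('n)} UNIV"
    and "bij_betw tgt {..<CARD('p)} UNIV"
    and "map_germ f"
    and "monomial_germ f"
    and "singular f"
    and "corank f = q"
    and "CARD('p) \<ge> 2 * CARD('n)"
  shows "(A_finite f \<longleftrightarrow> (\<exists>g. normal_form src tgt q g \<and> A_equivalent f g)) \<and>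
    (\<forall>m lam mu (hs :: (complex^'n \<Rightarrow> complex) list).
       normal_form_data q m lam mu hs \<and> (\<forall>j<q. \<forall>t<q. t \<noteq> j \<longrightarrow> mu j t = 1) \<longrightarrow>
       (\<forall>z. H_map src q lam mu hs z = H_map_simple src q lam hs z))"
proof (intro conjI iffI allI impI)
  assume "A_finite f"
  then obtain r where r: "\<And>g. map_germ g \<Longrightarrow> same_jet r f g \<Longrightarrow> A_equivalent g f"
    unfolding A_finite_def by blast
  obtain g :: "complex^'n \<Rightarrow> complex^'p" where g: "map_germ g" "same_jet r f g" "\<not> degenerate g"
    using perturbation_not_degenerate[OF assms(3,4,7)] by blast
  \<comment> \<open>Finite determinacy is used for one germ only: the nondegenerate perturbation
    with the same r-jet.\<close>
  have "A_equivalent f g" by (rule A_equivalent_sym[OF g(1) r[OF g(1,2)]])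
  then have "\<not> degenerate f" using degenerate_A_equivalent[OF assms(3)] g(3) by blast
  then have "axis_conditions (germ_exponents f)"
    using not_axis_conditions_imp_degenerate[OF assms(3,4)] by blast
  then show "\<exists>g. normal_form src tgt q g \<and> A_equivalent f g"
    by (rule axis_conditions_imp_normal_form[OF assms(1,2,3,4,6)])
next
  assume "\<exists>g. normal_form src tgt q g \<and> A_equivalent f g"
  then obtain g where g: "normal_form src tgt q g" "A_equivalent f g" by blast
  have "q \<le> CARD('n)" using assms(6) unfolding corank_def by simp
  \<comment> \<open>The axis conditions hold for the exponents of g. They are passed to f by way of
    nondegeneracy, from which they are recovered because f is monomial.\<close>
  then have "\<not> degenerate g"
    using normal_form_imp_axis_conditions[OF assms(1) _ g(1)] axis_conditions_not_degenerate by blast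
  then have "\<not> degenerate f" using degenerate_A_equivalent[OF assms(3) g(2)] by blast
  then have "axis_conditions (germ_exponents f)"
    using not_axis_conditions_imp_degenerate[OF assms(3,4)] by blast
  then show "A_finite f" by (rule axis_conditions_imp_A_finite[OF assms(3)])
next
  fix m lam mu and hs :: "(complex^'n \<Rightarrow> complex) list" and z
  assume "normal_form_data q m lam mu hs \<and> (\<forall>j<q. \<forall>t<q. t \<noteq> j \<longrightarrow> mu j t = 1)"
  then show "H_map src q lam mu hs z = H_map_simple src q lam hs z"
    by (intro H_map_eq_H_map_simple) blast
qed

end
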